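(* Let $P \subset \mathbb{R}^n$ be a smooth $n$-dimensional $\mathbb{Q}$-normal lattice polytope. Then $\operatorname{codeg}(P) \geq \frac{n+1}{2}$ if and only if $P$ is affinely isomorphic to one of the following polytopes: (i) $s\Delta_1$ for some integer $s\geq 1$ (here $n=1$); (ii) $3\Delta_3$ (here $n=3$); (iii) $2\Delta_n$; (iv) $\operatorname{Cayley}^1(P_0, \ldots, P_k)$ for some $k \geq \frac{n-1}{2}$ and some lattice polytopes $P_0,\dots,P_k$ (all of the same dimension and with the same normal fan); (v) $\operatorname{Cayley}^2(a_0\Delta_1, a_1\Delta_1, \ldots, a_{n-1}\Delta_1)$, where $n$ is odd and $a_0,\dots,a_{n-1}$ are positive integers all congruent modulo $2$.
   Context: A lattice polytope is the convex hull of finitely many points of $\mathbb{Z}^n$; affine isomorphisms are lattice-preserving affine isomorphisms. $\Delta_n$ denotes the standard $n$-dimensional unimodular simplex, and $s\Delta_n$ its $s$-th dilate. An $n$-dimensional lattice polytope $P\subset\mathbb{R}^n$ is smooth if exactly $n$ facets meet at each vertex and the primitive inner normal vectors of these facets form a basis of $\mathbb{Z}^n$. The codegree $\operatorname{codeg}(P)$ is the smallest positive integer $c$ such that $cP$ contains a lattice point in its interior. Adjoint polytopes: if $P$ has facet presentation $P=\{x : \langle \eta_i,x\rangle\ge -a_i,\ 1\le i\le r\}$ with $\eta_i$ the primitive inner facet normals, then for $t\ge 0$ set $P^{(t)}=\{x : \langle \eta_i,x\rangle\ge -a_i+t,\ 1\le i\le r\}$. Let $\sigma(P)=\sup\{t\ge0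 : P^{(t)}\neq\varnothing\}$ and $\lambda(P)=\sup\{t\ge 0: P^{(t)}\ne\varnothing \text{ and the normal fan of } P^{(t)} \text{ equals that of } P\}$. $P$ is called $\mathbb{Q}$-normal if $\sigma(P)=\lambda(P)$. Generalized Cayley polytopes: for $m$-dimensional lattice polytopes $P_0,\dots,P_k\subset\mathbb{R}^m$ and a positive integer $s$, $[P_0*\cdots*P_k]^s=\operatorname{Conv}(P_0\times\{0\},P_1\times\{se_1\},\dots,P_k\times\{se_k\})\subset\mathbb{R}^m\times\mathbb{R}^k$, where $e_1,\dots,e_k$ is a basis of $\mathbb{Z}^k$. When all $P_i$ have the same normal fan, this polytope is denoted $\operatorname{Cayley}^s(P_0,\dots,P_k)$ (a strict $s$-th order generalized Cayley polytope). *)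

theory Defs
  imports "HOL-Analysis.Analysis" "HOL-Library.Function_Algebras"
begin

section \<open>Points of R^n as functions nat => real vanishing outside {0..<n}\<close>

instantiation "fun" :: (type, real_vector) real_vector
begin
definition scaleR_fun :: "real \<Rightarrow> ('a \<Rightarrow> 'b) \<Rightarrow> 'a \<Rightarrow> 'b"
  where "scaleR_fun r f = (\<lambda>x. r *\<^sub>R f x)"
instance
  by standard (simp_all add: scaleR_fun_def fun_eq_iff scaleR_add_right scaleR_add_left)
end

type_synonym pt = "nat \<Rightarrow> real"

definition Rn :: "nat \<Rightarrow> pt set" where
  "Rn n = {x. \<forall>i\<ge>n. x i = 0}"

definition Zn :: "nat \<Rightarrow> pt set" where
  "Zn n = {x \<in> Rn n. \<forall>i. x i \<in> \<int>}"

definition unitv :: "nat \<Rightarrow> pt" where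
  "unitv j = (\<lambda>i. if i = j then 1 else 0)"

definition ip :: "nat \<Rightarrow> pt \<Rightarrow> pt \<Rightarrow> real" where
  "ip n u x = (\<Sum>i<n. u i * x i)"

definition lattice_polytope :: "nat \<Rightarrow> pt set \<Rightarrow> bool" where
  "lattice_polytope n P \<longleftrightarrow>
     (\<exists>V. finite V \<and> V \<noteq> {} \<and> V \<subseteq> Zn n \<and> P = convex hull V)"

definition full_dim :: "nat \<Rightarrow> pt set \<Rightarrow> bool" where
  "full_dim n P \<longleftrightarrow> affine hull P = Rn n"

definition interior_n :: "nat \<Rightarrow> pt set \<Rightarrow> pt set" where
  "interior_n n S = {x \<in> Rn n. \<exists>e>0. \<forall>y\<in>Rn n. (\<forall>i<n. \<bar>y i - x i\<bar> < e) \<longrightarrow> y \<in> S}"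

definition codeg :: "nat \<Rightarrow> pt set \<Rightarrow> nat" where
  "codeg n P = (LEAST c::nat. c > 0 \<and>
      (\<exists>z \<in> Zn n. z \<in> interior_n n ((\<lambda>x. real c *\<^sub>R x) ` P)))"

text \<open>Minimum of the linear functional u on P (equals -a_i in the facet presentation).\<close>
definition minval :: "nat \<Rightarrow> pt set \<Rightarrow> pt \<Rightarrow> real" where
  "minval n P u = Inf ((\<lambda>x. ip n u x) ` P)"

definition primitive :: "nat \<Rightarrow> pt \<Rightarrow> bool" where
  "primitive n u \<longleftrightarrow> u \<in> Zn n \<and> u \<noteq> 0 \<and>
     (\<forall>d::int. d \<ge> 1 \<longrightarrow> (\<forall>i<n. u i / of_int d \<in> \<int>) \<longrightarrow> d = 1)"

definition facet_normal :: "nat \<Rightarrow> pt set \<Rightarrow> pt \<Rightarrow> bool" where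
  "facet_normal n P u \<longleftrightarrow> primitive n u \<and>
     affine hull {x \<in> P. ip n u x = minval n P u} = {x \<in> Rn n. ip n u x = minval n P u}"

definition lattice_basis :: "nat \<Rightarrow> pt set \<Rightarrow> bool" where
  "lattice_basis n B \<longleftrightarrow> finite B \<and> B \<subseteq> Zn n \<and>
     (\<forall>z \<in> Zn n. \<exists>c::pt \<Rightarrow> int. z = (\<Sum>b\<in>B. of_int (c b) *\<^sub>R b)) \<and>
     (\<forall>c::pt \<Rightarrow> int. (\<Sum>b\<in>B. of_int (c b) *\<^sub>R b) = 0 \<longrightarrow> (\<forall>b\<in>B. c b = 0))"

definition smooth :: "nat \<Rightarrow> pt set \<Rightarrow> bool" where
  "smooth n P \<longleftrightarrow> (\<forall>v. v extreme_point_of P \<longrightarrow>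
     (let B = {u. facet_normal n P u \<and> ip n u v = minval n P u}
      in finite B \<and> card B = n \<and> lattice_basis n B))"

definition adjoint :: "nat \<Rightarrow> pt set \<Rightarrow> real \<Rightarrow> pt set" where
  "adjoint n P t = {x \<in> Rn n. \<forall>u. facet_normal n P u \<longrightarrow> ip n u x \<ge> minval n P u + t}"

definition normal_cone :: "nat \<Rightarrow> pt set \<Rightarrow> pt \<Rightarrow> pt set" where
  "normal_cone n P x = {u \<in> Rn n. \<forall>y\<in>P. ip n u x \<le> ip n u y}"

definition normal_fan :: "nat \<Rightarrow> pt set \<Rightarrow> pt set set" where
  "normal_fan n P = normal_cone n P ` P"

definition sigma_P :: "nat \<Rightarrow> pt set \<Rightarrow> real" where
  "sigma_P n P = Sup {t. t \<ge> 0 \<and> adjoint n P t \<noteq> {}}"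

definition lambda_P :: "nat \<Rightarrow> pt set \<Rightarrow> real" where
  "lambda_P n P = Sup {t. t \<ge> 0 \<and> adjoint n P t \<noteq> {} \<and>
                       normal_fan n (adjoint n P t) = normal_fan n P}"

definition Q_normal :: "nat \<Rightarrow> pt set \<Rightarrow> bool" where
  "Q_normal n P \<longleftrightarrow> sigma_P n P = lambda_P n P"

definition dil_simplex :: "nat \<Rightarrow> nat \<Rightarrow> pt set" where
  "dil_simplex n s = convex hull (insert 0 {real s *\<^sub>R unitv i | i. i < n})"

text \<open>[P_0 * ... * P_k]^s in R^m x R^k = R^(m+k); the R^k factor uses coordinates m..m+k-1.\<close>
definition gen_cayley :: "nat \<Rightarrow> nat \<Rightarrow> nat \<Rightarrow> (nat \<Rightarrow> pt set) \<Rightarrow> pt set" where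
  "gen_cayley m k s Ps = convex hull
     (\<Union>i\<le>k. (\<lambda>x. x + (if i = 0 then 0 else real s *\<^sub>R unitv (m + i - 1))) ` Ps i)"

definition aff_map :: "nat \<Rightarrow> (nat \<Rightarrow> nat \<Rightarrow> int) \<Rightarrow> (nat \<Rightarrow> int) \<Rightarrow> pt \<Rightarrow> pt" where
  "aff_map n A b x = (\<lambda>i. if i < n then (\<Sum>j<n. of_int (A i j) * x j) + of_int (b i) else 0)"

definition unimodular :: "nat \<Rightarrow> (nat \<Rightarrow> nat \<Rightarrow> int) \<Rightarrow> bool" where
  "unimodular n A \<longleftrightarrow> (\<exists>B. \<forall>i<n. \<forall>j<n.
      (\<Sum>l<n. A i l * B l j) = (if i = j then 1 else 0) \<and>
      (\<Sum>l<n. B i l * A l j) = (if i = j then 1 else 0))"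

definition lattice_iso :: "nat \<Rightarrow> pt set \<Rightarrow> nat \<Rightarrow> pt set \<Rightarrow> bool" where
  "lattice_iso n P m Q \<longleftrightarrow> m = n \<and>
     (\<exists>A b. unimodular n A \<and> aff_map n A b ` P = Q)"

end

theory Submission
  imports Defs
begin

text \<open>
  Write \<open>\<sigma>\<close> for \<open>\<sigma>(P)\<close>. Moving all facets inwards by \<open>t \<le> \<sigma>\<close> moves each vertex \<open>v\<close> of \<open>P\<close> to a point
  \<open>v\<^sub>t\<close> on the shifted facets through \<open>v\<close>, and Q-normality says that \<open>v\<^sub>t\<close> stays in the adjoint polytope up
  to \<open>t = \<sigma>\<close>. Clearing denominators in \<open>v\<^sub>t\<close> gives interior lattice points, hence \<open>(codeg P - 1) \<sigma> < 1\<close>.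
  Since \<open>\<sigma>\<close> is maximal, some facet is tight at all points \<open>v\<^sub>\<sigma>\<close>, and therefore the facet normals satisfy a
  nonnegative integral relation on which the sum of the numbers \<open>a\<^sub>i - \<sigma>\<close> vanishes. A shortest such
  relation has the form \<open>u\<^sub>0 + \<dots> + u\<^sub>k = 0\<close> for a primitive collection of facet normals, so
  \<open>s = a\<^sub>0 + \<dots> + a\<^sub>k = (k + 1) \<sigma>\<close> is a positive integer and \<open>P\<close> projects to \<open>s \<Delta>\<^sub>k\<close>. If
  \<open>codeg P \<ge> (n + 1) / 2\<close> then \<open>\<lfloor>n / 2\<rfloor> s < k + 1 \<le> n + 1\<close>, which leaves \<open>s = 1\<close>, \<open>k = n\<close>, or \<open>s = 2\<close> with
  \<open>k = n - 1\<close> and \<open>n\<close> odd. In each case all vertices of \<open>P\<close> lie over vertices of \<open>s \<Delta>\<^sub>k\<close>; smoothness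
  along the edges between the fibres then forces all fibres to have the same normal fan.

  Conversely, the barycentric coordinates of \<open>s \<Delta>\<^sub>k\<close> are \<open>k + 1\<close> integral affine forms with sum \<open>s\<close>,
  each of which is at least \<open>1\<close> at an interior lattice point of a dilate of \<open>P\<close>.
\<close>

section \<open>Farkas' lemma and facets of lattice polytopes\<close>

text \<open>\<open>smooth\<close>, \<open>adjoint\<close> and \<open>Q_normal\<close> speak of
  primitive facet normals, while a lattice polytope is given as the hull of finitely many integral
  points. That there are enough integral normals to cut out \<open>P\<close> is a theorem here and
  rests on Farkas' lemma.

  The number \<open>n div 2\<close> in the bound is the integral lower bound for
  \<open>codeg n P - 1\<close>. For \<open>s = 2\<close> and \<open>k = n - 1\<close> the heights of
  a vertex over the collection are at first only integers; they are also integral multiples of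
  \<sigma> = 2 / n, and for odd \<open>n\<close> both facts together make them even.

  Fibres are compared vertex by vertex. Vertices of two fibres that lie on the same facets outside
  the collection have the same edge directions along the fibre, and their difference is
  \<open>s\<close> times an integral vector. The first fact matches the normal fans, the second
  gives the congruence modulo 2 in the last family.\<close>

lemma sum_fun_apply: "(\<Sum>j\<in>J. f j) i = (\<Sum>j\<in>J. f j (i::nat) :: real)"
  by (induction J rule: infinite_finite_induct) auto

lemma scaleR_pt_apply: "(r *\<^sub>R (x::pt)) i = r * x i"
  by (simp add: scaleR_fun_def)

lemma ip_zero [simp]: "ip n 0 x = 0" "ip n u 0 = 0"
  by (simp_all add: ip_def)

lemma ip_add: "ip n (u + w) x = ip n u x + ip n w x" "ip n u (x + y) = ip n u x + ip n u y"
  by (simp_all add: ip_def algebra_simps sum.distrib)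

lemma ip_minus: "ip n (- u) x = - ip n u x" "ip n u (- x) = - ip n u x"
  by (simp_all add: ip_def sum_negf)

lemma ip_diff: "ip n (u - w) x = ip n u x - ip n w x" "ip n u (x - y) = ip n u x - ip n u y"
  by (simp_all add: ip_def algebra_simps sum_subtractf)

lemma ip_scaleR: "ip n (r *\<^sub>R u) x = r * ip n u x" "ip n u (r *\<^sub>R x) = r * ip n u x"
  by (simp_all add: ip_def scaleR_pt_apply algebra_simps sum_distrib_left)

lemma ip_sum: "ip n (\<Sum>j\<in>J. f j) x = (\<Sum>j\<in>J. ip n (f j) x)"
  "ip n u (\<Sum>j\<in>J. f j) = (\<Sum>j\<in>J. ip n u (f j))"
  by (induction J rule: infinite_finite_induct) (simp_all add: ip_add)

lemmas ip_simps = ip_add ip_minus ip_diff ip_scaleR ip_sum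

lemma ip_commute: "ip n u x = ip n x u"
  by (simp add: ip_def mult.commute)

lemma ip_self_eq_0:
  assumes "x \<in> Rn n" "ip n x x = 0"
  shows "x = 0"
proof
  fix i
  have "\<forall>i\<in>{..<n}. x i * x i = 0"
    using assms(2) unfolding ip_def by (subst (asm) sum_nonneg_eq_0_iff) auto
  then show "x i = 0 i"
    using assms(1) by (cases "i < n") (auto simp: Rn_def)
qed

lemma ip_self_pos:
  assumes "x \<in> Rn n" "x \<noteq> 0"
  shows "ip n x x > 0"
proof -
  have "ip n x x \<ge> 0" unfolding ip_def by (intro sum_nonneg) simp
  then show ?thesis using ip_self_eq_0[of x n] assms by force
qed

lemma subspace_Rn: "subspace (Rn n)"
  by (auto simp: subspace_def Rn_def scaleR_pt_apply)

lemma Rn_closed: "0 \<in> Rn n" "x \<in> Rn n \<Longrightarrow> y \<in> Rn n \<Longrightarrow> x + y \<in> Rn n"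
  "x \<in> Rn n \<Longrightarrow> y \<in> Rn n \<Longrightarrow> x - y \<in> Rn n" "x \<in> Rn n \<Longrightarrow> - x \<in> Rn n"
  "x \<in> Rn n \<Longrightarrow> r *\<^sub>R x \<in> Rn n" "(\<And>j. j \<in> J \<Longrightarrow> f j \<in> Rn n) \<Longrightarrow> (\<Sum>j\<in>J. f j) \<in> Rn n"
  using subspace_Rn[of n] by (auto simp: subspace_def subspace_diff subspace_neg subspace_sum)

lemma Zn_subset_Rn: "Zn n \<subseteq> Rn n"
  by (auto simp: Zn_def)

lemma Zn_closed: "0 \<in> Zn n" "x \<in> Zn n \<Longrightarrow> y \<in> Zn n \<Longrightarrow> x + y \<in> Zn n"
  "x \<in> Zn n \<Longrightarrow> y \<in> Zn n \<Longrightarrow> x - y \<in> Zn n" "x \<in> Zn n \<Longrightarrow> - x \<in> Zn n"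
  "x \<in> Zn n \<Longrightarrow> r \<in> \<int> \<Longrightarrow> r *\<^sub>R x \<in> Zn n" "(\<And>j. j \<in> J \<Longrightarrow> f j \<in> Zn n) \<Longrightarrow> (\<Sum>j\<in>J. f j) \<in> Zn n"
  by (auto simp: Zn_def Rn_closed sum_fun_apply scaleR_pt_apply)

lemma ip_Ints: "u \<in> Zn n \<Longrightarrow> x \<in> Zn n \<Longrightarrow> ip n u x \<in> \<int>"
  by (auto simp: ip_def Zn_def)

lemma unitv_Zn: "i < n \<Longrightarrow> unitv i \<in> Zn n"
  by (auto simp: Zn_def Rn_def unitv_def)

lemma ip_unitv:
  assumes "i < n"
  shows "ip n (unitv i) x = x i" "ip n x (unitv i) = x i"
proof -
  have "ip n (unitv i) x = (\<Sum>j<n. if j = i then x i else 0)"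
    unfolding ip_def unitv_def by (intro sum.cong) auto
  then show "ip n (unitv i) x = x i" using assms by simp
  then show "ip n x (unitv i) = x i" by (simp add: ip_commute)
qed

lemma pt_expand:
  assumes "x \<in> Rn n"
  shows "x = (\<Sum>i<n. x i *\<^sub>R unitv i)"
proof
  fix j
  have "(\<Sum>i<n. x i *\<^sub>R unitv i) j = (\<Sum>i<n. if i = j then x j else 0)"
    unfolding sum_fun_apply unitv_def scaleR_pt_apply by (intro sum.cong) auto
  then show "x j = (\<Sum>i<n. x i *\<^sub>R unitv i) j"
    using assms by (auto simp: Rn_def)
qed

text \<open>The induction step projects along the last generator, so the family has to be arbitrary.\<close>

lemma farkas:
  assumes "finite J" "\<And>j. j \<in> J \<Longrightarrow> \<alpha> j \<in> Rn n" "\<gamma> \<in> Rn n"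
  shows "(\<exists>c. (\<forall>j\<in>J. c j \<ge> (0::real)) \<and> \<gamma> = (\<Sum>j\<in>J. c j *\<^sub>R \<alpha> j)) \<or>
         (\<exists>u\<in>Rn n. (\<forall>j\<in>J. ip n u (\<alpha> j) \<ge> 0) \<and> ip n u \<gamma> < 0)"
  using assms
proof (induction J arbitrary: \<alpha> \<gamma> rule: finite_induct)
  case empty
  show ?case
  proof (cases "\<gamma> = 0")
    case False
    then have "ip n (- \<gamma>) \<gamma> < 0"
      using ip_self_pos[OF empty(2) False] by (simp add: ip_simps)
    then show ?thesis using Rn_closed(4)[OF empty(2)] by (metis empty_iff)
  qed auto
next
  case (insert m J)
  have R: "\<And>j. j \<in> J \<Longrightarrow> \<alpha> j \<in> Rn n" "\<alpha> m \<in> Rn n" using insert by auto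
  consider c where "\<forall>j\<in>J. c j \<ge> (0::real)" "\<gamma> = (\<Sum>j\<in>J. c j *\<^sub>R \<alpha> j)"
    | x where "x \<in> Rn n" "\<forall>j\<in>J. ip n x (\<alpha> j) \<ge> 0" "ip n x \<gamma> < 0" "ip n x (\<alpha> m) \<ge> 0"
    | x where "x \<in> Rn n" "\<forall>j\<in>J. ip n x (\<alpha> j) \<ge> 0" "ip n x \<gamma> < 0" "ip n x (\<alpha> m) < 0"
  proof -
    have "(\<exists>c. (\<forall>j\<in>J. c j \<ge> (0::real)) \<and> \<gamma> = (\<Sum>j\<in>J. c j *\<^sub>R \<alpha> j)) \<or>
         (\<exists>u\<in>Rn n. (\<forall>j\<in>J. ip n u (\<alpha> j) \<ge> 0) \<and> ip n u \<gamma> < 0)"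
      by (rule insert.IH) (use R insert.prems in auto)
    then show thesis using that not_le by blast
  qed
  then show ?case
  proof cases
    case (1 c)
    have "(\<Sum>j\<in>insert m J. (c(m := 0)) j *\<^sub>R \<alpha> j) = (\<Sum>j\<in>J. c j *\<^sub>R \<alpha> j)"
      using insert.hyps by (auto intro!: sum.cong)
    then show ?thesis using 1 by (intro disjI1 exI[of _ "c(m := 0)"]) auto
  next
    case 2
    then show ?thesis by auto
  next
    case (3 x)
    define r where "r j = ip n x (\<alpha> j) / ip n x (\<alpha> m)" for j
    define g where "g = ip n x \<gamma> / ip n x (\<alpha> m)"
    define \<alpha>' where "\<alpha>' j = \<alpha> j - r j *\<^sub>R \<alpha> m" for j
    define \<gamma>' where "\<gamma>' = \<gamma> - g *\<^sub>R \<alpha> m"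
    have r: "r j \<le> 0" if "j \<in> J" for j using 3 that by (auto simp: r_def divide_nonneg_neg)
    have g: "g > 0" using 3 by (auto simp: g_def divide_neg_neg)
    have R': "\<And>j. j \<in> J \<Longrightarrow> \<alpha>' j \<in> Rn n" "\<gamma>' \<in> Rn n"
      using R insert.prems by (auto simp: \<alpha>'_def \<gamma>'_def Rn_closed)
    consider c where "\<forall>j\<in>J. c j \<ge> (0::real)" "\<gamma>' = (\<Sum>j\<in>J. c j *\<^sub>R \<alpha>' j)"
      | y where "y \<in> Rn n" "\<forall>j\<in>J. ip n y (\<alpha>' j) \<ge> 0" "ip n y \<gamma>' < 0"
    proof -
      have "(\<exists>c. (\<forall>j\<in>J. c j \<ge> (0::real)) \<and> \<gamma>' = (\<Sum>j\<in>J. c j *\<^sub>R \<alpha>' j)) \<or>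
         (\<exists>u\<in>Rn n. (\<forall>j\<in>J. ip n u (\<alpha>' j) \<ge> 0) \<and> ip n u \<gamma>' < 0)"
        by (rule insert.IH) (use R' in auto)
      then show thesis using that by blast
    qed
    then show ?thesis
    proof cases
      case (1 c)
      define k where "k = g - (\<Sum>j\<in>J. c j * r j)"
      have "(\<Sum>j\<in>J. c j * r j) \<le> 0" using 1 r by (intro sum_nonpos) (simp add: mult_nonneg_nonpos)
      then have k: "k \<ge> 0" using g by (simp add: k_def)
      have "\<gamma> = k *\<^sub>R \<alpha> m + (\<Sum>j\<in>J. c j *\<^sub>R \<alpha> j)"
        using 1(2) by (simp add: \<gamma>'_def \<alpha>'_def k_def algebra_simps sum_subtractf scaleR_left.sum)
      moreover have "(\<Sum>j\<in>insert m J. (c(m := k)) j *\<^sub>R \<alpha> j) = k *\<^sub>R \<alpha> m + (\<Sum>j\<in>J. c j *\<^sub>R \<alpha> j)"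
        using insert.hyps by (auto intro!: sum.cong)
      ultimately show ?thesis using 1 k by (intro disjI1 exI[of _ "c(m := k)"]) auto
    next
      case (2 y)
      define u where "u = y - (ip n y (\<alpha> m) / ip n x (\<alpha> m)) *\<^sub>R x"
      have "ip n u (\<alpha> m) = 0" using 3 by (simp add: u_def ip_simps)
      moreover have "ip n u (\<alpha> j) = ip n y (\<alpha>' j)" for j
        by (simp add: u_def \<alpha>'_def r_def ip_simps)
      moreover have "ip n u \<gamma> = ip n y \<gamma>'"
        by (simp add: u_def \<gamma>'_def g_def ip_simps)
      moreover have "u \<in> Rn n" using 2 3 by (simp add: u_def Rn_closed)
      ultimately show ?thesis using 2 by (intro disjI2 bexI[of _ u]) auto
    qed
  qed
qed

text \<open>Farkas' lemma for the vectors of \<open>T\<close> together with their negatives: the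
  cone they generate is \<open>span T\<close>, and a functional nonnegative on \<open>t\<close> and
  on \<open>- t\<close> vanishes on \<open>t\<close>.\<close>

lemma not_in_span_separated:
  assumes "finite T" "T \<subseteq> Rn n" "y \<in> Rn n" "y \<notin> span T"
  obtains w where "w \<in> Rn n" "\<forall>t\<in>T. ip n w t = 0" "ip n w y \<noteq> 0"
proof -
  have fin: "finite (T \<union> uminus ` T)" using assms by simp
  have R: "j \<in> Rn n" if "j \<in> T \<union> uminus ` T" for j
    using that assms(2) Rn_closed(4) by auto
  have "\<not> (\<exists>c. (\<forall>j\<in>T \<union> uminus ` T. c j \<ge> (0::real)) \<and> y = (\<Sum>j\<in>T \<union> uminus ` T. c j *\<^sub>R j))"
  proof
    assume "\<exists>c. (\<forall>j\<in>T \<union> uminus ` T. c j \<ge> (0::real)) \<and> y = (\<Sum>j\<in>T \<union> uminus ` T. c j *\<^sub>R j)"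
    then obtain c where "y = (\<Sum>j\<in>T \<union> uminus ` T. c j *\<^sub>R j)" by blast
    also have "\<dots> \<in> span T"
      by (intro span_sum span_scale) (auto intro: span_base span_neg)
    finally show False using assms by blast
  qed
  then obtain w where w: "w \<in> Rn n" "\<forall>j\<in>T \<union> uminus ` T. ip n w j \<ge> 0" "ip n w y < 0"
    using farkas[OF fin, of "\<lambda>j. j" n y] R assms(3) by blast
  have "ip n w t = 0" if "t \<in> T" for t
  proof -
    have "ip n w t \<ge> 0" "ip n w (- t) \<ge> 0" using w that by auto
    then show ?thesis by (simp add: ip_simps)
  qed
  then show ?thesis using that w by force
qed

text \<open>A generating subset of least cardinality is irredundant: no member lies in the hull of
  the others, which makes each an extreme point. This is Krein-Milman for finitely many points in a
  bare real vector space.\<close>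

lemma finite_convex_hull_extreme:
  fixes V :: "'a::real_vector set"
  assumes "finite V"
  shows "convex hull V = convex hull {x. x extreme_point_of (convex hull V)}"
proof -
  define W where "W = (ARG_MIN card W. W \<subseteq> V \<and> convex hull W = convex hull V)"
  have W: "W \<subseteq> V \<and> convex hull W = convex hull V"
    unfolding W_def by (rule arg_min_natI[of _ V]) simp
  have min: "card W \<le> card W'" if "W' \<subseteq> V" "convex hull W' = convex hull V" for W'
    unfolding W_def by (rule arg_min_nat_le) (use that in simp)
  have fin: "finite W" using W assms finite_subset by blast
  have "w extreme_point_of (convex hull V)" if "w \<in> W" for w
  proof -
    have ins: "insert w (W - {w}) = W" using that by blast
    have "w \<notin> convex hull (W - {w})"
    proof
      assume "w \<in> convex hull (W - {w})"
      then have "convex hull (W - {w}) = convex hull V" using hull_redundant[of w convex "W - {w}"] ins W by simp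
      then have "card W \<le> card (W - {w})" using W by (intro min) auto
      then show False using that fin by (meson card_Diff1_less not_le)
    qed
    then show ?thesis
      using extreme_point_of_convex_hull_insert[of "W - {w}" w] fin ins W by simp
  qed
  then have "W \<subseteq> {x. x extreme_point_of (convex hull V)}" by blast
  then have "convex hull V \<subseteq> convex hull {x. x extreme_point_of (convex hull V)}"
    using W hull_mono[of W] by metis
  moreover have "convex hull {x. x extreme_point_of (convex hull V)} \<subseteq> convex hull V"
    by (intro hull_minimal) (auto simp: extreme_point_of_def)
  ultimately show ?thesis by blast
qed

lemma minval_eq:
  assumes "v \<in> P" "\<And>x. x \<in> P \<Longrightarrow> ip n u v \<le> ip n u x"
  shows "minval n P u = ip n u v"
  unfolding minval_def by (rule cInf_eq_minimum) (use assms in auto)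

lemma convex_ip_ge: "convex {x. c \<le> ip n u x}"
proof (rule convexI)
  fix x y and a b :: real
  assume "x \<in> {x. c \<le> ip n u x}" "y \<in> {x. c \<le> ip n u x}" "0 \<le> a" "0 \<le> b" "a + b = 1"
  moreover from this have "a * c + b * c \<le> a * ip n u x + b * ip n u y"
    by (intro add_mono mult_left_mono) auto
  moreover have "a * c + b * c = c" using \<open>a + b = 1\<close> by (metis distrib_right mult_1)
  ultimately show "a *\<^sub>R x + b *\<^sub>R y \<in> {x. c \<le> ip n u x}" by (simp add: ip_simps)
qed

lemma hull_ip_ge:
  assumes "x \<in> convex hull V" "\<And>v. v \<in> V \<Longrightarrow> c \<le> ip n u v"
  shows "c \<le> ip n u x"
  using hull_minimal[of V "{x. c \<le> ip n u x}" convex] convex_ip_ge assms by auto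

lemma affine_ip_eq: "affine {x \<in> Rn n. ip n u x = c}"
  unfolding affine_def by (auto simp: Rn_closed ip_simps simp flip: distrib_right)

lemma convex_hull_subset_Rn: "V \<subseteq> Rn n \<Longrightarrow> convex hull V \<subseteq> Rn n"
  by (intro hull_minimal subspace_imp_convex subspace_Rn)

text \<open>Over the rationals the reals form a vector space, so sending \<open>x\<close> to 1
  extends to a rational-linear map with rational values. Applied coordinatewise to a real solution
  of a homogeneous integral system, it gives a rational solution, which
  \<open>f x \<noteq> 0\<close> keeps nonzero.\<close>

lemma rational_functional:
  assumes "x \<noteq> (0::real)"
  obtains f :: "real \<Rightarrow> real" where "\<And>a b. f (a + b) = f a + f b" "\<And>a. f a \<in> \<rat>"
    "\<And>m a. f (real_of_int m * a) = real_of_int m * f a" "f x \<noteq> 0"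
proof -
  interpret vector_space_pair "\<lambda>(q::rat) (r::real). of_rat q * r" "(*) :: rat \<Rightarrow> rat \<Rightarrow> rat"
    by unfold_locales (auto simp: algebra_simps of_rat_add of_rat_mult)
  have "vs1.independent {x}" using assms by simp
  then obtain g where "Vector_Spaces.linear (\<lambda>(q::rat) (r::real). of_rat q * r) (*) g" and gx: "g x = 1"
    using linear_independent_extend[of "{x}" "\<lambda>_. 1"] by auto
  then interpret g: Vector_Spaces.linear "\<lambda>(q::rat) (r::real). of_rat q * r" "(*) :: rat \<Rightarrow> rat \<Rightarrow> rat" g by simp
  have sc: "g (of_int m * a) = of_int m * g a" for m a
    using g.scale[of "of_int m" a] by simp
  show ?thesis
    by (rule that[of "\<lambda>a. of_rat (g a)"]) (auto simp: g.add of_rat_add sc of_rat_mult gx)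
qed

lemma rational_common_denominator:
  fixes r :: "nat \<Rightarrow> real"
  assumes "\<And>i. i < n \<Longrightarrow> r i \<in> \<rat>"
  obtains M :: int where "M > 0" "\<And>i. i < n \<Longrightarrow> of_int M * r i \<in> \<int>"
proof -
  have "\<exists>d::int. d > 0 \<and> of_int d * r i \<in> \<int>" if "i < n" for i
  proof -
    have "r i \<in> \<rat>" by (rule assms[OF that])
    then obtain a b where "b > 0" "r i = of_int a / of_int b"
      by (rule Rats_cases') blast
    then show ?thesis by (intro exI[of _ b]) auto
  qed
  then obtain d where d: "\<And>i. i < n \<Longrightarrow> d i > (0::int) \<and> of_int (d i) * r i \<in> \<int>" by metis
  have "of_int (\<Prod>i<n. d i) * r i \<in> \<int>" if "i < n" for i
  proof -
    have "(\<Prod>i<n. d i) = d i * (\<Prod>j\<in>{..<n} - {i}. d j)"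
      by (rule prod.remove) (use that in auto)
    then have "of_int (\<Prod>i<n. d i) * r i = of_int (\<Prod>j\<in>{..<n} - {i}. d j) * (of_int (d i) * r i)"
      by simp
    then show ?thesis using d[OF that] by (metis Ints_mult Ints_of_int)
  qed
  moreover have "(\<Prod>i<n. d i) > 0" using d by (intro prod_pos) auto
  ultimately show ?thesis using that[of "\<Prod>i<n. d i"] by blast
qed

text \<open>Division by the largest common divisor of the coordinates: one nonzero coordinate bounds
  all common divisors, and a divisor \<open>e\<close> of the quotient would make
  \<open>d * e\<close> another one.\<close>

lemma primitive_multiple:
  assumes "g \<in> Zn n" "g \<noteq> 0"
  obtains d :: int where "d \<ge> 1" "primitive n ((1 / of_int d) *\<^sub>R g)"
proof -
  obtain i where i: "g i \<noteq> 0" using assms by (metis ext zero_fun_apply)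
  then have "i < n" using assms by (auto simp: Zn_def Rn_def not_le[symmetric])
  define S where "S = {d::int. d \<ge> 1 \<and> (\<forall>i<n. g i / of_int d \<in> \<int>)}"
  have bound: "d \<le> \<lceil>\<bar>g i\<bar>\<rceil>" if "d \<in> S" for d
  proof -
    obtain z where z: "g i / of_int d = of_int z"
      using \<open>d \<in> S\<close> \<open>i < n\<close> by (auto simp: S_def elim!: Ints_cases)
    have d: "d \<ge> 1" using that by (simp add: S_def)
    then have "g i = of_int z * of_int d" using z by (simp add: field_simps)
    moreover from this have "z \<noteq> 0" using i by auto
    ultimately have "real_of_int d \<le> \<bar>g i\<bar>" using d by (simp add: abs_mult)
    then show ?thesis by linarith
  qed
  have "S \<subseteq> {1..\<lceil>\<bar>g i\<bar>\<rceil>}" using bound by (auto simp: S_def)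
  then have fin: "finite S" using finite_subset by blast
  have "1 \<in> S" using assms by (auto simp: S_def Zn_def)
  define d where "d = Max S"
  have dS: "d \<in> S" and dmax: "\<And>e. e \<in> S \<Longrightarrow> e \<le> d"
    using Max_in[OF fin] Max_ge[OF fin] \<open>1 \<in> S\<close> unfolding d_def by blast+
  then have d: "d \<ge> 1" by (simp add: S_def)
  have "primitive n ((1 / of_int d) *\<^sub>R g)"
    unfolding primitive_def
  proof (intro conjI allI impI)
    show "(1 / of_int d) *\<^sub>R g \<in> Zn n"
    proof -
      have "g j / of_int d \<in> \<int>" for j
        using dS assms(1) by (cases "j < n") (auto simp: S_def Zn_def Rn_def)
      then show ?thesis using assms(1) by (auto simp: Zn_def Rn_def scaleR_pt_apply)
    qed
    show "(1 / of_int d) *\<^sub>R g \<noteq> 0" using assms d by simp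
    fix e :: int assume e: "e \<ge> 1" "\<forall>i<n. ((1 / of_int d) *\<^sub>R g) i / of_int e \<in> \<int>"
    moreover have "d * e \<ge> 1" using d e(1) mult_mono[of 1 d 1 e] by simp
    ultimately have "d * e \<in> S" by (simp add: S_def scaleR_pt_apply)
    from dmax[OF this] have "d * e \<le> d * 1" by simp
    then have "e \<le> 1" using d by (subst (asm) mult_le_cancel_left) auto
    then show "e = 1" using e by simp
  qed
  then show ?thesis using that d by blast
qed

lemma affine_add_span:
  assumes "affine S" "v \<in> S" "\<And>t. t \<in> T \<Longrightarrow> v + t \<in> S" "y \<in> span T"
  shows "v + y \<in> S"
proof -
  have "subspace ((\<lambda>x. x - v) ` S)" using affine_diffs_subspace_subtract assms by blast
  moreover have "T \<subseteq> (\<lambda>x. x - v) ` S" using assms(3) by force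
  ultimately have "y \<in> (\<lambda>x. x - v) ` S" using assms(4) span_minimal by blast
  then show ?thesis by auto
qed

text \<open>Among the functionals nonnegative on the cone of \<open>P\<close> at \<open>v\<close> and negative on \<open>b\<close>, one with a
  maximal set of tight generators defines a facet. Its rationality is obtained by applying a
  \<open>\<rat>\<close>-linear map \<open>\<real> \<rightarrow> \<rat>\<close> to the coordinates, since the tight generators are integral.\<close>

lemma facet_normal_separating:
  assumes V: "finite V" "V \<subseteq> Zn n" "v \<in> V" and full: "full_dim n (convex hull V)"
    and b: "b \<in> Rn n" "\<nexists>c. (\<forall>x\<in>V. c x \<ge> 0) \<and> b = (\<Sum>x\<in>V. c x *\<^sub>R (x - v))"
  obtains u where "facet_normal n (convex hull V) u" "minval n (convex hull V) u = ip n u v" "ip n u b < 0"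
proof -
  let ?P = "convex hull V"
  have VR: "V \<subseteq> Rn n" using V Zn_subset_Rn by blast
  define S where "S = {u \<in> Rn n. (\<forall>x\<in>V. ip n u (x - v) \<ge> 0) \<and> ip n u b < 0}"
  define tight where "tight u = {x \<in> V. ip n u (x - v) = 0}" for u
  have "\<exists>u. u \<in> S"
    using farkas[OF V(1), of "\<lambda>x. x - v" n b] V VR b unfolding S_def by (auto simp: Rn_closed subset_iff)
  moreover have "card (tight u) \<le> card V" for u
    using V by (intro card_mono) (auto simp: tight_def)
  ultimately obtain u where u: "u \<in> S" and umax: "\<And>w. w \<in> S \<Longrightarrow> card (tight w) \<le> card (tight u)"
    using ex_has_greatest_nat[of "\<lambda>u. u \<in> S" _ "\<lambda>u. card (tight u)" "Suc (card V)"] by (metis less_Suc_eq_le)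
  have uR: "u \<in> Rn n" and unn: "\<And>x. x \<in> V \<Longrightarrow> ip n u (x - v) \<ge> 0" and ub: "ip n u b < 0"
    using u by (auto simp: S_def)
  \<comment> \<open>If such a \<open>w\<close> existed, moving \<open>u\<close> along
    \<open>w\<close> by the smallest ratio \<open>q y\<close> would stay in \<open>S\<close> and
    make one more generator tight, against maximality. The conclusion is reached through this
    contradiction.\<close>
  have zero_neg: "w = 0" if w: "w \<in> Rn n" "\<And>x. x \<in> tight u \<Longrightarrow> ip n w (x - v) = 0" "ip n w b = 0"
      "\<exists>x\<in>V. ip n w (x - v) < 0" for w
  proof -
    define N where "N = {x \<in> V. ip n w (x - v) < 0}"
    define q where "q x = ip n u (x - v) / (- ip n w (x - v))" for x
    have N: "finite N" "N \<noteq> {}" using V w by (auto simp: N_def)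
    then obtain y where y: "y \<in> N" "\<And>x. x \<in> N \<Longrightarrow> q y \<le> q x"
      by (metis arg_min_if_finite(1) arg_min_least)
    have q0: "q y \<ge> 0" using y(1) unn by (auto simp: q_def N_def intro!: divide_nonneg_neg)
    define u' where "u' = u + q y *\<^sub>R w"
    have "ip n u' (x - v) \<ge> 0" if "x \<in> V" for x
    proof (cases "x \<in> N")
      case True
      then have "q y \<le> q x" "ip n w (x - v) < 0" using y by (auto simp: N_def)
      then have "q y * (- ip n w (x - v)) \<le> ip n u (x - v)" unfolding q_def[of x]
        by (subst (asm) pos_le_divide_eq) auto
      then show ?thesis by (simp add: u'_def ip_simps(1,2,7,8))
    next
      case False
      then have "ip n w (x - v) \<ge> 0" using that by (auto simp: N_def)
      then show ?thesis using unn[OF that] q0 by (simp add: u'_def ip_add(1) ip_scaleR(1))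
    qed
    moreover have "ip n u' b < 0" using ub w by (simp add: u'_def ip_add(1) ip_scaleR(1))
    ultimately have "u' \<in> S" using uR w by (auto simp: S_def u'_def Rn_closed)
    have "tight u \<subset> tight u'"
    proof
      show "tight u \<subseteq> tight u'" using w(2) by (auto simp: tight_def u'_def ip_add(1) ip_scaleR(1))
      have "ip n u' (y - v) = 0" using y by (auto simp: u'_def q_def N_def ip_add(1) ip_diff(1) ip_scaleR(1))
      then have "y \<in> tight u'" using y by (auto simp: tight_def N_def)
      moreover have "y \<notin> tight u" using w(2) y by (auto simp: N_def)
      ultimately show "tight u \<noteq> tight u'" by blast
    qed
    then have "card (tight u) < card (tight u')"
      using V by (intro psubset_card_mono) (auto simp: tight_def)
    then show ?thesis using umax[OF \<open>u' \<in> S\<close>] by simp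
  qed
  have zero: "w = 0" if w: "w \<in> Rn n" "\<And>x. x \<in> tight u \<Longrightarrow> ip n w (x - v) = 0" "ip n w b = 0" for w
  proof (rule ccontr)
    assume "w \<noteq> 0"
    have "\<exists>x\<in>V. ip n w (x - v) \<noteq> 0"
    proof (rule ccontr)
      assume "\<not> ?thesis"
      then have "V \<subseteq> {x \<in> Rn n. ip n w x = ip n w v}" using VR by (auto simp: ip_diff)
      then have "affine hull V \<subseteq> {x \<in> Rn n. ip n w x = ip n w v}"
        by (intro hull_minimal affine_ip_eq)
      moreover have "v + w \<in> affine hull V"
        using full w VR V(3) by (auto simp: full_dim_def Rn_closed)
      ultimately have "ip n w w = 0" by (auto simp: ip_add)
      then show False using ip_self_eq_0 w \<open>w \<noteq> 0\<close> by blast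
    qed
    then obtain x where "x \<in> V" "ip n w (x - v) \<noteq> 0" by blast
    then consider "\<exists>x\<in>V. ip n w (x - v) < 0" | "\<exists>x\<in>V. ip n (- w) (x - v) < 0"
      by (metis ip_minus(1) linorder_neqE_linordered_idom neg_less_0_iff_less)
    then show False
    proof cases
      case 1
      then show ?thesis using zero_neg[OF w] \<open>w \<noteq> 0\<close> by blast
    next
      case 2
      have "- w = 0"
        by (rule zero_neg) (use w 2 in \<open>auto simp: Rn_closed ip_minus(1) simp del: fun_Compl_def\<close>)
      then show ?thesis using \<open>w \<noteq> 0\<close> by (metis neg_equal_0_iff_equal)
    qed
  qed
  \<comment> \<open>The functionals vanishing on the tight generators form the line through
    \<open>u\<close>, so the tight generators span a hyperplane of directions.\<close>
  have multiple: "w = (ip n w b / ip n u b) *\<^sub>R u"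
    if "w \<in> Rn n" "\<And>x. x \<in> tight u \<Longrightarrow> ip n w (x - v) = 0" for w
  proof -
    have "w - (ip n w b / ip n u b) *\<^sub>R u = 0"
    proof (rule zero)
      show "ip n (w - (ip n w b / ip n u b) *\<^sub>R u) b = 0" using ub by (simp add: ip_diff(1) ip_scaleR(1))
      show "ip n (w - (ip n w b / ip n u b) *\<^sub>R u) (x - v) = 0" if "x \<in> tight u" for x
        using that \<open>x \<in> tight u \<Longrightarrow> ip n w (x - v) = 0\<close>
        unfolding tight_def by (simp add: ip_diff(1) ip_scaleR(1))
    qed (use uR that in \<open>auto simp: Rn_closed\<close>)
    then show ?thesis by simp
  qed
  have "u \<noteq> 0" using ub by auto
  then obtain i where i: "u i \<noteq> 0" by (metis ext zero_fun_apply)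
  obtain f where f: "\<And>a b. f (a + b) = f a + f b" "\<And>a. f a \<in> \<rat>"
    "\<And>m a. f (real_of_int m * a) = real_of_int m * f a" "f (u i) \<noteq> 0"
    by (rule rational_functional[OF i]) blast
  have f0: "f 0 = 0" using f(1)[of 0 0] by simp
  \<comment> \<open>Applying \<open>f\<close> coordinatewise commutes with pairing against integral
    vectors. So the rational vector \<open>r\<close> vanishes on the tight generators as
    \<open>u\<close> does, and \<open>multiple\<close> makes it proportional to
    \<open>u\<close>.\<close>
  define r :: pt where "r = (\<lambda>j. f (u j))"
  have rR: "r \<in> Rn n" using uR f0 by (auto simp: Rn_def r_def)
  have fsum: "f (\<Sum>j\<in>J. h j) = (\<Sum>j\<in>J. f (h j))" for J :: "nat set" and h
    by (induction J rule: infinite_finite_induct) (auto simp: f0 f(1))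
  have rf: "ip n r z = f (ip n u z)" if z: "z \<in> Zn n" for z
  proof -
    have "r j * z j = f (u j * z j)" for j
    proof -
      obtain m where "z j = of_int m" using z by (auto simp: Zn_def elim!: Ints_cases)
      then show ?thesis using f(3)[of m "u j"] by (simp add: r_def mult.commute)
    qed
    then show ?thesis unfolding ip_def fsum by simp
  qed
  obtain M :: int where M: "M > 0" "\<And>j. j < n \<Longrightarrow> of_int M * r j \<in> \<int>"
    using rational_common_denominator[of n r] f(2) by (auto simp: r_def)
  define g where "g = of_int M *\<^sub>R r"
  have gZ: "g \<in> Zn n"
  proof -
    have "of_int M * r j \<in> \<int>" for j using M(2) rR by (cases "j < n") (auto simp: Rn_def)
    then show ?thesis using rR by (auto simp: g_def Zn_def Rn_closed scaleR_pt_apply)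
  qed
  have g0: "g \<noteq> 0"
  proof
    assume "g = 0"
    then have "of_int M * r i = 0" unfolding g_def by (metis scaleR_pt_apply zero_fun_apply)
    then show False using M f(4) by (simp add: r_def)
  qed
  have gt: "ip n g (x - v) = 0" if x: "x \<in> tight u" for x
  proof -
    have "x - v \<in> Zn n" using x V by (auto simp: tight_def intro!: Zn_closed)
    then show ?thesis using x by (simp add: rf g_def ip_scaleR tight_def f0)
  qed
  define \<kappa> where "\<kappa> = ip n g b / ip n u b"
  have g: "g = \<kappa> *\<^sub>R u" using multiple[of g] gt gZ Zn_subset_Rn by (auto simp: \<kappa>_def)
  then have k0: "\<kappa> \<noteq> 0" using g0 by auto
  \<comment> \<open>The factor \<kappa> may be negative. Its sign turns \<open>g\<close> into a
    positive multiple of \<open>u\<close>, for which the minimum at \<open>v\<close> and the sign on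
    \<open>b\<close> are preserved.\<close>
  have g1: "sgn \<kappa> *\<^sub>R g \<in> Zn n" "sgn \<kappa> *\<^sub>R g \<noteq> 0"
    using gZ g0 k0 by (auto intro!: Zn_closed simp: sgn_if)
  obtain d :: int where d: "d \<ge> 1" "primitive n ((1 / of_int d) *\<^sub>R (sgn \<kappa> *\<^sub>R g))"
    using primitive_multiple[OF g1] by blast
  define \<mu> where "\<mu> = \<bar>\<kappa>\<bar> / of_int d"
  have mu: "\<mu> > 0" using d k0 by (simp add: \<mu>_def)
  have prim: "primitive n (\<mu> *\<^sub>R u)"
  proof -
    have "(1 / of_int d) *\<^sub>R (sgn \<kappa> *\<^sub>R g) = \<mu> *\<^sub>R u"
      unfolding g \<mu>_def by (simp add: sgn_mult_abs abs_sgn mult.commute)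
    then show ?thesis using d by simp
  qed
  have min: "ip n u v \<le> ip n u x" if "x \<in> ?P" for x
    by (rule hull_ip_ge[OF that]) (use unn in \<open>auto simp: ip_diff\<close>)
  have vP: "v \<in> ?P" using V hull_inc by metis
  have mv: "minval n ?P (\<mu> *\<^sub>R u) = ip n (\<mu> *\<^sub>R u) v"
    by (rule minval_eq[OF vP]) (use min mu in \<open>auto simp: ip_scaleR\<close>)
  let ?F = "{x \<in> ?P. ip n (\<mu> *\<^sub>R u) x = ip n (\<mu> *\<^sub>R u) v}"
  let ?H = "{x \<in> Rn n. ip n (\<mu> *\<^sub>R u) x = ip n (\<mu> *\<^sub>R u) v}"
  have "affine hull ?F = ?H"
  proof
    show "affine hull ?F \<subseteq> ?H"
      using convex_hull_subset_Rn[OF VR] by (intro hull_minimal affine_ip_eq) auto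
    show "?H \<subseteq> affine hull ?F"
    proof
      fix x assume x: "x \<in> ?H"
      let ?T = "(\<lambda>x. x - v) ` tight u"
      have "x - v \<in> span ?T"
      proof (rule ccontr)
        assume "x - v \<notin> span ?T"
        moreover have "finite ?T" "?T \<subseteq> Rn n" using V VR by (auto simp: tight_def intro!: Rn_closed)
        moreover have "x - v \<in> Rn n" using x VR V by (auto intro!: Rn_closed)
        ultimately obtain w where w: "w \<in> Rn n" "\<forall>t\<in>?T. ip n w t = 0" "ip n w (x - v) \<noteq> 0"
          using not_in_span_separated by metis
        then have "w = (ip n w b / ip n u b) *\<^sub>R u" by (intro multiple) auto
        then have "ip n w (x - v) = (ip n w b / ip n u b) * ip n u (x - v)" by (metis ip_scaleR(1))
        then show False using w x mu by (auto simp: ip_diff ip_scaleR)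
      qed
      moreover have "v \<in> affine hull ?F" using vP by (auto intro!: hull_inc)
      moreover have "v + t \<in> affine hull ?F" if t: "t \<in> ?T" for t
      proof -
        obtain x where x: "t = x - v" "x \<in> V" "ip n u x = ip n u v"
          using t by (auto simp: tight_def ip_diff)
        then have "x \<in> ?F" by (simp add: hull_inc ip_scaleR)
        then show ?thesis using x(1) by (simp add: hull_inc)
      qed
      ultimately have "v + (x - v) \<in> affine hull ?F"
        using affine_affine_hull by (intro affine_add_span[of "affine hull ?F" v ?T "x - v"])
      then show "x \<in> affine hull ?F" by simp
    qed
  qed
  then have "facet_normal n ?P (\<mu> *\<^sub>R u)" using prim by (simp add: facet_normal_def mv)
  moreover have "ip n (\<mu> *\<^sub>R u) b < 0" using mu ub by (simp add: ip_scaleR mult_pos_neg)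
  ultimately show ?thesis using that mv by blast
qed

section \<open>Vertices and facets of a smooth polytope\<close>

text \<open>The unit vectors have integral coefficients \<open>c j b\<close> in the basis; for fixed
  \<open>b\<close> these form the vector \<open>e b\<close>, a row of the inverse of the matrix with
  columns \<open>B\<close>. Duality follows by uniqueness of the coefficients in the expansion of
  each \<open>b'\<close>.\<close>

lemma lattice_basis_dual:
  assumes "lattice_basis n B"
  obtains e where "\<And>b. b \<in> B \<Longrightarrow> e b \<in> Zn n"
    "\<And>b b'. b \<in> B \<Longrightarrow> b' \<in> B \<Longrightarrow> ip n b' (e b) = (if b' = b then 1 else 0)"
    "\<And>x. x \<in> Rn n \<Longrightarrow> x = (\<Sum>b\<in>B. ip n b x *\<^sub>R e b)"
    "\<And>y. y \<in> Rn n \<Longrightarrow> y = (\<Sum>b\<in>B. ip n y (e b) *\<^sub>R b)"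
proof -
  have B: "finite B" "B \<subseteq> Zn n"
    and gen: "\<And>z. z \<in> Zn n \<Longrightarrow> \<exists>c::pt \<Rightarrow> int. z = (\<Sum>b\<in>B. of_int (c b) *\<^sub>R b)"
    and indep: "\<And>c::pt \<Rightarrow> int. (\<Sum>b\<in>B. of_int (c b) *\<^sub>R b) = 0 \<Longrightarrow> \<forall>b\<in>B. c b = 0"
    using assms by (auto simp: lattice_basis_def)
  have "\<exists>c::pt \<Rightarrow> int. unitv j = (\<Sum>b\<in>B. of_int (c b) *\<^sub>R b)" if "j < n" for j
    by (rule gen) (rule unitv_Zn[OF that])
  then obtain c :: "nat \<Rightarrow> pt \<Rightarrow> int"
    where c: "\<And>j. j < n \<Longrightarrow> unitv j = (\<Sum>b\<in>B. of_int (c j b) *\<^sub>R b)" by metis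
  define e :: "pt \<Rightarrow> pt" where "e b = (\<lambda>j. if j < n then of_int (c j b) else 0)" for b
  have eZ: "e b \<in> Zn n" for b by (auto simp: e_def Zn_def Rn_def)
  have expand: "y = (\<Sum>b\<in>B. ip n y (e b) *\<^sub>R b)" if "y \<in> Rn n" for y
  proof -
    have "y = (\<Sum>j<n. y j *\<^sub>R (\<Sum>b\<in>B. of_int (c j b) *\<^sub>R b))"
      using pt_expand[OF that] c by (metis (no_types, lifting) lessThan_iff sum.cong)
    also have "\<dots> = (\<Sum>b\<in>B. \<Sum>j<n. (y j * of_int (c j b)) *\<^sub>R b)"
      by (simp add: scaleR_sum_right sum.swap[of _ B])
    also have "\<dots> = (\<Sum>b\<in>B. ip n y (e b) *\<^sub>R b)"
      by (simp add: ip_def e_def flip: scaleR_sum_left)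
    finally show ?thesis .
  qed
  have dual: "ip n b' (e b) = (if b' = b then 1 else 0)" if "b \<in> B" "b' \<in> B" for b b'
  proof -
    have "\<exists>k. ip n b' (e d) = of_int k" if "d \<in> B" for d
      using ip_Ints[of b' n "e d"] eZ B \<open>b' \<in> B\<close> by (auto elim: Ints_cases)
    then obtain k where k: "\<And>d. d \<in> B \<Longrightarrow> ip n b' (e d) = of_int (k d)" by metis
    define h where "h d = k d - (if d = b' then 1 else 0)" for d
    have "b' = (\<Sum>d\<in>B. of_int (k d) *\<^sub>R d)"
      using expand[of b'] k B \<open>b' \<in> B\<close> Zn_subset_Rn by (simp add: subset_iff)
    moreover have "(\<Sum>d\<in>B. of_int (if d = b' then 1 else 0) *\<^sub>R d) = (\<Sum>d\<in>B. if d = b' then b' else 0)"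
      by (intro sum.cong) auto
    moreover have "\<dots> = b'" using B \<open>b' \<in> B\<close> by simp
    ultimately have "(\<Sum>d\<in>B. of_int (h d) *\<^sub>R d) = 0"
      by (simp add: h_def algebra_simps sum_subtractf)
    then have "h b = 0" using indep \<open>b \<in> B\<close> by blast
    then show ?thesis using k[OF \<open>b \<in> B\<close>] by (auto simp: h_def split: if_splits)
  qed
  have expand': "x = (\<Sum>b\<in>B. ip n b x *\<^sub>R e b)" if x: "x \<in> Rn n" for x
  proof
    fix j
    show "x j = (\<Sum>b\<in>B. ip n b x *\<^sub>R e b) j"
    proof (cases "j < n")
      case True
      have "x j = ip n (unitv j) x" using ip_unitv(1)[OF True] by simp
      also have "\<dots> = (\<Sum>b\<in>B. of_int (c j b) * ip n b x)"
        unfolding c[OF True] by (simp add: ip_sum ip_scaleR)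
      also have "\<dots> = (\<Sum>b\<in>B. ip n b x *\<^sub>R e b) j"
        using True by (simp add: sum_fun_apply scaleR_pt_apply e_def mult.commute)
      finally show ?thesis .
    next
      case False
      then show ?thesis using x by (simp add: sum_fun_apply scaleR_pt_apply e_def Rn_def)
    qed
  qed
  show ?thesis using that[of e] eZ dual expand expand' by blast
qed

locale smooth_polytope =
  fixes n :: nat and P :: "pt set"
  assumes lattice: "lattice_polytope n P" and full: "full_dim n P" and smooth: "smooth n P"
begin

definition E :: "pt set" where "E = {v. v extreme_point_of P}"

definition N :: "pt set" where "N = {u. facet_normal n P u}"

definition I :: "pt \<Rightarrow> pt set" where "I v = {u \<in> N. ip n u v = minval n P u}"

abbreviation mv :: "pt \<Rightarrow> real" where "mv \<equiv> minval n P"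

lemma finite_E: "finite E" and E_Zn: "E \<subseteq> Zn n" and P_eq: "P = convex hull E" and E_nonempty: "E \<noteq> {}"
proof -
  obtain V where V: "finite V" "V \<noteq> {}" "V \<subseteq> Zn n" "P = convex hull V"
    using lattice by (auto simp: lattice_polytope_def)
  have E': "E = {x. x extreme_point_of (convex hull V)}" by (simp only: E_def V(4)[symmetric])
  have "E \<subseteq> V" unfolding E' by (rule extreme_points_of_convex_hull)
  then show "finite E" "E \<subseteq> Zn n" using V finite_subset by blast+
  show "P = convex hull E" using finite_convex_hull_extreme[OF V(1)] V(4) E' by metis
  then show "E \<noteq> {}" using V(2,4) by (metis convex_hull_eq_empty)
qed

lemma E_Rn: "E \<subseteq> Rn n"
  using E_Zn Zn_subset_Rn by blast

lemma E_P: "v \<in> E \<Longrightarrow> v \<in> P"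
  using hull_inc[of v E convex] by (simp flip: P_eq)

lemma P_Rn: "P \<subseteq> Rn n"
  using convex_hull_subset_Rn[OF E_Rn] by (simp flip: P_eq)

lemma minval_attained:
  obtains v where "v \<in> E" "mv u = ip n u v" "\<And>x. x \<in> P \<Longrightarrow> ip n u v \<le> ip n u x"
proof -
  obtain v where v: "v \<in> E" "\<And>x. x \<in> E \<Longrightarrow> ip n u v \<le> ip n u x"
    using finite_E E_nonempty by (metis arg_min_if_finite(1) arg_min_least)
  have le: "ip n u v \<le> ip n u x" if "x \<in> P" for x
    using hull_ip_ge[of x E] that v P_eq by metis
  then show ?thesis using that v minval_eq[of v P n u] E_P by blast
qed

lemma minval_le: "x \<in> P \<Longrightarrow> mv u \<le> ip n u x"
  by (rule minval_attained[of u]) simp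

lemma N_Zn: "N \<subseteq> Zn n"
  by (auto simp: N_def facet_normal_def primitive_def)

lemma N_Rn: "N \<subseteq> Rn n"
  using N_Zn Zn_subset_Rn by blast

lemma N_nonzero: "u \<in> N \<Longrightarrow> u \<noteq> 0"
  by (auto simp: N_def facet_normal_def primitive_def)

lemma I_subset_N: "I v \<subseteq> N"
  by (auto simp: I_def)

lemma I_facts:
  assumes "v \<in> E"
  shows "finite (I v)" "card (I v) = n" "lattice_basis n (I v)"
  using assms smooth by (auto simp: E_def I_def N_def smooth_def Let_def)

lemma minval_Ints:
  assumes "u \<in> Zn n"
  shows "mv u \<in> \<int>"
proof -
  obtain v where "v \<in> E" "mv u = ip n u v" by (rule minval_attained[of u])
  then show ?thesis using ip_Ints[OF assms] E_Zn by auto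
qed

text \<open>For \<open>b \<in> I v\<close> this is the primitive direction of the edge of
  \<open>P\<close> at \<open>v\<close> that leaves the facet of \<open>b\<close> and stays in all
  other facets through \<open>v\<close>.\<close>

definition dual :: "pt \<Rightarrow> pt \<Rightarrow> pt" where
  "dual v = (SOME e. (\<forall>b\<in>I v. e b \<in> Zn n) \<and>
     (\<forall>b\<in>I v. \<forall>b'\<in>I v. ip n b' (e b) = (if b' = b then 1 else 0)) \<and>
     (\<forall>x\<in>Rn n. x = (\<Sum>b\<in>I v. ip n b x *\<^sub>R e b)) \<and>
     (\<forall>y\<in>Rn n. y = (\<Sum>b\<in>I v. ip n y (e b) *\<^sub>R b)))"

lemma dual_facts:
  assumes "v \<in> E"
  shows dual_Zn: "b \<in> I v \<Longrightarrow> dual v b \<in> Zn n"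
    and ip_dual: "b \<in> I v \<Longrightarrow> b' \<in> I v \<Longrightarrow> ip n b' (dual v b) = (if b' = b then 1 else 0)"
    and dual_expand: "x \<in> Rn n \<Longrightarrow> x = (\<Sum>b\<in>I v. ip n b x *\<^sub>R dual v b)"
    and I_expand: "y \<in> Rn n \<Longrightarrow> y = (\<Sum>b\<in>I v. ip n y (dual v b) *\<^sub>R b)"
proof -
  have "\<exists>e. (\<forall>b\<in>I v. e b \<in> Zn n) \<and>
     (\<forall>b\<in>I v. \<forall>b'\<in>I v. ip n b' (e b) = (if b' = b then 1 else 0)) \<and>
     (\<forall>x\<in>Rn n. x = (\<Sum>b\<in>I v. ip n b x *\<^sub>R e b)) \<and>
     (\<forall>y\<in>Rn n. y = (\<Sum>b\<in>I v. ip n y (e b) *\<^sub>R b))"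
    by (rule lattice_basis_dual[OF I_facts(3)[OF assms]]) blast
  from someI_ex[OF this] have *: "(\<forall>b\<in>I v. dual v b \<in> Zn n) \<and>
     (\<forall>b\<in>I v. \<forall>b'\<in>I v. ip n b' (dual v b) = (if b' = b then 1 else 0)) \<and>
     (\<forall>x\<in>Rn n. x = (\<Sum>b\<in>I v. ip n b x *\<^sub>R dual v b)) \<and>
     (\<forall>y\<in>Rn n. y = (\<Sum>b\<in>I v. ip n y (dual v b) *\<^sub>R b))"
    unfolding dual_def by blast
  show "b \<in> I v \<Longrightarrow> dual v b \<in> Zn n" using * by blast
  show "b \<in> I v \<Longrightarrow> b' \<in> I v \<Longrightarrow> ip n b' (dual v b) = (if b' = b then 1 else 0)" using * by blast
  show "x \<in> Rn n \<Longrightarrow> x = (\<Sum>b\<in>I v. ip n b x *\<^sub>R dual v b)" using * by blast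
  show "y \<in> Rn n \<Longrightarrow> y = (\<Sum>b\<in>I v. ip n y (dual v b) *\<^sub>R b)" using * by blast
qed

lemma facet_normal_separating':
  assumes "v \<in> E" "b \<in> Rn n" "\<nexists>c. (\<forall>x\<in>E. c x \<ge> 0) \<and> b = (\<Sum>x\<in>E. c x *\<^sub>R (x - v))"
  obtains u where "u \<in> I v" "ip n u b < 0"
proof -
  have "full_dim n (convex hull E)" using full P_eq by simp
  then obtain u where "facet_normal n (convex hull E) u" "minval n (convex hull E) u = ip n u v" "ip n u b < 0"
    using facet_normal_separating[OF finite_E E_Zn assms(1) _ assms(2,3)] by blast
  then show ?thesis using that[of u] by (simp add: I_def N_def flip: P_eq)
qed

text \<open>By \<open>facet_normal_separating'\<close> a direction on which no normal at
  \<open>v\<close> is negative lies in the cone of the differences \<open>x - v\<close>. Dividing by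
  the total weight \<open>C\<close> turns this cone combination into a convex combination of
  vertices.\<close>

lemma feasible_direction:
  assumes "v \<in> E" "b \<in> Rn n" "\<And>u. u \<in> I v \<Longrightarrow> ip n u b \<ge> 0"
  obtains \<epsilon> where "\<epsilon> > 0" "v + \<epsilon> *\<^sub>R b \<in> P"
proof -
  obtain c where c: "\<And>x. x \<in> E \<Longrightarrow> c x \<ge> 0" "b = (\<Sum>x\<in>E. c x *\<^sub>R (x - v))"
    using facet_normal_separating'[OF assms(1,2)] assms(3) by (metis not_le)
  define C where "C = sum c E"
  have C: "C \<ge> 0" using c by (auto simp: C_def intro: sum_nonneg)
  show ?thesis
  proof (cases "C = 0")
    case True
    then have "\<forall>x\<in>E. c x = 0"
      using c(1) finite_E unfolding C_def by (subst (asm) sum_nonneg_eq_0_iff) auto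
    then have "b = 0" using c(2) by simp
    then show ?thesis using that[of 1] E_P[OF assms(1)] by simp
  next
    case False
    then have Cp: "C > 0" using C by simp
    have "b = (\<Sum>x\<in>E. c x *\<^sub>R x) - C *\<^sub>R v"
      unfolding c(2) C_def by (simp add: scaleR_diff_right sum_subtractf scaleR_sum_left)
    then have "v + (1 / C) *\<^sub>R b = (1 / C) *\<^sub>R (\<Sum>x\<in>E. c x *\<^sub>R x)"
      using Cp by (simp add: scaleR_diff_right)
    also have "\<dots> = (\<Sum>x\<in>E. (c x / C) *\<^sub>R x)" by (simp add: scaleR_sum_right)
    also have "\<dots> \<in> convex hull E"
    proof (rule convex_sum)
      show "(\<Sum>x\<in>E. c x / C) = 1" using Cp by (simp add: C_def flip: sum_divide_distrib)
    qed (use finite_E c Cp in \<open>auto simp: hull_inc\<close>)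
    finally show ?thesis using that[of "1 / C"] Cp P_eq by simp
  qed
qed

lemma dual_feasible:
  assumes "v \<in> E" "b \<in> I v"
  obtains \<epsilon> where "\<epsilon> > 0" "v + \<epsilon> *\<^sub>R dual v b \<in> P"
proof (rule feasible_direction[OF assms(1)])
  show "dual v b \<in> Rn n" using dual_Zn[OF assms] Zn_subset_Rn by blast
  show "0 \<le> ip n u (dual v b)" if "u \<in> I v" for u using ip_dual[OF assms that] by simp
qed (rule that)

lemma minimizer_dual_nonneg:
  assumes "v \<in> E" "b \<in> I v" "\<And>x. x \<in> P \<Longrightarrow> ip n w v \<le> ip n w x"
  shows "ip n w (dual v b) \<ge> 0"
proof -
  obtain \<epsilon> where e: "\<epsilon> > 0" "v + \<epsilon> *\<^sub>R dual v b \<in> P" using dual_feasible[OF assms(1,2)] by blast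
  then have "0 \<le> \<epsilon> * ip n w (dual v b)" using assms(3)[OF e(2)] by (simp add: ip_add ip_scaleR)
  then show ?thesis using e by (simp add: zero_le_mult_iff)
qed

text \<open>Homogenisation: all points are lifted to height one in the extra coordinate
  \<open>n\<close>. A cone combination of lifted vertices at height one has total weight one, so
  Farkas' lemma in dimension \<open>n + 1\<close> separates \<open>x\<close> from the hull.\<close>

lemma separate_point:
  assumes "x \<in> Rn n" "x \<notin> P"
  obtains u where "\<And>y. y \<in> E \<Longrightarrow> ip n u x < ip n u y"
proof -
  have ip': "ip (Suc n) u (y + unitv n) = ip n u y + u n" if "y \<in> Rn n" for u y
  proof -
    have "(\<Sum>i<n. u i * (y + unitv n) i) = (\<Sum>i<n. u i * y i)"
      by (intro sum.cong) (auto simp: unitv_def)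
    moreover have "(y + unitv n) n = 1" using that by (simp add: Rn_def unitv_def)
    ultimately show ?thesis by (simp add: ip_def)
  qed
  have R: "y + unitv n \<in> Rn (Suc n)" if "y \<in> Rn n" for y
    using that by (auto simp: Rn_def unitv_def)
  have "\<nexists>c. (\<forall>y\<in>E. c y \<ge> (0::real)) \<and> x + unitv n = (\<Sum>y\<in>E. c y *\<^sub>R (y + unitv n))"
  proof
    assume "\<exists>c. (\<forall>y\<in>E. c y \<ge> (0::real)) \<and> x + unitv n = (\<Sum>y\<in>E. c y *\<^sub>R (y + unitv n))"
    then obtain c where c: "\<And>y. y \<in> E \<Longrightarrow> c y \<ge> 0" "x + unitv n = (\<Sum>y\<in>E. c y *\<^sub>R (y + unitv n))" by blast
    have "(x + unitv n) n = (\<Sum>y\<in>E. c y * (y n + unitv n n))"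
      unfolding c(2) by (simp add: sum_fun_apply scaleR_pt_apply)
    moreover have "(\<Sum>y\<in>E. c y * (y n + unitv n n)) = sum c E"
      using E_Rn by (intro sum.cong) (auto simp: Rn_def unitv_def)
    moreover have "(x + unitv n) n = 1" using assms(1) by (simp add: Rn_def unitv_def)
    ultimately have s: "sum c E = 1" by simp
    have "x + unitv n = (\<Sum>y\<in>E. c y *\<^sub>R y) + sum c E *\<^sub>R unitv n"
      unfolding c(2) by (simp add: scaleR_add_right sum.distrib scaleR_sum_left)
    then have "x = (\<Sum>y\<in>E. c y *\<^sub>R y)" using s by simp
    also have "\<dots> \<in> convex hull E"
      by (rule convex_sum) (use finite_E c s in \<open>auto simp: hull_inc\<close>)
    finally show False using assms(2) P_eq by simp
  qed
  then obtain u where u: "\<forall>y\<in>E. ip (Suc n) u (y + unitv n) \<ge> 0" "ip (Suc n) u (x + unitv n) < 0"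
    using farkas[of E "\<lambda>y. y + unitv n" "Suc n" "x + unitv n"] finite_E R E_Rn assms(1) by blast
  have "ip n u x < ip n u y" if "y \<in> E" for y
    using u that ip'[of y u] ip'[of x u] E_Rn assms(1) by force
  then show ?thesis using that by blast
qed

text \<open>The facet presentation. A point outside \<open>P\<close> is cut off by some
  \<open>u\<close>; at a vertex \<open>v\<close> minimising \<open>u\<close>, the functional is
  nonnegative on the cone of \<open>P\<close> at \<open>v\<close> but negative on
  \<open>x - v\<close>, so some facet normal at \<open>v\<close> already excludes
  \<open>x\<close>.\<close>

lemma mem_P_iff: "x \<in> P \<longleftrightarrow> x \<in> Rn n \<and> (\<forall>u\<in>N. mv u \<le> ip n u x)"
proof
  assume "x \<in> P"
  then show "x \<in> Rn n \<and> (\<forall>u\<in>N. mv u \<le> ip n u x)" using P_Rn minval_le by blast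
next
  assume x: "x \<in> Rn n \<and> (\<forall>u\<in>N. mv u \<le> ip n u x)"
  show "x \<in> P"
  proof (rule ccontr)
    assume "x \<notin> P"
    then obtain u where u: "\<And>y. y \<in> E \<Longrightarrow> ip n u x < ip n u y" using separate_point x by blast
    obtain v where v: "v \<in> E" "\<And>x. x \<in> P \<Longrightarrow> ip n u v \<le> ip n u x" by (rule minval_attained[of u]) blast
    have "\<nexists>c. (\<forall>y\<in>E. c y \<ge> 0) \<and> x - v = (\<Sum>y\<in>E. c y *\<^sub>R (y - v))"
    proof
      assume "\<exists>c. (\<forall>y\<in>E. c y \<ge> 0) \<and> x - v = (\<Sum>y\<in>E. c y *\<^sub>R (y - v))"
      then obtain c where c: "\<And>y. y \<in> E \<Longrightarrow> c y \<ge> 0" "x - v = (\<Sum>y\<in>E. c y *\<^sub>R (y - v))" by blast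
      have "ip n u (x - v) = (\<Sum>y\<in>E. c y * ip n u (y - v))"
        by (subst c(2)) (simp only: ip_sum ip_scaleR)
      moreover have "\<dots> \<ge> 0" using c(1) v E_P by (intro sum_nonneg mult_nonneg_nonneg) (auto simp: ip_diff)
      ultimately show False using u[OF v(1)] by (simp add: ip_diff)
    qed
    moreover have "x - v \<in> Rn n" using x v E_Rn by (auto intro: Rn_closed)
    ultimately obtain w where "w \<in> I v" "ip n w (x - v) < 0"
      using facet_normal_separating' v(1) by blast
    then show False using x by (force simp: I_def ip_diff)
  qed
qed

lemma finite_N: "finite N"
proof -
  have "N \<subseteq> (\<Union>v\<in>E. I v)"
  proof
    fix u assume "u \<in> N"
    moreover obtain v where "v \<in> E" "mv u = ip n u v" by (rule minval_attained[of u])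
    ultimately show "u \<in> (\<Union>v\<in>E. I v)" by (auto simp: I_def)
  qed
  then show ?thesis using finite_E I_facts by (meson finite_UN finite_subset)
qed

text \<open>In a convex combination of vertices equal to \<open>x\<close>, the weighted slacks of
  \<open>u\<close> are nonnegative and add up to zero, so only vertices of the face carry
  weight.\<close>

lemma mem_face_hull:
  assumes "x \<in> P" "\<And>u. u \<in> F \<Longrightarrow> ip n u x = mv u"
  shows "x \<in> convex hull {y \<in> E. \<forall>u\<in>F. ip n u y = mv u}"
proof -
  obtain c where c: "\<And>y. y \<in> E \<Longrightarrow> c y \<ge> 0" "sum c E = 1" "(\<Sum>y\<in>E. c y *\<^sub>R y) = x"
  proof -
    have "x \<in> convex hull E" using assms(1) by (simp flip: P_eq)
    then show thesis using that unfolding convex_hull_finite[OF finite_E] by blast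
  qed
  have tight: "ip n u y = mv u" if "u \<in> F" "y \<in> E" "c y \<noteq> 0" for u y
  proof -
    have "(\<Sum>y\<in>E. c y * (ip n u y - mv u)) = ip n u (\<Sum>y\<in>E. c y *\<^sub>R y) - sum c E * mv u"
      by (simp add: ip_sum ip_scaleR right_diff_distrib sum_subtractf sum_distrib_right)
    also have "\<dots> = 0" using c assms(2)[OF that(1)] by simp
    finally have "\<forall>y\<in>E. c y * (ip n u y - mv u) = 0"
      using c(1) minval_le E_P finite_E by (subst (asm) sum_nonneg_eq_0_iff) auto
    then show ?thesis using that by auto
  qed
  let ?G = "{y \<in> E. \<forall>u\<in>F. ip n u y = mv u}"
  have out: "c y = 0" if "y \<in> E - ?G" for y using tight that by blast
  have "x = (\<Sum>y\<in>?G. c y *\<^sub>R y)" "sum c ?G = 1"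
    unfolding c(2)[symmetric] c(3)[symmetric]
    by (intro sum.mono_neutral_right sum.mono_neutral_left finite_E; use out in auto)+
  then show ?thesis
    using finite_E c(1) by (auto simp: hull_inc intro!: convex_sum)
qed

end

section \<open>Adjoint polytopes and the codegree\<close>

context smooth_polytope
begin

text \<open>For small \<open>t\<close> this is the vertex of the adjoint polytope \<open>P\<^sup>(\<^sup>t\<^sup>)\<close> that corresponds to \<open>v\<close>.\<close>

definition shift :: "pt \<Rightarrow> real \<Rightarrow> pt" where
  "shift v t = v + t *\<^sub>R (\<Sum>b\<in>I v. dual v b)"

lemma shift_Rn: "v \<in> E \<Longrightarrow> shift v t \<in> Rn n"
  using E_Rn dual_Zn Zn_subset_Rn unfolding shift_def by (blast intro: Rn_closed)

lemma ip_shift: "ip n u (shift v t) = ip n u v + t * (\<Sum>b\<in>I v. ip n u (dual v b))"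
  by (simp add: shift_def ip_add ip_scaleR ip_sum)

lemma ip_shift_tight:
  assumes "v \<in> E" "u \<in> I v"
  shows "ip n u (shift v t) = mv u + t"
proof -
  have "(\<Sum>b\<in>I v. ip n u (dual v b)) = (\<Sum>b\<in>I v. if b = u then 1 else 0)"
    using ip_dual[OF assms(1)] assms(2) by (intro sum.cong) auto
  also have "\<dots> = 1" using I_facts(1)[OF assms(1)] assms(2) by simp
  finally show ?thesis using assms(2) by (simp add: ip_shift I_def)
qed

lemma shift_small:
  assumes "v \<in> E"
  obtains t where "t > 0" "\<And>u s. u \<in> N \<Longrightarrow> 0 \<le> s \<Longrightarrow> s \<le> t \<Longrightarrow> ip n u (shift v s) \<ge> mv u + s"
proof -
  define k where "k u = (\<Sum>b\<in>I v. ip n u (dual v b))" for u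
  \<comment> \<open>The denominator is positive and dominates \<open>1 - k u\<close>. On a facet
    through \<open>v\<close> the inequality is an equality for every \<open>s\<close>, so the value
    1 is an arbitrary positive bound.\<close>
  define q where "q u = (if u \<in> I v then 1 else (ip n u v - mv u) / (1 + \<bar>k u\<bar>))" for u
  have q0: "q u > 0" if "u \<in> N" for u
  proof (cases "u \<in> I v")
    case False
    then have "ip n u v \<noteq> mv u" using that by (simp add: I_def)
    then have "ip n u v > mv u" using minval_le[OF E_P[OF assms], of u] by simp
    then show ?thesis using False by (simp add: q_def add_pos_nonneg)
  qed (simp add: q_def)
  have ok: "ip n u (shift v s) \<ge> mv u + s" if u: "u \<in> N" and s: "0 \<le> s" "s \<le> q u" for u s
  proof (cases "u \<in> I v")
    case True
    then show ?thesis using ip_shift_tight[OF assms True] by simp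
  next
    case False
    have pos: "1 + \<bar>k u\<bar> > 0" by simp
    have "s * (1 + \<bar>k u\<bar>) \<le> ip n u v - mv u"
      using s(2) False pos by (simp add: q_def pos_le_divide_eq)
    moreover have "s * (1 - k u) \<le> s * (1 + \<bar>k u\<bar>)" using s(1) by (intro mult_left_mono) auto
    ultimately show ?thesis by (simp add: ip_shift k_def[symmetric] algebra_simps)
  qed
  \<comment> \<open>The added 1 keeps the set nonempty in dimension 0, where there are no
    normals.\<close>
  define t where "t = Min (insert 1 (q ` N))"
  have "t > 0" using finite_N q0 by (simp add: t_def)
  moreover have "t \<le> q u" if "u \<in> N" for u using finite_N that by (simp add: t_def)
  ultimately show ?thesis using that[of t] ok by (meson order_trans)
qed

lemma interior_scaled:
  assumes "c > 0" "z \<in> Rn n" "\<And>u. u \<in> N \<Longrightarrow> ip n u z \<ge> c * mv u + 1"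
  shows "z \<in> interior_n n ((\<lambda>x. c *\<^sub>R x) ` P)"
proof -
  \<comment> \<open>A uniform choice: if no coordinate changes by \<open>e\<close> or more, no facet
    functional changes by more than 1.\<close>
  define e where "e = 1 / (1 + (\<Sum>u\<in>N. \<Sum>i<n. \<bar>u i\<bar>))"
  have S0: "(\<Sum>u\<in>N. \<Sum>i<n. \<bar>u i\<bar>) \<ge> 0" by (intro sum_nonneg) simp
  then have e: "e > 0" by (simp add: e_def add_pos_nonneg)
  have "y \<in> (\<lambda>x. c *\<^sub>R x) ` P" if y: "y \<in> Rn n" "\<forall>i<n. \<bar>y i - z i\<bar> < e" for y
  proof -
    have "mv u \<le> ip n u ((1 / c) *\<^sub>R y)" if u: "u \<in> N" for u
    proof -
      have "\<bar>ip n u (y - z)\<bar> \<le> (\<Sum>i<n. \<bar>u i * (y - z) i\<bar>)" unfolding ip_def by (rule sum_abs)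
      also have "\<dots> \<le> (\<Sum>i<n. \<bar>u i\<bar> * e)"
        using y(2) by (intro sum_mono) (auto simp: abs_mult intro!: mult_left_mono dest: less_imp_le)
      also have "\<dots> = (\<Sum>i<n. \<bar>u i\<bar>) * e" by (simp add: sum_distrib_right)
      also have "\<dots> \<le> (\<Sum>u\<in>N. \<Sum>i<n. \<bar>u i\<bar>) * e"
        using e finite_N u by (intro mult_right_mono member_le_sum) (auto intro: sum_nonneg)
      also have "\<dots> \<le> 1" using S0 unfolding e_def by (simp add: divide_le_eq)
      finally have "ip n u y \<ge> c * mv u" using assms(3)[OF u] by (simp add: ip_diff)
      then show ?thesis using assms(1) by (simp add: ip_scaleR pos_le_divide_eq mult.commute)
    qed
    then have "(1 / c) *\<^sub>R y \<in> P" using y(1) by (auto simp: mem_P_iff intro: Rn_closed)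
    moreover have "y = c *\<^sub>R ((1 / c) *\<^sub>R y)" using assms(1) by simp
    ultimately show ?thesis by blast
  qed
  then show ?thesis using assms(2) e unfolding interior_n_def by blast
qed

text \<open>\<open>c\<close> times the shifted vertex is \<open>c\<close> times \<open>v\<close>
  plus the sum of the dual basis, hence integral, and the slack \<open>1 / c\<close> becomes the
  slack 1 required by \<open>interior_scaled\<close>.\<close>

lemma lattice_interior_point:
  assumes "v \<in> E" "c > 0" "\<And>u. u \<in> N \<Longrightarrow> ip n u (shift v (1 / real c)) \<ge> mv u + 1 / real c"
  shows "\<exists>z\<in>Zn n. z \<in> interior_n n ((\<lambda>x. real c *\<^sub>R x) ` P)"
proof
  let ?z = "real c *\<^sub>R v + (\<Sum>b\<in>I v. dual v b)"
  show zZ: "?z \<in> Zn n" using assms(1) E_Zn dual_Zn by (blast intro: Zn_closed Ints_of_nat)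
  have z: "?z = real c *\<^sub>R shift v (1 / real c)"
    using assms(2) by (simp add: shift_def scaleR_add_right)
  show "?z \<in> interior_n n ((\<lambda>x. real c *\<^sub>R x) ` P)"
  proof (rule interior_scaled)
    fix u assume "u \<in> N"
    from assms(3)[OF this] have "real c * (mv u + 1 / real c) \<le> real c * ip n u (shift v (1 / real c))"
      by (intro mult_left_mono) auto
    then show "real c * mv u + 1 \<le> ip n u ?z" using assms(2) by (simp add: z ip_scaleR algebra_simps)
  qed (use assms(2) zZ Zn_subset_Rn in auto)
qed

text \<open>The \<open>LEAST\<close> in \<open>codeg\<close> needs a witness: for large
  \<open>c\<close> the shift of a vertex by \<open>1 / c\<close> satisfies all shifted facet
  inequalities.\<close>

lemma codeg_facts:
  shows "codeg n P > 0"
    and "\<exists>z\<in>Zn n. z \<in> interior_n n ((\<lambda>x. real (codeg n P) *\<^sub>R x) ` P)"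
    and "\<And>c. 0 < c \<Longrightarrow> c < codeg n P \<Longrightarrow> \<not> (\<exists>z\<in>Zn n. z \<in> interior_n n ((\<lambda>x. real c *\<^sub>R x) ` P))"
proof -
  obtain v where v: "v \<in> E" using E_nonempty by blast
  obtain t where t: "t > 0" "\<And>u s. u \<in> N \<Longrightarrow> 0 \<le> s \<Longrightarrow> s \<le> t \<Longrightarrow> ip n u (shift v s) \<ge> mv u + s"
    using shift_small[OF v] by blast
  obtain c :: nat where c: "c > 0" "1 / real c < t"
    using ex_inverse_of_nat_less[OF t(1)] by (auto simp: inverse_eq_divide)
  have "\<exists>z\<in>Zn n. z \<in> interior_n n ((\<lambda>x. real c *\<^sub>R x) ` P)"
    by (rule lattice_interior_point[OF v]) (use c t(2) in auto)
  then have ex: "\<exists>c>0. \<exists>z\<in>Zn n. z \<in> interior_n n ((\<lambda>x. real c *\<^sub>R x) ` P)" using c by blast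
  from LeastI_ex[OF ex] show "codeg n P > 0"
    "\<exists>z\<in>Zn n. z \<in> interior_n n ((\<lambda>x. real (codeg n P) *\<^sub>R x) ` P)"
    unfolding codeg_def by blast+
  show "\<not> (\<exists>z\<in>Zn n. z \<in> interior_n n ((\<lambda>x. real c *\<^sub>R x) ` P))" if "0 < c" "c < codeg n P" for c
    using not_less_Least[OF that(2)[unfolded codeg_def]] that(1) by blast
qed

lemma adjoint_iff: "x \<in> adjoint n P t \<longleftrightarrow> x \<in> Rn n \<and> (\<forall>u\<in>N. mv u + t \<le> ip n u x)"
  by (auto simp: adjoint_def N_def)

lemma adjoint_0: "adjoint n P 0 = P"
  by (rule set_eqI) (simp add: adjoint_iff mem_P_iff)

lemma I_nonempty: "n > 0 \<Longrightarrow> v \<in> E \<Longrightarrow> I v \<noteq> {}"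
  using I_facts(2)[of v] by auto

text \<open>Completeness of the normal fan in integral form: the coefficients of \<open>z\<close> in
  the basis at a minimising vertex are its values on the edge directions there, which are integral,
  and nonnegative by minimality.\<close>

lemma minimizing_combination:
  assumes "z \<in> Zn n"
  obtains v and c :: "pt \<Rightarrow> nat" where "v \<in> E" "mv z = ip n z v" "z = (\<Sum>b\<in>I v. real (c b) *\<^sub>R b)"
proof -
  obtain v where v: "v \<in> E" "mv z = ip n z v" "\<And>x. x \<in> P \<Longrightarrow> ip n z v \<le> ip n z x"
    by (rule minval_attained[of z]) blast
  have "\<exists>k::nat. ip n z (dual v b) = real k" if "b \<in> I v" for b
  proof -
    have "ip n z (dual v b) \<in> \<int>" using ip_Ints[OF assms] dual_Zn[OF v(1) that] by blast
    moreover have "ip n z (dual v b) \<ge> 0" using minimizer_dual_nonneg[OF v(1) that] v(3) by blast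
    ultimately show ?thesis by (metis Ints_cases nonneg_int_cases of_int_0_le_iff of_int_of_nat_eq)
  qed
  then obtain c where c: "\<And>b. b \<in> I v \<Longrightarrow> ip n z (dual v b) = real (c b)" by metis
  have "z = (\<Sum>b\<in>I v. ip n z (dual v b) *\<^sub>R b)"
    using I_expand[OF v(1)] assms Zn_subset_Rn by blast
  then have "z = (\<Sum>b\<in>I v. real (c b) *\<^sub>R b)" using c by simp
  then show ?thesis using that v by blast
qed

text \<open>Expanding \<open>- u\<close> nonnegatively in the normals at a vertex bounds
  \<open>ip n u x\<close> above on every adjoint polytope, independently of \<open>t\<close>,
  whereas the inequality of \<open>u\<close> itself asks for at least \<open>mv u + t\<close>. So
  the supremum defining \<sigma> is taken over a bounded set.\<close>

lemma adjoint_bounded: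
  assumes "n > 0"
  obtains K where "\<And>t. 0 \<le> t \<Longrightarrow> adjoint n P t \<noteq> {} \<Longrightarrow> t \<le> K"
proof -
  obtain v0 where "v0 \<in> E" using E_nonempty by blast
  then obtain u where u: "u \<in> N" using I_nonempty[OF assms] I_subset_N by blast
  then have "- u \<in> Zn n" using N_Zn by (blast intro: Zn_closed)
  then obtain v and c :: "pt \<Rightarrow> nat" where v: "v \<in> E" and c: "- u = (\<Sum>b\<in>I v. real (c b) *\<^sub>R b)"
    by (rule minimizing_combination)
  have "t \<le> - (mv u + (\<Sum>b\<in>I v. real (c b) * mv b))" if t: "0 \<le> t" and ne: "adjoint n P t \<noteq> {}" for t
  proof -
    obtain x where x: "x \<in> Rn n" "\<And>u. u \<in> N \<Longrightarrow> mv u + t \<le> ip n u x"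
      using ne unfolding ex_in_conv[symmetric] adjoint_iff by blast
    have "- ip n u x = ip n (- u) x" by (rule ip_minus(1)[symmetric])
    also have "\<dots> = (\<Sum>b\<in>I v. real (c b) * ip n b x)" unfolding c by (simp add: ip_sum ip_scaleR)
    also have "\<dots> \<ge> (\<Sum>b\<in>I v. real (c b) * mv b)"
    proof (intro sum_mono mult_left_mono)
      fix b assume "b \<in> I v"
      then have "mv b + t \<le> ip n b x" using x(2) I_subset_N by blast
      then show "mv b \<le> ip n b x" using t by simp
    qed simp
    finally show ?thesis using x(2)[OF u] by simp
  qed
  then show ?thesis by (rule that)
qed

text \<open>Equality of the fans provides a point \<open>x\<close> of the adjoint polytope with the
  normal cone of \<open>v\<close>. Were some \<open>b \<in> I v\<close> slack at \<open>x\<close>, a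
  small step along \<open>- dual v b\<close> would remain admissible and lower \<open>b\<close>,
  although \<open>b\<close> is in the cone at \<open>x\<close>. So \<open>x\<close> solves the
  equations that determine \<open>shift v t\<close>.\<close>

lemma shift_in_adjoint:
  assumes fan: "normal_fan n (adjoint n P t) = normal_fan n P" and v: "v \<in> E"
  shows "shift v t \<in> adjoint n P t"
proof -
  have "normal_cone n P v \<in> normal_fan n P" using E_P[OF v] by (simp add: normal_fan_def)
  then obtain x where x: "x \<in> adjoint n P t" "normal_cone n (adjoint n P t) x = normal_cone n P v"
    unfolding fan[symmetric] by (auto simp: normal_fan_def)
  have active: "u \<in> I v" if "u \<in> N" "ip n u x = mv u + t" for u
  proof -
    have "u \<in> normal_cone n (adjoint n P t) x"
      using that N_Rn by (auto simp: normal_cone_def adjoint_iff)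
    then have "u \<in> normal_cone n P v" by (simp only: x(2))
    then have le: "ip n u v \<le> ip n u y" if "y \<in> P" for y using that by (simp add: normal_cone_def)
    have "mv u = ip n u v" by (rule minval_eq[OF E_P[OF v]]) (rule le)
    then show ?thesis using that(1) by (simp add: I_def)
  qed
  have tight: "ip n b x = mv b + t" if b: "b \<in> I v" for b
  proof (rule ccontr)
    assume ne: "ip n b x \<noteq> mv b + t"
    define d where "d = dual v b"
    \<comment> \<open>Admissible step lengths along \<open>- d\<close>: the normals of
      \<open>I v\<close> other than \<open>b\<close> are constant along \<open>d\<close> and get the
      default 1, \<open>q'\<close> uses the slack of \<open>b\<close> itself, and the normals
      outside \<open>I v\<close> are slack at \<open>x\<close> by \<open>active\<close>.\<close>
    define q where "q u = (if u \<in> I v then 1 else (ip n u x - mv u - t) / (1 + \<bar>ip n u d\<bar>))" for u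
    define q' where "q' u = (if u = b then ip n b x - mv b - t else q u)" for u
    have slack: "ip n u x \<ge> mv u + t" if "u \<in> N" for u using x(1) that by (simp add: adjoint_iff)
    have bN: "b \<in> N" using b I_subset_N by blast
    have q0: "q' u > 0" if "u \<in> N" for u
    proof (cases "u = b \<or> u \<notin> I v")
      case True
      then have "ip n u x \<noteq> mv u + t" using ne active that by blast
      then have "ip n u x - mv u - t > 0" using slack[OF that] by simp
      then show ?thesis using True by (auto simp: q'_def q_def b intro!: divide_pos_pos add_pos_nonneg)
    qed (simp add: q'_def q_def)
    define \<epsilon> where "\<epsilon> = Min (q' ` N)"
    have e: "\<epsilon> > 0" "\<And>u. u \<in> N \<Longrightarrow> \<epsilon> \<le> q' u"
    proof -
      have "finite (q' ` N)" "q' ` N \<noteq> {}" using finite_N bN by auto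
      then show "\<epsilon> > 0" unfolding \<epsilon>_def using q0 by (subst Min_gr_iff) auto
      show "\<epsilon> \<le> q' u" if "u \<in> N" for u unfolding \<epsilon>_def using finite_N that by simp
    qed
    have "x - \<epsilon> *\<^sub>R d \<in> adjoint n P t"
      unfolding adjoint_iff
    proof (intro conjI ballI)
      show "x - \<epsilon> *\<^sub>R d \<in> Rn n"
        using x(1) dual_Zn[OF v b] Zn_subset_Rn by (auto simp: d_def adjoint_iff intro!: Rn_closed)
      fix u assume u: "u \<in> N"
      consider "u = b" | "u \<noteq> b" "u \<in> I v" | "u \<notin> I v" by blast
      then show "mv u + t \<le> ip n u (x - \<epsilon> *\<^sub>R d)"
      proof cases
        case 1
        then show ?thesis using e(2)[OF u] ip_dual[OF v b b] by (simp add: q'_def d_def ip_diff ip_scaleR)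
      next
        case 2
        then show ?thesis using ip_dual[OF v b, of u] slack[OF u] by (simp add: d_def ip_diff ip_scaleR)
      next
        case 3
        have pos: "1 + \<bar>ip n u d\<bar> > 0" by simp
        have "\<epsilon> \<le> (ip n u x - mv u - t) / (1 + \<bar>ip n u d\<bar>)"
        proof -
          have "u \<noteq> b" using 3 b by blast
          then show ?thesis using e(2)[OF u] 3 by (simp add: q'_def q_def)
        qed
        then have "\<epsilon> * (1 + \<bar>ip n u d\<bar>) \<le> ip n u x - mv u - t" using pos by (simp add: pos_le_divide_eq)
        moreover have "\<epsilon> * ip n u d \<le> \<epsilon> * (1 + \<bar>ip n u d\<bar>)" using e(1) by (intro mult_left_mono) auto
        ultimately show ?thesis by (simp add: ip_diff ip_scaleR)
      qed
    qed
    moreover have "b \<in> normal_cone n (adjoint n P t) x"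
      unfolding x(2) using b N_Rn minval_le by (auto simp: normal_cone_def I_def)
    ultimately have "ip n b x \<le> ip n b (x - \<epsilon> *\<^sub>R d)" by (simp add: normal_cone_def)
    then show False using e(1) ip_dual[OF v b b] by (simp add: d_def ip_diff ip_scaleR)
  qed
  have xR: "x \<in> Rn n" using x(1) by (simp add: adjoint_iff)
  have "x = (\<Sum>b\<in>I v. ip n b x *\<^sub>R dual v b)" by (rule dual_expand[OF v xR])
  also have "\<dots> = (\<Sum>b\<in>I v. ip n b (shift v t) *\<^sub>R dual v b)"
    using tight ip_shift_tight[OF v] by simp
  also have "\<dots> = shift v t" by (rule dual_expand[OF v shift_Rn[OF v], symmetric])
  finally show ?thesis using x(1) by simp
qed

end

section \<open>Q-normality and the largest shift\<close>

locale Q_normal_polytope = smooth_polytope +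
  assumes Q_normal: "Q_normal n P" and n_pos: "n > 0"
begin

abbreviation \<sigma> :: real where "\<sigma> \<equiv> sigma_P n P"

lemma sigma_upper: "0 \<le> t \<Longrightarrow> adjoint n P t \<noteq> {} \<Longrightarrow> t \<le> \<sigma>"
proof -
  assume t: "0 \<le> t" "adjoint n P t \<noteq> {}"
  obtain K where "\<And>t. 0 \<le> t \<Longrightarrow> adjoint n P t \<noteq> {} \<Longrightarrow> t \<le> K" using adjoint_bounded[OF n_pos] by blast
  then have "bdd_above {t. 0 \<le> t \<and> adjoint n P t \<noteq> {}}" by (intro bdd_aboveI[of _ K]) simp
  then show "t \<le> \<sigma>" unfolding sigma_P_def using t by (intro cSup_upper) auto
qed

lemma sigma_pos: "\<sigma> > 0"
proof -
  obtain v where v: "v \<in> E" using E_nonempty by blast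
  obtain t where t: "t > 0" "\<And>u s. u \<in> N \<Longrightarrow> 0 \<le> s \<Longrightarrow> s \<le> t \<Longrightarrow> ip n u (shift v s) \<ge> mv u + s"
    using shift_small[OF v] by blast
  have "shift v t \<in> adjoint n P t" using t shift_Rn[OF v] by (simp add: adjoint_iff)
  then have "t \<le> \<sigma>" using t(1) by (intro sigma_upper) auto
  then show ?thesis using t(1) by simp
qed

text \<open>For fixed \<open>v\<close> and \<open>u\<close> the inequality is affine in the shift
  \<open>t\<close>. It holds for every \<open>t\<close> that preserves the fan, hence at the
  supremum of these, which is \<sigma> by Q-normality; for \<open>k \<ge> 1\<close> it holds for all
  nonnegative \<open>t\<close>.\<close>

lemma shift_sigma:
  assumes v: "v \<in> E" and u: "u \<in> N"
  shows "mv u + \<sigma> \<le> ip n u (shift v \<sigma>)"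
proof -
  define k where "k = (\<Sum>b\<in>I v. ip n u (dual v b))"
  define S where "S = {t. t \<ge> 0 \<and> adjoint n P t \<noteq> {} \<and> normal_fan n (adjoint n P t) = normal_fan n P}"
  have Sup: "\<sigma> = Sup S" using Q_normal by (simp add: Q_normal_def lambda_P_def S_def)
  have "0 \<in> S" using E_P E_nonempty by (auto simp: S_def adjoint_0)
  have S: "mv u + t \<le> ip n u v + t * k" if "t \<in> S" for t
    using shift_in_adjoint[of t v] that v u by (auto simp: S_def adjoint_iff ip_shift k_def)
  have base: "mv u \<le> ip n u v" by (rule minval_le[OF E_P[OF v]])
  have "mv u + \<sigma> \<le> ip n u v + \<sigma> * k"
  proof (cases "k \<ge> 1")
    case True
    then have "\<sigma> * 1 \<le> \<sigma> * k" using sigma_pos by (intro mult_left_mono) auto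
    then show ?thesis using base by simp
  next
    case False
    have "\<sigma> \<le> (ip n u v - mv u) / (1 - k)"
      unfolding Sup using \<open>0 \<in> S\<close> False S by (intro cSup_least) (auto simp: pos_le_divide_eq algebra_simps)
    then show ?thesis using False by (simp add: pos_le_divide_eq algebra_simps)
  qed
  then show ?thesis by (simp add: ip_shift k_def)
qed

lemma not_strictly_feasible:
  assumes "q \<in> Rn n"
  obtains u where "u \<in> N" "ip n u q \<le> mv u + \<sigma>"
proof (rule ccontr)
  assume "\<not> thesis"
  then have gt: "ip n u q > mv u + \<sigma>" if "u \<in> N" for u using that \<open>\<not> thesis\<close> \<open>_ \<Longrightarrow> _ \<Longrightarrow> thesis\<close> not_le by blast
  define \<epsilon> where "\<epsilon> = Min (insert 1 ((\<lambda>u. ip n u q - mv u - \<sigma>) ` N))"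
  have e: "\<epsilon> > 0" using finite_N gt by (auto simp: \<epsilon>_def less_diff_eq add.commute)
  have "\<epsilon> \<le> ip n u q - mv u - \<sigma>" if "u \<in> N" for u using finite_N that by (simp add: \<epsilon>_def)
  then have "q \<in> adjoint n P (\<sigma> + \<epsilon>)" using assms by (fastforce simp: adjoint_iff)
  then have "\<sigma> + \<epsilon> \<le> \<sigma>" using e sigma_pos by (intro sigma_upper) auto
  then show False using e by simp
qed

text \<open>Otherwise \<open>1 / c \<le> \<sigma>\<close> for \<open>c = codeg n P - 1\<close>. The
  facet inequalities for the shifted vertex hold at 0 and at \<sigma>, hence in between, and the
  shift by \<open>1 / c\<close> gives an interior lattice point of a dilate that is too
  small.\<close>

lemma codeg_sigma: "real (codeg n P - 1) * \<sigma> < 1"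
proof (rule ccontr)
  assume neg: "\<not> ?thesis"
  define c where "c = codeg n P - 1"
  have c0: "c > 0" using neg unfolding c_def[symmetric] by (intro gr0I) auto
  obtain v where v: "v \<in> E" using E_nonempty by blast
  have "real c * \<sigma> \<ge> 1" using neg unfolding c_def[symmetric] by simp
  then have inv: "1 / real c \<le> \<sigma>" using c0 by (simp add: divide_le_eq mult.commute)
  have "mv u + 1 / real c \<le> ip n u (shift v (1 / real c))" if u: "u \<in> N" for u
  proof -
    define k where "k = (\<Sum>b\<in>I v. ip n u (dual v b))"
    define t where "t = 1 / real c"
    have t: "0 \<le> t" "t \<le> \<sigma>" using inv by (auto simp: t_def)
    have base: "mv u \<le> ip n u v" by (rule minval_le[OF E_P[OF v]])
    have top: "mv u + \<sigma> \<le> ip n u v + \<sigma> * k" using shift_sigma[OF v u] by (simp add: ip_shift k_def)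
    have "mv u + t \<le> ip n u v + t * k"
    proof (cases "k \<ge> 1")
      case True
      then have "t * 1 \<le> t * k" using t by (intro mult_left_mono) auto
      then show ?thesis using base by simp
    next
      case False
      then have "t * (1 - k) \<le> \<sigma> * (1 - k)" using t by (intro mult_right_mono) auto
      then show ?thesis using top by (simp add: algebra_simps)
    qed
    then show ?thesis by (simp add: ip_shift k_def t_def)
  qed
  from lattice_interior_point[OF v c0 this]
  show False using codeg_facts(3)[of c] c0 by (simp add: c_def)
qed

end

section \<open>Primitive collections with zero sum\<close>

lemma sum_if_subset:
  assumes "finite N" "A \<subseteq> N"
  shows "(\<Sum>w\<in>N. if w \<in> A then f w else 0) = sum f A"
  using assms by (simp add: sum.inter_restrict[symmetric] Int_absorb1)

context Q_normal_polytope
begin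

text \<open>The barycentre \<open>q\<close> of the points \<open>shift v \<sigma>\<close> cannot be
  slack on all facets, since \<sigma> is maximal. On a facet without slack at \<open>q\<close>, the
  nonnegative slacks of the individual points average to zero.\<close>

lemma central_normal:
  obtains u where "u \<in> N" "\<And>v. v \<in> E \<Longrightarrow> ip n u (shift v \<sigma>) = mv u + \<sigma>"
proof -
  define q where "q = (1 / real (card E)) *\<^sub>R (\<Sum>v\<in>E. shift v \<sigma>)"
  have "q \<in> Rn n" unfolding q_def by (intro Rn_closed shift_Rn)
  then obtain u where u: "u \<in> N" "ip n u q \<le> mv u + \<sigma>" by (rule not_strictly_feasible)
  have card: "real (card E) > 0" using finite_E E_nonempty by (simp add: card_gt_0_iff)
  have "ip n u q = (\<Sum>v\<in>E. ip n u (shift v \<sigma>)) / real (card E)"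
    by (simp add: q_def ip_scaleR ip_sum)
  then have "(\<Sum>v\<in>E. ip n u (shift v \<sigma>)) \<le> real (card E) * (mv u + \<sigma>)"
    using u(2) card by (simp add: pos_divide_le_eq mult.commute)
  then have le: "(\<Sum>v\<in>E. ip n u (shift v \<sigma>) - (mv u + \<sigma>)) \<le> 0"
    by (simp add: sum_subtractf)
  have nn: "0 \<le> ip n u (shift v \<sigma>) - (mv u + \<sigma>)" if "v \<in> E" for v
    using shift_sigma[OF that u(1)] by simp
  have "(\<Sum>v\<in>E. ip n u (shift v \<sigma>) - (mv u + \<sigma>)) = 0"
    using le sum_nonneg[of E "\<lambda>v. ip n u (shift v \<sigma>) - (mv u + \<sigma>)"] nn by fastforce
  then have "\<forall>v\<in>E. ip n u (shift v \<sigma>) - (mv u + \<sigma>) = 0"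
    using finite_E nn by (subst (asm) sum_nonneg_eq_0_iff) auto
  then show ?thesis using that[of u] u(1) by simp
qed

definition relation :: "(pt \<Rightarrow> nat) \<Rightarrow> bool" where
  "relation m \<longleftrightarrow> (\<Sum>u\<in>N. real (m u) *\<^sub>R u) = 0 \<and> (\<Sum>u\<in>N. real (m u) * (mv u + \<sigma>)) = 0 \<and> (\<exists>u\<in>N. m u > 0)"

text \<open>The relation is \<open>u + (- u) = 0\<close> for a normal \<open>u\<close> from
  \<open>central_normal\<close>, with \<open>- u\<close> expanded at a vertex \<open>v\<close>. All
  normals in it are tight at \<open>shift v \<sigma>\<close>, and pairing with this point gives
  degree zero.\<close>

lemma relation_exists: "\<exists>m. relation m"
proof -
  obtain u where u: "u \<in> N" "\<And>v. v \<in> E \<Longrightarrow> ip n u (shift v \<sigma>) = mv u + \<sigma>"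
    using central_normal by blast
  then have "- u \<in> Zn n" using N_Zn by (blast intro: Zn_closed)
  then obtain v and c :: "pt \<Rightarrow> nat" where v: "v \<in> E" and c: "- u = (\<Sum>b\<in>I v. real (c b) *\<^sub>R b)"
    by (rule minimizing_combination)
  define m where "m w = (if w \<in> {u} then 1 else 0) + (if w \<in> I v then c w else 0)" for w
  have split: "(\<Sum>w\<in>N. real (m w) *\<^sub>R f w) = f u + (\<Sum>b\<in>I v. real (c b) *\<^sub>R f b)"
    for f :: "pt \<Rightarrow> 'b::real_vector"
  proof -
    have "(\<Sum>w\<in>N. real (m w) *\<^sub>R f w) =
      (\<Sum>w\<in>N. (if w \<in> {u} then f w else 0) + (if w \<in> I v then real (c w) *\<^sub>R f w else 0))"
      by (intro sum.cong) (auto simp: m_def algebra_simps)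
    then show ?thesis
      using u(1) by (simp only: sum.distrib sum_if_subset[OF finite_N I_subset_N]
          sum_if_subset[OF finite_N, of "{u}"] empty_subsetI insert_subset simp_thms) simp
  qed
  have "(\<Sum>b\<in>I v. real (c b) * (mv b + \<sigma>)) = (\<Sum>b\<in>I v. real (c b) * ip n b (shift v \<sigma>))"
    using ip_shift_tight[OF v] by simp
  also have "\<dots> = ip n (- u) (shift v \<sigma>)" unfolding c by (simp add: ip_sum ip_scaleR)
  also have "\<dots> = - (mv u + \<sigma>)" using u(2)[OF v] by (simp only: ip_minus)
  finally have deg: "(\<Sum>w\<in>N. real (m w) * (mv w + \<sigma>)) = 0"
    using split[of "\<lambda>w. mv w + \<sigma>"] by simp
  have "(\<Sum>w\<in>N. real (m w) *\<^sub>R w) = u + - u" using split[of "\<lambda>w. w"] by (simp only: c)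
  then have "(\<Sum>w\<in>N. real (m w) *\<^sub>R w) = 0" by (simp only: right_minus)
  moreover have "m u > 0" by (simp add: m_def)
  ultimately show ?thesis using deg u(1) unfolding relation_def by blast
qed

text \<open>Batyrev's argument for the existence of a primitive collection with zero sum, carried out among
  the relations of degree zero with respect to the adjoint class. On these the degree of \<open>P\<close> is \<open>\<sigma>\<close>
  times the number of normals involved, so a relation with the fewest normals is wanted.\<close>

lemma primitive_collection_exists:
  obtains C where "C \<subseteq> N" "C \<noteq> {}" "(\<Sum>u\<in>C. u) = 0" "(\<Sum>u\<in>C. mv u + \<sigma>) = 0"
    "\<And>u. u \<in> C \<Longrightarrow> \<exists>v\<in>E. C - {u} \<subseteq> I v"
proof -
  define m where "m = (ARG_MIN (\<lambda>m. \<Sum>u\<in>N. m u) m. relation m)"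
  have rel: "relation m" unfolding m_def using relation_exists arg_min_natI by metis
  have min: "(\<Sum>u\<in>N. m u) \<le> (\<Sum>u\<in>N. m' u)" if "relation m'" for m'
    unfolding m_def using arg_min_nat_le[of relation m' "\<lambda>m. \<Sum>u\<in>N. m u"] that by simp
  define S where "S = {u \<in> N. m u > 0}"
  \<comment> \<open>The normals at one vertex are linearly independent: pairing the relation with
    \<open>dual v b\<close> isolates the coefficient \<open>m b\<close>.\<close>
  have S: "\<not> S \<subseteq> I v" if v: "v \<in> E" for v
  proof
    assume sub: "S \<subseteq> I v"
    obtain b where b: "b \<in> N" "m b > 0" using rel by (auto simp: relation_def)
    then have bI: "b \<in> I v" using sub by (auto simp: S_def)
    have "ip n (\<Sum>u\<in>N. real (m u) *\<^sub>R u) (dual v b) = (\<Sum>u\<in>N. real (m u) * ip n u (dual v b))"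
      by (simp add: ip_sum ip_scaleR)
    also have "\<dots> = (\<Sum>u\<in>N. if u \<in> {b} then real (m u) else 0)"
    proof (intro sum.cong refl)
      fix u assume "u \<in> N"
      then have "m u = 0 \<or> u \<in> I v" using sub by (auto simp: S_def)
      then show "real (m u) * ip n u (dual v b) = (if u \<in> {b} then real (m u) else 0)"
        using ip_dual[OF v bI] b by auto
    qed
    also have "\<dots> = real (m b)" using b by (subst sum_if_subset[OF finite_N]) auto
    finally show False using rel b by (simp add: relation_def)
  qed
  \<comment> \<open>A smallest part of the support that lies in no \<open>I v\<close>; every proper
    part obtained by removing one element then belongs to some vertex, as a primitive collection
    requires.\<close>
  define C where "C = (ARG_MIN card C. C \<subseteq> S \<and> (\<forall>v\<in>E. \<not> C \<subseteq> I v))"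
  have C: "C \<subseteq> S \<and> (\<forall>v\<in>E. \<not> C \<subseteq> I v)"
    unfolding C_def by (rule arg_min_natI[of _ S]) (use S in auto)
  have Cmin: "card C \<le> card C'" if "C' \<subseteq> S \<and> (\<forall>v\<in>E. \<not> C' \<subseteq> I v)" for C'
    unfolding C_def by (rule arg_min_nat_le) (rule that)
  have CN: "C \<subseteq> N" using C by (auto simp: S_def)
  have finC: "finite C" using CN finite_N finite_subset by blast
  have prim: "\<exists>v\<in>E. C - {u} \<subseteq> I v" if u: "u \<in> C" for u
  proof (rule ccontr)
    assume "\<not> ?thesis"
    then have "card C \<le> card (C - {u})" using C by (intro Cmin) blast
    then show False using u finC by (meson card_Diff1_less not_le)
  qed
  have "(\<Sum>u\<in>C. u) \<in> Zn n" using CN N_Zn by (intro Zn_closed) blast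
  then obtain v and c :: "pt \<Rightarrow> nat" where v: "v \<in> E" and "mv (\<Sum>u\<in>C. u) = ip n (\<Sum>u\<in>C. u) v"
    and c: "(\<Sum>u\<in>C. u) = (\<Sum>b\<in>I v. real (c b) *\<^sub>R b)"
    by (rule minimizing_combination)
  have comb: "(\<Sum>u\<in>C. ip n u x) = (\<Sum>b\<in>I v. real (c b) * ip n b x)" for x
  proof -
    have "(\<Sum>u\<in>C. ip n u x) = ip n (\<Sum>u\<in>C. u) x" by (simp add: ip_sum)
    then show ?thesis unfolding c by (simp add: ip_sum ip_scaleR)
  qed
  have lt: "(\<Sum>u\<in>C. mv u) < (\<Sum>b\<in>I v. real (c b) * mv b)"
  proof -
    obtain u where "u \<in> C" "u \<notin> I v" using C v by blast
    then have "mv u < ip n u v" using minval_le[OF E_P[OF v], of u] CN by (force simp: I_def)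
    then have "(\<Sum>u\<in>C. mv u) < (\<Sum>u\<in>C. ip n u v)"
      using \<open>u \<in> C\<close> minval_le[OF E_P[OF v]] by (intro sum_strict_mono_ex1 finC) auto
    also have "\<dots> = (\<Sum>b\<in>I v. real (c b) * mv b)" unfolding comb by (simp add: I_def)
    finally show ?thesis .
  qed
  \<comment> \<open>One copy of \<open>C\<close> is replaced by its expansion at \<open>v\<close>,
    which has the same sum. The subtraction does not truncate, because \<open>m\<close> is positive
    on \<open>C\<close>.\<close>
  define m' where "m' w = (m w - (if w \<in> C then 1 else 0)) + (if w \<in> I v then c w else 0)" for w
  have m1: "m w \<ge> 1" if "w \<in> C" for w using that C by (auto simp: S_def)
  have m': "real (m' w) = real (m w) - (if w \<in> C then 1 else 0) + (if w \<in> I v then real (c w) else 0)" for w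
    using m1[of w] by (auto simp: m'_def of_nat_diff)
  have split: "(\<Sum>w\<in>N. real (m' w) *\<^sub>R f w) =
      (\<Sum>w\<in>N. real (m w) *\<^sub>R f w) - sum f C + (\<Sum>b\<in>I v. real (c b) *\<^sub>R f b)"
    for f :: "pt \<Rightarrow> 'b::real_vector"
  proof -
    have "(\<Sum>w\<in>N. real (m' w) *\<^sub>R f w) = (\<Sum>w\<in>N. real (m w) *\<^sub>R f w - (if w \<in> C then f w else 0)
        + (if w \<in> I v then real (c w) *\<^sub>R f w else 0))"
      by (intro sum.cong refl) (simp add: m' algebra_simps)
    then show ?thesis
      by (simp only: sum.distrib sum_subtractf sum_if_subset[OF finite_N I_subset_N]
          sum_if_subset[OF finite_N CN])
  qed
  have zero': "(\<Sum>w\<in>N. real (m' w) *\<^sub>R w) = 0"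
    using split[of "\<lambda>w. w"] rel by (simp add: relation_def c)
  have deg': "(\<Sum>w\<in>N. real (m' w) * (mv w + \<sigma>)) =
      - (\<Sum>u\<in>C. mv u + \<sigma>) + (\<Sum>b\<in>I v. real (c b) * (mv b + \<sigma>))"
    using split[of "\<lambda>w. mv w + \<sigma>"] rel by (simp add: relation_def)
  \<comment> \<open>The point \<open>shift v \<sigma>\<close> bounds the degree of \<open>m'\<close>
    from both sides: all inequalities together give at most 0, while the exchange of
    \<open>C\<close> for normals tight at this point gives at least 0.\<close>
  have "(\<Sum>w\<in>N. real (m' w) * (mv w + \<sigma>)) \<le> (\<Sum>w\<in>N. real (m' w) * ip n w (shift v \<sigma>))"
    using shift_sigma[OF v] by (intro sum_mono mult_left_mono) auto
  also have "\<dots> = ip n (\<Sum>w\<in>N. real (m' w) *\<^sub>R w) (shift v \<sigma>)" by (simp add: ip_sum ip_scaleR)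
  also have "\<dots> = 0" by (simp add: zero')
  finally have le0: "(\<Sum>w\<in>N. real (m' w) * (mv w + \<sigma>)) \<le> 0" .
  have "(\<Sum>u\<in>C. mv u + \<sigma>) \<le> (\<Sum>u\<in>C. ip n u (shift v \<sigma>))"
    using shift_sigma[OF v] CN by (intro sum_mono) blast
  also have "\<dots> = (\<Sum>b\<in>I v. real (c b) * (mv b + \<sigma>))"
    unfolding comb using ip_shift_tight[OF v] by simp
  finally have deg0: "(\<Sum>w\<in>N. real (m' w) * (mv w + \<sigma>)) = 0" using le0 deg' by simp
  then have eq: "(\<Sum>u\<in>C. mv u + \<sigma>) = (\<Sum>b\<in>I v. real (c b) * (mv b + \<sigma>))" using deg' by simp
  then have "(\<Sum>u\<in>C. mv u) + real (card C) * \<sigma> = (\<Sum>b\<in>I v. real (c b) * mv b) + (\<Sum>b\<in>I v. real (c b)) * \<sigma>"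
    by (simp add: sum.distrib distrib_left sum_distrib_right)
  then have "(\<Sum>b\<in>I v. real (c b)) * \<sigma> < real (card C) * \<sigma>" using lt by simp
  then have lt': "(\<Sum>b\<in>I v. real (c b)) < real (card C)"
    using sigma_pos by (simp add: mult_less_cancel_right_pos)
  have "(\<Sum>w\<in>N. real (m' w)) = (\<Sum>w\<in>N. real (m w)) - real (card C) + (\<Sum>b\<in>I v. real (c b))"
    using split[of "\<lambda>w. 1 :: real"] by simp
  then have "real (\<Sum>w\<in>N. m' w) < real (\<Sum>w\<in>N. m w)" using lt' by simp
  \<comment> \<open>The exchange keeps both sums zero but uses fewer normals, so by minimality
    \<open>m'\<close> can fail to be a relation only by vanishing on \<open>N\<close>. Hence the
    expansion of the sum of \<open>C\<close> is empty.\<close>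
  then have "\<not> relation m'" using min[of m'] by linarith
  then have m'0: "m' w = 0" if "w \<in> N" for w using zero' deg0 that by (auto simp: relation_def)
  have c0: "c b = 0" if "b \<in> I v" for b
    using m'0[of b] that I_subset_N by (auto simp: m'_def)
  show ?thesis
  proof (rule that[of C])
    show "C \<noteq> {}" using C v by auto
    show "(\<Sum>u\<in>C. u) = 0" unfolding c using c0 by simp
    show "(\<Sum>u\<in>C. mv u + \<sigma>) = 0" unfolding eq using c0 by simp
  qed (use CN prim in auto)
qed

end

section \<open>Generalized Cayley polytopes\<close>

text \<open>A weighted mean of values equals their lower bound only if every value with nonzero
  weight does. Thus the whole normal fan is determined by the normal cones at finitely many
  generating points.\<close>

lemma normal_cone_combination:
  assumes "finite X" "\<And>v. v \<in> X \<Longrightarrow> c v \<ge> 0" "sum c X = 1" "\<And>v. v \<in> X \<Longrightarrow> g v \<in> Q"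
  shows "normal_cone m Q (\<Sum>v\<in>X. c v *\<^sub>R g v) =
    {w \<in> Rn m. \<forall>v\<in>X. c v \<noteq> 0 \<longrightarrow> w \<in> normal_cone m Q (g v)}"
proof (intro set_eqI iffI)
  let ?x = "\<Sum>v\<in>X. c v *\<^sub>R g v"
  have ipx: "ip m w ?x = (\<Sum>v\<in>X. c v * ip m w (g v))" for w by (simp add: ip_sum ip_scaleR)
  {
    fix w assume w: "w \<in> normal_cone m Q ?x"
    then have le: "\<And>y. y \<in> Q \<Longrightarrow> ip m w ?x \<le> ip m w y" by (simp add: normal_cone_def)
    have "(\<Sum>v\<in>X. c v * (ip m w (g v) - ip m w ?x)) = ip m w ?x - sum c X * ip m w ?x"
      unfolding right_diff_distrib sum_subtractf ipx[symmetric] sum_distrib_right[symmetric] by simp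
    also have "\<dots> = 0" using assms(3) by simp
    finally have "\<forall>v\<in>X. c v * (ip m w (g v) - ip m w ?x) = 0"
      using assms le by (subst (asm) sum_nonneg_eq_0_iff) auto
    then have "ip m w (g v) = ip m w ?x" if "v \<in> X" "c v \<noteq> 0" for v using that by auto
    then show "w \<in> {w \<in> Rn m. \<forall>v\<in>X. c v \<noteq> 0 \<longrightarrow> w \<in> normal_cone m Q (g v)}"
      using w le by (auto simp: normal_cone_def)
  next
    fix w assume w: "w \<in> {w \<in> Rn m. \<forall>v\<in>X. c v \<noteq> 0 \<longrightarrow> w \<in> normal_cone m Q (g v)}"
    have "ip m w ?x \<le> ip m w y" if "y \<in> Q" for y
    proof -
      have "(\<Sum>v\<in>X. c v * ip m w (g v)) \<le> (\<Sum>v\<in>X. c v * ip m w y)"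
      proof (intro sum_mono)
        fix v assume v: "v \<in> X"
        show "c v * ip m w (g v) \<le> c v * ip m w y"
        proof (cases "c v = 0")
          case False
          then have "ip m w (g v) \<le> ip m w y" using w v that by (simp add: normal_cone_def)
          then show ?thesis using assms(2)[OF v] by (rule mult_left_mono)
        qed simp
      qed
      also have "\<dots> = ip m w y" using assms(3) by (simp flip: sum_distrib_right)
      finally show ?thesis unfolding ipx .
    qed
    then show "w \<in> normal_cone m Q ?x" using w by (simp add: normal_cone_def)
  }
qed

text \<open>A point of the first hull is sent to the combination of the \<open>g v\<close> with the
  same weights; both have the same normal cone, namely the intersection of the cones that carry
  weight.\<close>

lemma normal_fan_subset:
  assumes "finite X" "\<And>v. v \<in> X \<Longrightarrow> g v \<in> X'"
    "\<And>v. v \<in> X \<Longrightarrow> normal_cone m (convex hull X) v = normal_cone m (convex hull X') (g v)"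
  shows "normal_fan m (convex hull X) \<subseteq> normal_fan m (convex hull X')"
proof
  fix K assume "K \<in> normal_fan m (convex hull X)"
  then obtain x where x: "x \<in> convex hull X" "K = normal_cone m (convex hull X) x"
    by (auto simp: normal_fan_def)
  then obtain c where c: "\<forall>v\<in>X. c v \<ge> 0" "sum c X = 1" "(\<Sum>v\<in>X. c v *\<^sub>R v) = x"
    unfolding convex_hull_finite[OF assms(1)] by blast
  have "K = {w \<in> Rn m. \<forall>v\<in>X. c v \<noteq> 0 \<longrightarrow> w \<in> normal_cone m (convex hull X) v}"
    unfolding x(2) c(3)[symmetric]
    using normal_cone_combination[of X c "\<lambda>v. v" "convex hull X" m] assms(1) c by (simp add: hull_inc)
  also have "\<dots> = {w \<in> Rn m. \<forall>v\<in>X. c v \<noteq> 0 \<longrightarrow> w \<in> normal_cone m (convex hull X') (g v)}"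
    using assms(3) by auto
  also have "\<dots> = normal_cone m (convex hull X') (\<Sum>v\<in>X. c v *\<^sub>R g v)"
    using normal_cone_combination[of X c g "convex hull X'" m] assms c by (simp add: hull_inc)
  finally have "K = normal_cone m (convex hull X') (\<Sum>v\<in>X. c v *\<^sub>R g v)" .
  moreover have "(\<Sum>v\<in>X. c v *\<^sub>R g v) \<in> convex hull X'"
    using assms c by (intro convex_sum) (auto simp: hull_inc)
  ultimately show "K \<in> normal_fan m (convex hull X')" unfolding normal_fan_def by blast
qed

context smooth_polytope
begin

text \<open>The lattice heights over the facets \<open>r 0\<close>, ..., \<open>r (n - 1)\<close>.
  When \<open>r\<close> enumerates \<open>I v\<close>, these are integral affine coordinates with
  origin \<open>v\<close>.\<close>

definition chart :: "(nat \<Rightarrow> pt) \<Rightarrow> pt \<Rightarrow> pt" where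
  "chart r x = (\<lambda>j. if j < n then ip n (r j) x - mv (r j) else 0)"

lemma chart_hull: "chart r ` (convex hull X) = convex hull (chart r ` X)"
proof -
  define L where "L x = (\<lambda>j. if j < n then ip n (r j) x else 0)" for x
  define a where "a = (\<lambda>j. if j < n then - mv (r j) else 0)"
  have "linear L" by (rule linearI) (auto simp: L_def fun_eq_iff ip_simps scaleR_pt_apply)
  moreover have "chart r = (\<lambda>x. a + x) \<circ> L" by (auto simp: chart_def a_def L_def fun_eq_iff)
  ultimately show ?thesis
    by (simp only: image_comp[symmetric] convex_hull_linear_image convex_hull_translation)
qed

text \<open>The rows of the matrix are the normals at \<open>v\<close>, and the columns of its
  inverse are the dual vectors. The floors only convert integral reals into integers.\<close>

lemma chart_iso:
  assumes v: "v \<in> E" and r: "bij_betw r {..<n} (I v)"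
  shows "lattice_iso n P n (chart r ` P)"
proof -
  have rI: "r j \<in> I v" if "j < n" for j using r that by (auto simp: bij_betw_def)
  then have rZ: "r j \<in> Zn n" if "j < n" for j using that I_subset_N N_Zn by blast
  define A where "A j l = \<lfloor>r j l\<rfloor>" for j l
  define B where "B l j = \<lfloor>dual v (r j) l\<rfloor>" for l j
  define b where "b j = \<lfloor>- mv (r j)\<rfloor>" for j
  have Ints_floor: "real_of_int \<lfloor>t\<rfloor> = t" if "t \<in> \<int>" for t :: real using that by (auto elim: Ints_cases)
  have A: "of_int (A j l) = r j l" if "j < n" for j l
    using rZ[OF that] by (simp add: A_def Zn_def Ints_floor)
  have B: "of_int (B l j) = dual v (r j) l" if "j < n" for j l
    using dual_Zn[OF v rI[OF that]] by (simp add: B_def Zn_def Ints_floor)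
  have b: "of_int (b j) = - mv (r j)" if "j < n" for j
    unfolding b_def by (rule Ints_floor) (use minval_Ints[OF rZ[OF that]] in simp)
  have inj: "r i = r j \<longleftrightarrow> i = j" if "i < n" "j < n" for i j
    using r that by (auto simp: bij_betw_def inj_on_def)
  have "unimodular n A"
    unfolding unimodular_def
  proof (intro exI[of _ B] allI impI conjI)
    fix i j assume i: "i < n" and j: "j < n"
    have "real_of_int (\<Sum>l<n. A i l * B l j) = ip n (r i) (dual v (r j))"
      using i j by (simp add: A B ip_def)
    also have "\<dots> = real_of_int (if i = j then 1 else 0)"
      using ip_dual[OF v rI[OF j] rI[OF i]] inj[OF i j] by simp
    finally show "(\<Sum>l<n. A i l * B l j) = (if i = j then 1 else 0)" by (simp only: of_int_eq_iff)
    have "unitv j \<in> Rn n" using unitv_Zn[OF j] Zn_subset_Rn by blast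
    then have "unitv j = (\<Sum>b\<in>I v. ip n b (unitv j) *\<^sub>R dual v b)" by (rule dual_expand[OF v])
    then have "unitv j i = (\<Sum>b\<in>I v. b j * dual v b i)"
      by (simp add: ip_unitv(2)[OF j] sum_fun_apply scaleR_pt_apply)
    also have "\<dots> = (\<Sum>l<n. r l j * dual v (r l) i)"
      by (rule sum.reindex_bij_betw[OF r, symmetric])
    also have "\<dots> = real_of_int (\<Sum>l<n. B i l * A l j)" by (simp add: A B mult.commute)
    finally have "unitv j i = real_of_int (\<Sum>l<n. B i l * A l j)" .
    moreover have "unitv j i = real_of_int (if i = j then 1 else 0)" by (simp add: unitv_def)
    ultimately have "real_of_int (\<Sum>l<n. B i l * A l j) = real_of_int (if i = j then 1 else 0)"
      by (simp only:)
    then show "(\<Sum>l<n. B i l * A l j) = (if i = j then 1 else 0)" by (simp only: of_int_eq_iff)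
  qed
  moreover have "aff_map n A b = chart r"
    by (auto simp: fun_eq_iff aff_map_def chart_def A b ip_def)
  ultimately show ?thesis unfolding lattice_iso_def by metis
qed

end

section \<open>Projection to a dilated simplex\<close>

locale primitive_collection = smooth_polytope +
  fixes C :: "pt set" and s k :: nat
  assumes C_N: "C \<subseteq> N" and C_sum: "(\<Sum>u\<in>C. u) = 0" and C_card: "card C = Suc k"
    and s_pos: "s > 0" and s_eq: "(\<Sum>u\<in>C. mv u) = - real s"
    and C_prim: "\<And>u. u \<in> C \<Longrightarrow> \<exists>v\<in>E. C - {u} \<subseteq> I v"
begin

text \<open>The vertices of \<open>P\<close> above that vertex of the dilated simplex at which the
  barycentric coordinate of \<open>u\<close> is \<open>s\<close> and all others vanish.\<close>

definition over :: "pt \<Rightarrow> pt set" where "over u = {v \<in> E. C - {u} \<subseteq> I v}"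

lemma finite_C: "finite C"
  using C_card by (metis Suc_not_Zero card.infinite)

lemma over_E: "v \<in> over u \<Longrightarrow> v \<in> E"
  by (simp add: over_def)

lemma ip_C: "(\<Sum>u\<in>C. ip n u x) = 0"
  using ip_sum(1)[of n "\<lambda>u. u" C x] C_sum by simp

lemma ip_C_remove: "u \<in> C \<Longrightarrow> ip n u x = - (\<Sum>w\<in>C - {u}. ip n w x)"
  using ip_C[of x] by (simp add: sum.remove[OF finite_C])

lemma height_over:
  assumes "u \<in> C" "v \<in> over u"
  shows "ip n u v = mv u + real s"
proof -
  have "(\<Sum>w\<in>C - {u}. ip n w v) = (\<Sum>w\<in>C - {u}. mv w)"
    using assms by (intro sum.cong) (auto simp: over_def I_def)
  moreover have "(\<Sum>w\<in>C. mv w) = mv u + (\<Sum>w\<in>C - {u}. mv w)"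
    by (rule sum.remove[OF finite_C assms(1)])
  ultimately show ?thesis using ip_C_remove[OF assms(1), of v] s_eq by simp
qed

lemma k_pos: "k > 0"
proof (rule ccontr)
  assume "\<not> k > 0"
  then obtain u where "C = {u}" using C_card by (auto simp: card_1_singleton_iff)
  then show False using C_sum C_N N_nonzero by auto
qed

lemma k_le: "k \<le> n"
proof -
  obtain u where u: "u \<in> C" using C_card by fastforce
  then obtain v where v: "v \<in> E" "C - {u} \<subseteq> I v" using C_prim by blast
  have "card (C - {u}) \<le> card (I v)" using v I_facts(1) by (intro card_mono) auto
  then show ?thesis using I_facts(2)[OF v(1)] C_card u finite_C by simp
qed

lemma height_sum: "(\<Sum>u\<in>C. ip n u x - mv u) = real s"
  by (simp add: sum_subtractf ip_C s_eq)

text \<open>The heights are nonnegative with sum \<open>s\<close>. If all are multiples of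
  \<open>s\<close>, one of them is \<open>s\<close> and the others are 0.\<close>

lemma vertex_if_heights_divisible:
  assumes v: "v \<in> E" and dvd: "\<And>u. u \<in> C \<Longrightarrow> \<exists>z::int. ip n u v - mv u = real s * of_int z"
  shows "\<exists>u\<in>C. C - {u} \<subseteq> I v"
proof -
  have nn: "ip n u v - mv u \<ge> 0" for u using minval_le[OF E_P[OF v]] by simp
  have "\<exists>u\<in>C. ip n u v - mv u \<noteq> 0"
  proof (rule ccontr)
    assume "\<not> ?thesis"
    then have "(\<Sum>u\<in>C. ip n u v - mv u) = 0" by (intro sum.neutral) blast
    then show False using height_sum s_pos by simp
  qed
  then obtain u where u: "u \<in> C" "ip n u v - mv u \<noteq> 0" by blast
  obtain z :: int where z: "ip n u v - mv u = real s * of_int z" using dvd[OF u(1)] by blast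
  have "0 < real s * of_int z" using u(2) nn[of u] z by linarith
  then have "z \<ge> 1" using s_pos by (simp add: zero_less_mult_iff)
  then have ge: "ip n u v - mv u \<ge> real s"
    using mult_left_mono[of 1 "real_of_int z" "real s"] z by simp
  have "(\<Sum>w\<in>C - {u}. ip n w v - mv w) \<le> 0"
    using height_sum[of v] ge by (simp add: sum.remove[OF finite_C u(1)])
  then have "(\<Sum>w\<in>C - {u}. ip n w v - mv w) = 0"
    using sum_nonneg[of "C - {u}" "\<lambda>w. ip n w v - mv w"] nn by fastforce
  then have "\<forall>w\<in>C - {u}. ip n w v - mv w = 0"
    using finite_C nn by (subst (asm) sum_nonneg_eq_0_iff) auto
  then have "C - {u} \<subseteq> I v" using C_N by (auto simp: I_def)
  then show ?thesis using u(1) by blast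
qed

text \<open>If \<open>k = n\<close>, the heights over the facets in \<open>C\<close> are barycentric coordinates, and \<open>P\<close> is a simplex.\<close>

lemma vertex_if_simplex:
  assumes kn: "k = n" and v: "v \<in> E"
  shows "\<exists>u\<in>C. C - {u} \<subseteq> I v"
proof -
  obtain p where p: "\<And>u. u \<in> C \<Longrightarrow> p u \<in> over u" using C_prim by (metis (no_types, lifting) mem_Collect_eq over_def)
  have pI: "I (p u) = C - {u}" if u: "u \<in> C" for u
  proof -
    have "C - {u} \<subseteq> I (p u)" "finite (I (p u))" "card (I (p u)) = card (C - {u})"
      using p[OF u] I_facts[OF over_E[OF p[OF u]]] C_card u finite_C kn by (auto simp: over_def)
    then show ?thesis by (metis card_subset_eq)
  qed
  \<comment> \<open>Both sides have the same value on every member of \<open>C\<close>, and by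
    \<open>pI\<close> the set \<open>C\<close> without \<open>u\<close> is the whole basis of
    normals at \<open>p u\<close>.\<close>
  have bary: "x = (\<Sum>u\<in>C. ((ip n u x - mv u) / real s) *\<^sub>R p u)" if x: "x \<in> P" for x
  proof -
    let ?y = "\<Sum>u\<in>C. ((ip n u x - mv u) / real s) *\<^sub>R p u"
    have same: "ip n w ?y = ip n w x" if w: "w \<in> C" for w
    proof -
      have "ip n w ?y = (\<Sum>u\<in>C. ((ip n u x - mv u) / real s) * ip n w (p u))"
        by (simp add: ip_sum ip_scaleR)
      also have "\<dots> = (\<Sum>u\<in>C. ((ip n u x - mv u) / real s) * mv w + (if u = w then ip n w x - mv w else 0))"
      proof (intro sum.cong refl)
        fix u assume u: "u \<in> C"
        show "((ip n u x - mv u) / real s) * ip n w (p u) =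
          ((ip n u x - mv u) / real s) * mv w + (if u = w then ip n w x - mv w else 0)"
        proof (cases "u = w")
          case True
          then show ?thesis using height_over[OF w p[OF w]] s_pos by (simp add: field_simps)
        next
          case False
          then have "w \<in> I (p u)" using pI[OF u] w by blast
          then show ?thesis using False by (simp add: I_def)
        qed
      qed
      also have "\<dots> = (\<Sum>u\<in>C. ip n u x - mv u) / real s * mv w + (ip n w x - mv w)"
        using w finite_C by (simp only: sum.distrib sum_divide_distrib sum_distrib_right) simp
      also have "\<dots> = ip n w x" using height_sum[of x] s_pos by simp
      finally show ?thesis .
    qed
    obtain u where u: "u \<in> C" using C_card by fastforce
    have yR: "?y \<in> Rn n" using p over_E E_Rn by (intro Rn_closed) blast
    have "x = (\<Sum>b\<in>I (p u). ip n b x *\<^sub>R dual (p u) b)"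
      using x P_Rn by (intro dual_expand over_E[OF p[OF u]]) blast
    also have "\<dots> = (\<Sum>b\<in>I (p u). ip n b ?y *\<^sub>R dual (p u) b)"
      using same pI[OF u] by (intro sum.cong) auto
    also have "\<dots> = ?y" by (rule dual_expand[OF over_E[OF p[OF u]] yR, symmetric])
    finally show ?thesis .
  qed
  have simplex: "P = convex hull (p ` C)"
  proof
    show "P \<subseteq> convex hull (p ` C)"
    proof
      fix x assume x: "x \<in> P"
      have "(\<Sum>u\<in>C. ((ip n u x - mv u) / real s) *\<^sub>R p u) \<in> convex hull (p ` C)"
      proof (rule convex_sum[OF finite_C convex_convex_hull])
        show "(\<Sum>u\<in>C. (ip n u x - mv u) / real s) = 1"
          using height_sum[of x] s_pos by (simp flip: sum_divide_distrib)
      qed (use minval_le[OF x] in \<open>auto simp: hull_inc\<close>)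
      then show "x \<in> convex hull (p ` C)" using bary[OF x] by simp
    qed
    have "p ` C \<subseteq> E" using p over_E by blast
    then show "convex hull (p ` C) \<subseteq> P" using hull_mono[of "p ` C" E convex] P_eq by blast
  qed
  have "v extreme_point_of P" using v by (simp add: E_def)
  then have "v extreme_point_of convex hull (p ` C)" by (simp only: simplex[symmetric])
  then obtain u where "u \<in> C" "v = p u" using extreme_point_of_convex_hull by blast
  then show ?thesis using p by (auto simp: over_def)
qed

end

section \<open>Fibres over the vertices of the simplex\<close>

locale cayley_polytope = primitive_collection +
  assumes C_vert: "\<And>v. v \<in> E \<Longrightarrow> \<exists>u\<in>C. C - {u} \<subseteq> I v"
begin

text \<open>The normals at \<open>v\<close> that vary along the fibre through \<open>v\<close>.
  Vertices of different fibres are matched by having equal \<open>rest\<close>.\<close>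

definition rest :: "pt \<Rightarrow> pt set" where "rest v = I v - C"

lemma I_over:
  assumes "u \<in> C" "v \<in> over u"
  shows "I v = (C - {u}) \<union> rest v" "(C - {u}) \<inter> rest v = {}"
proof -
  have "u \<notin> I v" using height_over[OF assms] s_pos by (simp add: I_def)
  then show "I v = (C - {u}) \<union> rest v" using assms by (auto simp: over_def rest_def)
  show "(C - {u}) \<inter> rest v = {}" by (auto simp: rest_def)
qed

lemma rest_card:
  assumes "u \<in> C" "v \<in> over u"
  shows "finite (rest v)" "k + card (rest v) = n"
proof -
  show fin: "finite (rest v)" using I_facts(1)[OF over_E[OF assms(2)]] by (simp add: rest_def)
  have "card (I v) = card (C - {u}) + card (rest v)"
    using I_over[OF assms] fin finite_C by (metis card_Un_disjoint finite_Diff)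
  then show "k + card (rest v) = n"
    using I_facts(2)[OF over_E[OF assms(2)]] C_card assms(1) finite_C by simp
qed

lemma face_over:
  assumes "x \<in> P" "\<And>w. w \<in> C - {u} \<Longrightarrow> ip n w x = mv w"
  shows "x \<in> convex hull (over u)"
proof -
  have "{y \<in> E. \<forall>w\<in>C - {u}. ip n w y = mv w} = over u"
    using C_N by (auto simp: over_def I_def)
  then show ?thesis using mem_face_hull[of x "C - {u}"] assms by simp
qed

text \<open>The edge at \<open>v\<close> leaving the facet of \<open>w\<close> leads to the fibre over the opposite vertex of the simplex.\<close>

lemma neighbour:
  assumes u: "u \<in> C" and v: "v \<in> over u" and w: "w \<in> C"
  obtains v' where "v' \<in> over w" "rest v' = rest v"
proof (cases "w = u")
  case True
  then show ?thesis using that v by blast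
next
  case False
  note vE = over_E[OF v]
  have wI: "w \<in> I v" using False v w by (auto simp: over_def)
  obtain \<epsilon> where e: "\<epsilon> > 0" "v + \<epsilon> *\<^sub>R dual v w \<in> P" by (rule dual_feasible[OF vE wI])
  let ?x = "v + \<epsilon> *\<^sub>R dual v w"
  let ?Y = "{y \<in> E. \<forall>f\<in>I v - {w}. ip n f y = mv f}"
  have "?x \<in> convex hull ?Y"
  proof (rule mem_face_hull[OF e(2)])
    fix f assume "f \<in> I v - {w}"
    then show "ip n f ?x = mv f" using ip_dual[OF vE wI, of f] by (simp add: ip_add ip_scaleR I_def)
  qed
  have "(\<Sum>c\<in>C - {u}. ip n c (dual v w)) = (\<Sum>c\<in>C - {u}. if c = w then 1 else 0)"
    using ip_dual[OF vE wI] v by (intro sum.cong) (auto simp: over_def)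
  also have "\<dots> = 1" using finite_C w False by simp
  \<comment> \<open>The heights over \<open>C\<close> have constant sum, and along this edge only
    those of \<open>w\<close> and \<open>u\<close> change, so \<open>u\<close> loses what
    \<open>w\<close> gains.\<close>
  finally have "ip n u (dual v w) = - 1" using ip_C_remove[OF u] by simp
  then have "ip n u ?x < mv u + real s" using e(1) height_over[OF u v] by (simp add: ip_add ip_scaleR)
  \<comment> \<open>A point of the edge with \<open>u\<close>-height below \<open>s\<close> forces a
    vertex of the same face with this property. Its full height \<open>s\<close> then belongs
    neither to \<open>u\<close> nor to any normal still tight on that face, which leaves
    \<open>w\<close>.\<close>
  then obtain y where y: "y \<in> ?Y" "ip n u y < mv u + real s"
    using hull_ip_ge[OF \<open>?x \<in> convex hull ?Y\<close>, of "mv u + real s" n u] by force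
  then have yE: "y \<in> E" by simp
  obtain c where c: "c \<in> C" "C - {c} \<subseteq> I y" using C_vert[OF yE] by blast
  then have yc: "y \<in> over c" using yE by (simp add: over_def)
  have hc: "ip n c y = mv c + real s" by (rule height_over[OF c(1) yc])
  have "c = w"
  proof (rule ccontr)
    assume "c \<noteq> w"
    moreover have "c \<noteq> u" using hc y(2) by auto
    ultimately have "c \<in> I v - {w}" using c(1) v by (auto simp: over_def)
    then show False using y(1) hc s_pos by auto
  qed
  then have yw: "y \<in> over w" using yc by simp
  have "rest v \<subseteq> rest y"
  proof
    fix f assume f: "f \<in> rest v"
    then have "f \<in> I v - {w}" "f \<in> N" using w I_subset_N by (auto simp: rest_def)
    then show "f \<in> rest y" using y(1) f by (auto simp: rest_def I_def)
  qed
  moreover have "card (rest v) = card (rest y)" using rest_card[OF u v] rest_card[OF w yw] by simp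
  ultimately have "rest v = rest y" using rest_card(1)[OF w yw] by (metis card_subset_eq)
  then show ?thesis using that yw by simp
qed

lemma dual_C:
  assumes "u \<in> C" "v \<in> over u" "b \<in> rest v" "w \<in> C"
  shows "ip n w (dual v b) = 0"
proof -
  have b: "b \<in> I v" "b \<notin> C" using assms(3) by (auto simp: rest_def)
  have z: "ip n w (dual v b) = 0" if "w \<in> C - {u}" for w
    using ip_dual[OF over_E[OF assms(2)] b(1), of w] b(2) that assms(2) by (auto simp: over_def)
  then have "ip n u (dual v b) = 0" using ip_C_remove[OF assms(1)] by simp
  then show ?thesis using z assms(4) by blast
qed

text \<open>In the basis at \<open>v'\<close>, the vector \<open>dual v b\<close> has no components
  along \<open>C\<close> by \<open>dual_C\<close>, and its components along the common
  \<open>rest\<close> are those of \<open>dual v' b\<close>. So matched vertices have parallel edges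
  in their fibres.\<close>

lemma dual_neighbour:
  assumes u: "u \<in> C" "v \<in> over u" and w: "w \<in> C" "v' \<in> over w" and eq: "rest v' = rest v" and b: "b \<in> rest v"
  shows "dual v b = dual v' b"
proof -
  have bI: "b \<in> I v" "b \<in> I v'" using b eq by (auto simp: rest_def)
  have "dual v b = (\<Sum>c\<in>I v'. ip n c (dual v b) *\<^sub>R dual v' c)"
    using dual_Zn[OF over_E[OF u(2)] bI(1)] Zn_subset_Rn by (intro dual_expand over_E[OF w(2)]) blast
  also have "\<dots> = (\<Sum>c\<in>I v'. if c = b then dual v' b else 0)"
  proof (intro sum.cong refl)
    fix c assume "c \<in> I v'"
    then consider "c \<in> C" | "c \<in> rest v" using eq by (auto simp: rest_def)
    then show "ip n c (dual v b) *\<^sub>R dual v' c = (if c = b then dual v' b else 0)"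
    proof cases
      case 1
      then show ?thesis using dual_C[OF u b] b by (auto simp: rest_def)
    next
      case 2
      then show ?thesis using ip_dual[OF over_E[OF u(2)] bI(1), of c] by (auto simp: rest_def)
    qed
  qed
  also have "\<dots> = dual v' b" using I_facts(1)[OF over_E[OF w(2)]] bI(2) by simp
  finally show ?thesis .
qed

text \<open>The two vertices agree on every normal at \<open>v\<close> except \<open>w\<close>,
  whose height rises from 0 to \<open>s\<close>. The factor \<open>s\<close> in front of an integral
  vector is the origin of the congruence between the fibres.\<close>

lemma neighbour_difference:
  assumes u: "u \<in> C" "v \<in> over u" and w: "w \<in> C" "v' \<in> over w" and eq: "rest v' = rest v" and ne: "w \<noteq> u"
  shows "v' - v = real s *\<^sub>R dual v w"
proof -
  have wI: "w \<in> I v" using u w ne by (auto simp: over_def)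
  have "v' - v \<in> Rn n" using over_E u w E_Rn by (blast intro: Rn_closed)
  then have "v' - v = (\<Sum>c\<in>I v. ip n c (v' - v) *\<^sub>R dual v c)" by (rule dual_expand[OF over_E[OF u(2)]])
  also have "\<dots> = (\<Sum>c\<in>I v. if c = w then real s *\<^sub>R dual v w else 0)"
  proof (intro sum.cong refl)
    fix c assume c: "c \<in> I v"
    show "ip n c (v' - v) *\<^sub>R dual v c = (if c = w then real s *\<^sub>R dual v w else 0)"
    proof (cases "c = w")
      case True
      then show ?thesis using c height_over[OF w] by (simp add: ip_diff I_def)
    next
      case False
      then have "c \<in> I v'" using c eq w by (auto simp: rest_def over_def)
      then show ?thesis using c False by (simp add: ip_diff I_def)
    qed
  qed
  also have "\<dots> = real s *\<^sub>R dual v w" using I_facts(1)[OF over_E[OF u(2)]] wI by simp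
  finally show ?thesis .
qed

end

lemma hull_UN_hull:
  "convex hull (\<Union>i\<in>J. convex hull (A i)) = convex hull (\<Union>i\<in>J. A i)"
proof
  have "convex hull (A i) \<subseteq> convex hull (\<Union>i\<in>J. A i)" if "i \<in> J" for i
    using that by (intro hull_mono) blast
  then show "convex hull (\<Union>i\<in>J. convex hull (A i)) \<subseteq> convex hull (\<Union>i\<in>J. A i)"
    by (intro hull_minimal[of "\<Union>i\<in>J. convex hull (A i)"]) auto
  have "A i \<subseteq> convex hull (A i)" for i by (rule hull_subset)
  then show "convex hull (\<Union>i\<in>J. A i) \<subseteq> convex hull (\<Union>i\<in>J. convex hull (A i))"
    by (intro hull_mono) blast
qed

section \<open>Coordinates adapted to the projection\<close>

locale cayley_chart = cayley_polytope +
  fixes us bs :: "nat \<Rightarrow> pt" and v0 :: pt and m :: nat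
  assumes us: "bij_betw us {..k} C" and v0: "v0 \<in> over (us 0)" and bs: "bij_betw bs {..<m} (rest v0)"
begin

lemma us_C: "i \<le> k \<Longrightarrow> us i \<in> C"
  using us by (auto simp: bij_betw_def)

lemma us_inj: "i \<le> k \<Longrightarrow> j \<le> k \<Longrightarrow> us i = us j \<longleftrightarrow> i = j"
  using us by (auto simp: bij_betw_def inj_on_def)

lemma bs_rest: "j < m \<Longrightarrow> bs j \<in> rest v0"
  using bs by (auto simp: bij_betw_def)

lemma m_k: "m + k = n"
  using rest_card(2)[OF us_C[of 0] v0] bij_betw_same_card[OF bs] by simp

text \<open>The first \<open>m\<close> coordinates run along the fibre, the last \<open>k\<close>
  are heights over the collection. The normal \<open>us 0\<close> is left out, since its height is
  determined by the others; its fibre lies over the origin of the simplex.\<close>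

definition r :: "nat \<Rightarrow> pt" where "r j = (if j < m then bs j else us (Suc (j - m)))"

lemma r_bij: "bij_betw r {..<n} (I v0)"
proof -
  have I0: "I v0 = (C - {us 0}) \<union> rest v0" by (rule I_over[OF us_C[of 0] v0]) simp
  have img: "r ` {..<n} = I v0"
  proof
    have "r j \<in> C - {us 0}" if "j < n" "\<not> j < m" for j
    proof -
      have "Suc (j - m) \<le> k" using that m_k by simp
      then show ?thesis using that us_C us_inj[of "Suc (j - m)" 0] by (simp add: r_def)
    qed
    moreover have "r j \<in> rest v0" if "j < m" for j using that bs_rest by (simp add: r_def)
    ultimately have "r j \<in> I v0" if "j < n" for j unfolding I0 using that by (cases "j < m") auto
    then show "r ` {..<n} \<subseteq> I v0" by auto
    show "I v0 \<subseteq> r ` {..<n}"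
    proof
      fix b assume "b \<in> I v0"
      then consider "b \<in> rest v0" | "b \<in> C" "b \<noteq> us 0" unfolding I0 by blast
      then show "b \<in> r ` {..<n}"
      proof cases
        case 1
        then obtain j where "j < m" "b = bs j" using bs by (auto simp: bij_betw_def)
        then show ?thesis using m_k by (intro image_eqI[of _ _ j]) (auto simp: r_def)
      next
        case 2
        then obtain i where i: "i \<le> k" "b = us i" using us by (auto simp: bij_betw_def)
        then have "i \<noteq> 0" using 2 by auto
        then show ?thesis using i m_k by (intro image_eqI[of _ _ "m + i - 1"]) (auto simp: r_def)
      qed
    qed
  qed
  moreover have "card (I v0) = n" by (rule I_facts(2)[OF over_E[OF v0]])
  ultimately show ?thesis unfolding bij_betw_def by (auto intro: eq_card_imp_inj_on)
qed

definition proj :: "pt \<Rightarrow> pt" where "proj x = (\<lambda>j. if j < m then chart r x j else 0)"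

definition fib :: "nat \<Rightarrow> pt set" where "fib i = convex hull (proj ` over (us i))"

lemma proj_apply: "j < m \<Longrightarrow> proj x j = ip n (bs j) x - mv (bs j)" "j \<ge> m \<Longrightarrow> proj x j = 0"
  using m_k by (auto simp: proj_def chart_def r_def)

lemma fib_image: "fib i = proj ` (convex hull (over (us i)))"
proof -
  define L where "L x = (\<lambda>j. if j < m then x j else 0)" for x :: pt
  have "linear L" by (rule linearI) (auto simp: L_def fun_eq_iff scaleR_pt_apply)
  moreover have "proj = L \<circ> chart r" by (auto simp: proj_def L_def fun_eq_iff)
  ultimately show ?thesis
    unfolding fib_def by (simp only: image_comp[symmetric] chart_hull convex_hull_linear_image)
qed

lemma fib_P: "x \<in> fib i \<Longrightarrow> \<exists>p\<in>P. x = proj p"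
proof -
  assume "x \<in> fib i"
  then obtain p where p: "p \<in> convex hull (over (us i))" "x = proj p" by (auto simp: fib_image)
  have "convex hull (over (us i)) \<subseteq> convex hull E" by (intro hull_mono) (auto simp: over_def)
  then have "p \<in> P" using p(1) P_eq by blast
  then show ?thesis using p(2) by blast
qed

lemma chart_over:
  assumes i: "i \<le> k" and v: "v \<in> over (us i)"
  shows "chart r v = proj v + (if i = 0 then 0 else real s *\<^sub>R unitv (m + i - 1))"
proof
  fix j
  consider "j < m" | l where "j = m + l" "l < k" | "j \<ge> n" using m_k by (metis add_diff_inverse_nat nat_add_left_cancel_less not_le)
  then show "chart r v j = (proj v + (if i = 0 then 0 else real s *\<^sub>R unitv (m + i - 1))) j"
  proof cases
    case 1
    then show ?thesis by (auto simp: proj_def scaleR_pt_apply unitv_def)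
  next
    case (2 l)
    have c: "chart r v (m + l) = ip n (us (Suc l)) v - mv (us (Suc l))"
      using 2 m_k by (simp add: chart_def r_def)
    show ?thesis
    proof (cases "i = Suc l")
      case True
      then show ?thesis using 2 height_over[OF us_C[OF i] v] by (simp add: c proj_def scaleR_pt_apply unitv_def)
    next
      case False
      have "us (Suc l) \<in> C - {us i}" using False 2 i us_C[of "Suc l"] us_inj[of "Suc l" i] by simp
      then have "ip n (us (Suc l)) v = mv (us (Suc l))" using v by (auto simp: over_def I_def)
      then show ?thesis using 2 False by (auto simp: c proj_def scaleR_pt_apply unitv_def)
    qed
  next
    case 3
    then show ?thesis using m_k i by (auto simp: chart_def proj_def scaleR_pt_apply unitv_def)
  qed
qed

lemma E_over: "E = (\<Union>i\<le>k. over (us i))"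
proof
  show "E \<subseteq> (\<Union>i\<le>k. over (us i))"
  proof
    fix v assume v: "v \<in> E"
    then obtain u where u: "u \<in> C" "C - {u} \<subseteq> I v" using C_vert by blast
    moreover obtain i where "i \<le> k" "u = us i" using us u(1) by (auto simp: bij_betw_def)
    ultimately show "v \<in> (\<Union>i\<le>k. over (us i))" using v by (auto simp: over_def)
  qed
qed (auto simp: over_def)

lemma chart_cayley: "chart r ` P = gen_cayley m k s fib"
proof -
  define t where "t i = (if i = 0 then 0 else real s *\<^sub>R unitv (m + i - 1))" for i
  have tr: "(\<lambda>x. x + t i) ` fib i = convex hull ((\<lambda>x. x + t i) ` proj ` over (us i))" for i
    using convex_hull_translation[of "t i" "proj ` over (us i)"] by (simp add: fib_def add.commute)
  have img: "(\<lambda>x. x + t i) ` proj ` over (us i) = chart r ` over (us i)" if "i \<le> k" for i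
    using chart_over[OF that] unfolding t_def by (force simp: image_image intro!: image_cong)
  have "gen_cayley m k s fib = convex hull (\<Union>i\<le>k. convex hull ((\<lambda>x. x + t i) ` proj ` over (us i)))"
    unfolding gen_cayley_def t_def[symmetric] tr ..
  also have "\<dots> = convex hull (\<Union>i\<le>k. (\<lambda>x. x + t i) ` proj ` over (us i))" by (rule hull_UN_hull)
  also have "(\<Union>i\<le>k. (\<lambda>x. x + t i) ` proj ` over (us i)) = chart r ` E"
    unfolding E_over image_UN using img by (intro SUP_cong) auto
  also have "convex hull (chart r ` E) = chart r ` (convex hull E)" by (rule chart_hull[symmetric])
  also have "\<dots> = chart r ` P" by (simp flip: P_eq)
  finally show ?thesis ..
qed

lemma over_nonempty: "i \<le> k \<Longrightarrow> over (us i) \<noteq> {}"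
  using C_prim[OF us_C] by (auto simp: over_def)

lemma proj_Rn: "proj x \<in> Rn m"
  by (simp add: Rn_def proj_def)

lemma bs_Zn: "j < m \<Longrightarrow> bs j \<in> Zn n"
  using bs_rest I_subset_N N_Zn by (force simp: rest_def)

lemma fib_lattice:
  assumes "i \<le> k"
  shows "lattice_polytope m (fib i)"
proof -
  have "proj v \<in> Zn m" if v: "v \<in> over (us i)" for v
  proof -
    have "ip n (bs j) v - mv (bs j) \<in> \<int>" if "j < m" for j
      using ip_Ints[OF bs_Zn[OF that]] minval_Ints[OF bs_Zn[OF that]] over_E[OF v] E_Zn by (auto intro: Ints_diff)
    then have "proj v j \<in> \<int>" for j by (cases "j < m") (auto simp: proj_apply)
    then show ?thesis using proj_Rn by (simp add: Zn_def)
  qed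
  moreover have "finite (over (us i))" using finite_E by (simp add: over_def)
  ultimately show ?thesis
    unfolding lattice_polytope_def fib_def using over_nonempty[OF assms]
    by (intro exI[of _ "proj ` over (us i)"]) auto
qed

section \<open>Normal fans and minimal values of the fibres\<close>

lemma fib_edge:
  assumes i: "i \<le> k" and v: "v \<in> over (us i)" and b: "b \<in> rest v"
  obtains \<epsilon> where "\<epsilon> > 0" "proj (v + \<epsilon> *\<^sub>R dual v b) \<in> fib i"
proof -
  have bI: "b \<in> I v" using b by (simp add: rest_def)
  obtain \<epsilon> where e: "\<epsilon> > 0" "v + \<epsilon> *\<^sub>R dual v b \<in> P" by (rule dual_feasible[OF over_E[OF v] bI])
  have "v + \<epsilon> *\<^sub>R dual v b \<in> convex hull (over (us i))"
  proof (rule face_over[OF e(2)])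
    fix w assume w: "w \<in> C - {us i}"
    then have "ip n w v = mv w" using v by (auto simp: over_def I_def)
    then show "ip n w (v + \<epsilon> *\<^sub>R dual v b) = mv w"
      using dual_C[OF us_C[OF i] v b] w by (simp add: ip_add ip_scaleR)
  qed
  then show ?thesis using that e(1) by (auto simp: fib_image)
qed

text \<open>The vertex matched with \<open>v0\<close> is tight on all \<open>bs j\<close>, so in
  these coordinates all fibres share the origin as a vertex.\<close>

lemma base_vertex:
  assumes "i \<le> k"
  obtains v where "v \<in> over (us i)" "rest v = rest v0" "proj v = 0"
proof -
  obtain v where v: "v \<in> over (us i)" "rest v = rest v0"
    by (rule neighbour[OF us_C[of 0] v0 us_C[OF assms]]) auto
  have "proj v j = 0" for j
  proof (cases "j < m")
    case True
    then have "bs j \<in> I v" using bs_rest v(2) by (auto simp: rest_def)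
    then show ?thesis using True by (simp add: proj_apply I_def)
  qed (simp add: proj_apply)
  then have "proj v = 0" by (simp add: fun_eq_iff)
  then show ?thesis using that v by blast
qed

lemma fib_zero: "i \<le> k \<Longrightarrow> 0 \<in> fib i"
proof -
  assume "i \<le> k"
  then obtain v where "v \<in> over (us i)" "proj v = 0" by (rule base_vertex)
  then show "0 \<in> fib i" unfolding fib_def by (intro hull_inc) (force intro: image_eqI)
qed

lemma fib_nonneg: "x \<in> fib i \<Longrightarrow> x j \<ge> 0"
  using fib_P[of x i] minval_le by (cases "j < m") (auto simp: proj_apply)

text \<open>At the base vertex the edge directions within the fibre are dual to the
  \<open>bs j\<close>, so they project to the unit vectors.\<close>

lemma fib_full:
  assumes i: "i \<le> k"
  shows "full_dim m (fib i)"
proof -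
  have sub: "fib i \<subseteq> Rn m" using proj_Rn by (auto simp: fib_image)
  have "affine hull (fib i) \<subseteq> Rn m" by (intro hull_minimal sub subspace_imp_affine subspace_Rn)
  moreover have "Rn m \<subseteq> affine hull (fib i)"
  proof -
    have span: "affine hull (fib i) = span (fib i)"
      using fib_zero[OF i] by (intro affine_hull_span_0 hull_inc)
    obtain v where v: "v \<in> over (us i)" "rest v = rest v0" "proj v = 0" by (rule base_vertex[OF i])
    have un: "unitv j \<in> span (fib i)" if j: "j < m" for j
    proof -
      have b: "bs j \<in> rest v" using bs_rest[OF j] v(2) by simp
      then have bI: "bs j \<in> I v" by (simp add: rest_def)
      obtain \<epsilon> where e: "\<epsilon> > 0" "proj (v + \<epsilon> *\<^sub>R dual v (bs j)) \<in> fib i" by (rule fib_edge[OF i v(1) b])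
      have "proj (v + \<epsilon> *\<^sub>R dual v (bs j)) = \<epsilon> *\<^sub>R unitv j"
      proof
        fix l
        show "proj (v + \<epsilon> *\<^sub>R dual v (bs j)) l = (\<epsilon> *\<^sub>R unitv j) l"
        proof (cases "l < m")
          case True
          have "bs l \<in> I v" using bs_rest[OF True] v(2) by (auto simp: rest_def)
          moreover have "bs l = bs j \<longleftrightarrow> l = j" using bs True j by (auto simp: bij_betw_def inj_on_def)
          ultimately show ?thesis
            using True ip_dual[OF over_E[OF v(1)] bI, of "bs l"]
            by (simp add: proj_apply ip_add ip_scaleR scaleR_pt_apply unitv_def I_def)
        next
          case False
          then show ?thesis using j by (simp add: proj_apply scaleR_pt_apply unitv_def)
        qed
      qed
      then have "\<epsilon> *\<^sub>R unitv j \<in> span (fib i)" using e(2) by (simp add: span_base)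
      then have "(1 / \<epsilon>) *\<^sub>R (\<epsilon> *\<^sub>R unitv j) \<in> span (fib i)" by (rule span_scale)
      then show ?thesis using e(1) by simp
    qed
    show ?thesis
    proof
      fix x assume "x \<in> Rn m"
      then have "x = (\<Sum>j<m. x j *\<^sub>R unitv j)" by (rule pt_expand)
      moreover have "(\<Sum>j<m. x j *\<^sub>R unitv j) \<in> span (fib i)"
        by (intro span_sum span_scale un) auto
      ultimately show "x \<in> affine hull (fib i)" by (simp add: span)
    qed
  qed
  ultimately show ?thesis by (simp add: full_dim_def)
qed

text \<open>The transpose of the linear part of \<open>proj\<close>: it pulls a functional on the
  fibre back to the ambient space.\<close>

definition lift :: "pt \<Rightarrow> pt" where "lift w = (\<Sum>j<m. w j *\<^sub>R bs j)"

lemma ip_proj: "ip m w (proj x) = ip n (lift w) x - (\<Sum>j<m. w j * mv (bs j))"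
  unfolding ip_def[of m] lift_def ip_sum ip_scaleR by (simp add: proj_apply right_diff_distrib sum_subtractf)

text \<open>The differences from \<open>v\<close> to other vertices of its fibre are nonnegative
  combinations of the edge directions \<open>dual v b\<close> with \<open>b \<in> rest v\<close>.
  The resulting description depends only on \<open>rest v\<close> and these directions, and matched
  vertices share both.\<close>

lemma fib_normal_cone:
  assumes i: "i \<le> k" and v: "v \<in> over (us i)"
  shows "normal_cone m (fib i) (proj v) = {w \<in> Rn m. \<forall>b\<in>rest v. 0 \<le> ip n (lift w) (dual v b)}"
proof (intro set_eqI iffI)
  fix w assume "w \<in> normal_cone m (fib i) (proj v)"
  then have w: "w \<in> Rn m" "\<And>y. y \<in> fib i \<Longrightarrow> ip m w (proj v) \<le> ip m w y" by (auto simp: normal_cone_def)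
  have "0 \<le> ip n (lift w) (dual v b)" if b: "b \<in> rest v" for b
  proof -
    obtain \<epsilon> where e: "\<epsilon> > 0" "proj (v + \<epsilon> *\<^sub>R dual v b) \<in> fib i" by (rule fib_edge[OF i v b])
    then have "0 \<le> \<epsilon> * ip n (lift w) (dual v b)" using w(2)[OF e(2)] by (simp add: ip_proj ip_add ip_scaleR)
    then show ?thesis using e(1) by (simp add: zero_le_mult_iff)
  qed
  then show "w \<in> {w \<in> Rn m. \<forall>b\<in>rest v. 0 \<le> ip n (lift w) (dual v b)}" using w(1) by blast
next
  fix w assume w: "w \<in> {w \<in> Rn m. \<forall>b\<in>rest v. 0 \<le> ip n (lift w) (dual v b)}"
  have "ip m w (proj v) \<le> ip m w y" if "y \<in> fib i" for y
  proof (rule hull_ip_ge[OF that[unfolded fib_def]])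
    fix z assume "z \<in> proj ` over (us i)"
    then obtain v' where v': "v' \<in> over (us i)" "z = proj v'" by blast
    have d: "v' - v \<in> Rn n" using over_E v v' E_Rn by (blast intro: Rn_closed)
    have "ip n (lift w) (v' - v) = (\<Sum>b\<in>I v. ip n b (v' - v) * ip n (lift w) (dual v b))"
      by (subst dual_expand[OF over_E[OF v] d]) (simp add: ip_sum ip_scaleR)
    also have "\<dots> \<ge> 0"
    proof (rule sum_nonneg)
      fix b assume b: "b \<in> I v"
      show "0 \<le> ip n b (v' - v) * ip n (lift w) (dual v b)"
      proof (cases "b \<in> rest v")
        case True
        moreover have "ip n b v \<le> ip n b v'" using b minval_le[OF E_P[OF over_E[OF v'(1)]]] by (simp add: I_def)
        ultimately show ?thesis using w by (auto simp: ip_diff intro!: mult_nonneg_nonneg)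
      next
        case False
        then have "b \<in> C - {us i}" using b I_over(1)[OF us_C[OF i] v] by blast
        then have "b \<in> I v'" using v'(1) by (auto simp: over_def)
        then show ?thesis using b by (simp add: ip_diff I_def)
      qed
    qed
    finally show "ip m w (proj v) \<le> ip m w z" by (simp add: v'(2) ip_proj ip_diff)
  qed
  then show "w \<in> normal_cone m (fib i) (proj v)" using w by (simp add: normal_cone_def)
qed

lemma fib_neighbour:
  assumes i: "i \<le> k" "v \<in> over (us i)" and j: "j \<le> k"
  obtains v' where "v' \<in> over (us j)" "rest v' = rest v"
    "normal_cone m (fib i) (proj v) = normal_cone m (fib j) (proj v')"
proof -
  obtain v' where v': "v' \<in> over (us j)" "rest v' = rest v"
    by (rule neighbour[OF us_C[OF i(1)] i(2) us_C[OF j]])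
  have "normal_cone m (fib i) (proj v) = normal_cone m (fib j) (proj v')"
    unfolding fib_normal_cone[OF i] fib_normal_cone[OF j v'(1)] v'(2)
    using dual_neighbour[OF us_C[OF i(1)] i(2) us_C[OF j] v'] by auto
  then show ?thesis using that v' by blast
qed

lemma fib_fan_subset:
  assumes i: "i \<le> k" and j: "j \<le> k"
  shows "normal_fan m (fib i) \<subseteq> normal_fan m (fib j)"
proof -
  have "\<exists>y. y \<in> proj ` over (us j) \<and> normal_cone m (fib i) x = normal_cone m (fib j) y"
    if x: "x \<in> proj ` over (us i)" for x
  proof -
    obtain v where v: "v \<in> over (us i)" "x = proj v" using x by blast
    obtain v' where "v' \<in> over (us j)" "normal_cone m (fib i) (proj v) = normal_cone m (fib j) (proj v')"
      by (rule fib_neighbour[OF i v(1) j])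
    then show ?thesis using v(2) by blast
  qed
  then obtain g where "\<And>x. x \<in> proj ` over (us i) \<Longrightarrow>
      g x \<in> proj ` over (us j) \<and> normal_cone m (fib i) x = normal_cone m (fib j) (g x)" by (metis (no_types))
  moreover have "finite (proj ` over (us i))" using finite_E by (simp add: over_def)
  ultimately show ?thesis unfolding fib_def by (intro normal_fan_subset[where g = g]) auto
qed

text \<open>Matched vertices have the same normal cone, so the minimum of \<open>w\<close> is
  attained at matched vertices of both fibres. Their difference is \<open>s\<close> times an
  integral vector.\<close>

lemma fib_minval_cong:
  assumes i: "i \<le> k" and w: "w \<in> Zn m"
  shows "\<exists>z::int. minval m (fib i) w - minval m (fib 0) w = real s * of_int z"
proof (cases "i = 0")
  case True
  then show ?thesis by (intro exI[of _ 0]) simp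
next
  case False
  have fin: "finite (over (us 0))" "over (us 0) \<noteq> {}" using finite_E v0 by (auto simp: over_def)
  then obtain v where v: "v \<in> over (us 0)" "\<And>y. y \<in> over (us 0) \<Longrightarrow> ip m w (proj v) \<le> ip m w (proj y)"
    using arg_min_if_finite(1)[of "over (us 0)" "\<lambda>y. ip m w (proj y)"]
      arg_min_least[of "over (us 0)" _ "\<lambda>y. ip m w (proj y)"] by blast
  have le: "ip m w (proj v) \<le> ip m w y" if "y \<in> fib 0" for y
    by (rule hull_ip_ge[OF that[unfolded fib_def]]) (use v(2) in auto)
  obtain v' where v': "v' \<in> over (us i)" "rest v' = rest v"
    "normal_cone m (fib 0) (proj v) = normal_cone m (fib i) (proj v')"
    by (rule fib_neighbour[OF _ v(1) i]) simp
  have "w \<in> normal_cone m (fib 0) (proj v)" using le w Zn_subset_Rn by (auto simp: normal_cone_def)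
  then have "w \<in> normal_cone m (fib i) (proj v')" by (simp only: v'(3))
  then have le': "ip m w (proj v') \<le> ip m w y" if "y \<in> fib i" for y using that by (simp add: normal_cone_def)
  have "minval m (fib 0) w = ip m w (proj v)"
    by (rule minval_eq) (use v(1) le in \<open>auto simp: fib_def hull_inc\<close>)
  moreover have "minval m (fib i) w = ip m w (proj v')"
    by (rule minval_eq) (use v'(1) le' in \<open>auto simp: fib_def hull_inc\<close>)
  ultimately have "minval m (fib i) w - minval m (fib 0) w = ip n (lift w) (v' - v)"
    by (simp add: ip_proj ip_diff)
  also have "v' - v = real s *\<^sub>R dual v (us i)"
    by (rule neighbour_difference) (use us_C us_inj[of i 0] i v v' False in auto)
  also have "ip n (lift w) (real s *\<^sub>R dual v (us i)) = real s * ip n (lift w) (dual v (us i))"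
    by (rule ip_scaleR)
  finally have eq: "minval m (fib i) w - minval m (fib 0) w = real s * ip n (lift w) (dual v (us i))" .
  have "us i \<in> I v" using v(1) us_C[OF i] us_inj[of i 0] i False by (auto simp: over_def)
  then have "dual v (us i) \<in> Zn n" using dual_Zn over_E[OF v(1)] by blast
  moreover have "lift w \<in> Zn n"
    unfolding lift_def using w bs_Zn by (intro Zn_closed) (auto simp: Zn_def)
  ultimately have "ip n (lift w) (dual v (us i)) \<in> \<int>" by (intro ip_Ints)
  then show ?thesis using eq by (auto elim!: Ints_cases)
qed

end

lemma (in cayley_polytope) cayley_isomorphism:
  obtains m fib where "m + k = n" "lattice_iso n P n (gen_cayley m k s fib)"
    "\<And>i. i \<le> k \<Longrightarrow> lattice_polytope m (fib i) \<and> full_dim m (fib i) \<and> 0 \<in> fib i"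
    "\<And>i x j. i \<le> k \<Longrightarrow> x \<in> fib i \<Longrightarrow> x j \<ge> 0"
    "\<And>i. i \<le> k \<Longrightarrow> normal_fan m (fib i) = normal_fan m (fib 0)"
    "\<And>i w. i \<le> k \<Longrightarrow> w \<in> Zn m \<Longrightarrow> \<exists>z::int. minval m (fib i) w - minval m (fib 0) w = real s * of_int z"
proof -
  obtain us where us: "bij_betw us {..k} C"
    using ex_bij_betw_nat_finite[OF finite_C] C_card by (auto simp: atLeast0LessThan lessThan_Suc_atMost)
  then have u0: "us 0 \<in> C" by (auto simp: bij_betw_def)
  then obtain v0 where v0: "v0 \<in> over (us 0)" using C_prim by (auto simp: over_def)
  obtain bs where bs: "bij_betw bs {..<card (rest v0)} (rest v0)"
    using ex_bij_betw_nat_finite[OF rest_card(1)[OF u0 v0]] by (auto simp: atLeast0LessThan)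
  interpret cayley_chart n P C s k us bs v0 "card (rest v0)"
    by unfold_locales (use us v0 bs in auto)
  show ?thesis
  proof (rule that[of "card (rest v0)" fib])
    show "lattice_iso n P n (gen_cayley (card (rest v0)) k s fib)"
      using chart_iso[OF over_E[OF v0] r_bij] by (simp add: chart_cayley)
    show "normal_fan (card (rest v0)) (fib i) = normal_fan (card (rest v0)) (fib 0)" if "i \<le> k" for i
      using fib_fan_subset[of i 0] fib_fan_subset[of 0 i] that by auto
  qed (use m_k fib_lattice fib_full fib_zero fib_nonneg fib_minval_cong in auto)
qed

section \<open>Classification\<close>

definition simplex_cylinder :: "nat \<Rightarrow> nat \<Rightarrow> nat \<Rightarrow> pt set" where
  "simplex_cylinder m k s = {y. (\<forall>i<k. 0 \<le> y (m + i)) \<and> (\<Sum>i<k. y (m + i)) \<le> real s}"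

lemma convex_simplex_cylinder: "convex (simplex_cylinder m k s)"
proof (rule convexI)
  fix x y and a b :: real
  assume *: "x \<in> simplex_cylinder m k s" "y \<in> simplex_cylinder m k s" "0 \<le> a" "0 \<le> b" "a + b = 1"
  have "(\<Sum>i<k. (a *\<^sub>R x + b *\<^sub>R y) (m + i)) = a * (\<Sum>i<k. x (m + i)) + b * (\<Sum>i<k. y (m + i))"
    by (simp add: scaleR_pt_apply sum.distrib sum_distrib_left)
  also have "\<dots> \<le> a * real s + b * real s"
    using * by (intro add_mono mult_left_mono) (auto simp: simplex_cylinder_def)
  also have "\<dots> = real s" using *(5) by (metis distrib_right mult_1)
  finally show "a *\<^sub>R x + b *\<^sub>R y \<in> simplex_cylinder m k s"
    using * by (auto simp: simplex_cylinder_def scaleR_pt_apply)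
qed

lemma dil_simplex_cylinder: "dil_simplex n s \<subseteq> simplex_cylinder 0 n s"
  unfolding dil_simplex_def
proof (intro hull_minimal convex_simplex_cylinder)
  have "(\<Sum>i<n. real s * unitv j i) = real s" if "j < n" for j
    using that by (simp add: unitv_def flip: sum_distrib_left)
  then show "insert 0 {real s *\<^sub>R unitv i |i. i < n} \<subseteq> simplex_cylinder 0 n s"
    by (auto simp: simplex_cylinder_def scaleR_pt_apply) (auto simp: unitv_def)
qed

lemma gen_cayley_cylinder:
  assumes "\<And>i. i \<le> k \<Longrightarrow> Ps i \<subseteq> Rn m"
  shows "gen_cayley m k s Ps \<subseteq> simplex_cylinder m k s"
  unfolding gen_cayley_def
proof (intro hull_minimal convex_simplex_cylinder UN_least image_subsetI)
  fix i x assume i: "i \<in> {..k}" and "x \<in> Ps i"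
  then have x: "x (m + l) = 0" for l using assms[of i] by (auto simp: Rn_def)
  show "x + (if i = 0 then 0 else real s *\<^sub>R unitv (m + i - 1)) \<in> simplex_cylinder m k s"
  proof (cases "i = 0")
    case True
    then show ?thesis using x by (simp add: simplex_cylinder_def)
  next
    case False
    have u: "unitv (m + i - 1) (m + l) = (if l = i - 1 then 1 else 0)" for l
      using False by (auto simp: unitv_def)
    have "(\<Sum>l<k. real s * (if l = i - 1 then 1 else 0)) = real s"
      using False i by (simp flip: sum_distrib_left)
    moreover have "(x + (if i = 0 then 0 else real s *\<^sub>R unitv (m + i - 1))) (m + l) =
        real s * (if l = i - 1 then 1 else 0)" for l
      using False by (simp only: plus_fun_apply scaleR_pt_apply x u if_False add_0)
    ultimately show ?thesis by (simp only: simplex_cylinder_def mem_Collect_eq) simp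
  qed
qed

text \<open>An interior point can be moved slightly along \<open>- u\<close> within the dilate, and
  \<open>ip n u u > 0\<close> makes the value drop strictly while it stays nonnegative.\<close>

lemma interior_strict:
  assumes u: "u \<in> Rn n" "u \<noteq> 0" and ge: "\<And>x. x \<in> P \<Longrightarrow> ip n u x + \<beta> \<ge> 0"
    and z: "z \<in> interior_n n ((\<lambda>x. c *\<^sub>R x) ` P)" and c: "c > 0"
  shows "ip n u z + c * \<beta> > 0"
proof -
  obtain e where e: "e > 0" "\<And>y. y \<in> Rn n \<Longrightarrow> (\<forall>i<n. \<bar>y i - z i\<bar> < e) \<Longrightarrow> y \<in> (\<lambda>x. c *\<^sub>R x) ` P"
    and zR: "z \<in> Rn n" using z by (auto simp: interior_n_def)
  define S where "S = (\<Sum>i<n. \<bar>u i\<bar>)"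
  have S: "S \<ge> 0" unfolding S_def by (intro sum_nonneg) simp
  define \<delta> where "\<delta> = e / (1 + S)"
  have d: "\<delta> > 0" using e(1) S by (simp add: \<delta>_def)
  have "\<bar>(z - \<delta> *\<^sub>R u) i - z i\<bar> < e" if "i < n" for i
  proof -
    have "\<bar>u i\<bar> \<le> S" unfolding S_def using that by (intro member_le_sum) auto
    then have "\<delta> * \<bar>u i\<bar> < \<delta> * (1 + S)" using d by (intro mult_strict_left_mono) auto
    also have "\<dots> = e" using S by (simp add: \<delta>_def)
    finally show ?thesis using d by (simp add: scaleR_pt_apply abs_mult)
  qed
  then obtain x where x: "x \<in> P" "z - \<delta> *\<^sub>R u = c *\<^sub>R x"
    using e(2)[of "z - \<delta> *\<^sub>R u"] zR u(1) by (auto intro: Rn_closed)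
  have "ip n u z - \<delta> * ip n u u = c * ip n u x"
    using arg_cong[OF x(2), of "ip n u"] by (simp add: ip_diff ip_scaleR)
  moreover have "c * (ip n u x + \<beta>) \<ge> 0" using ge[OF x(1)] c by simp
  moreover have "\<delta> * ip n u u > 0" using d ip_self_pos[OF u] by simp
  ultimately show ?thesis by (simp add: distrib_left)
qed

text \<open>\<open>Q\<close> enters only through the \<open>k\<close> coordinates from
  \<open>m\<close> on and their sum. Pulled back to the dilate by \<open>c\<close>, the barycentric
  forms add up to \<open>c * s\<close>, and at an integral point strict positivity means at least 1.
  For \<open>k = 0\<close> the last form has zero linear part, so this case is separate.\<close>

lemma interior_lattice_bound:
  assumes iso: "lattice_iso n P (m + k) Q" and Q: "Q \<subseteq> simplex_cylinder m k s" and s: "s > 0"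
    and z: "z \<in> Zn n" "z \<in> interior_n n ((\<lambda>x. real c *\<^sub>R x) ` P)" and c: "c > 0"
  shows "k + 1 \<le> c * s"
proof (cases "k = 0")
  case True
  then show ?thesis using s c by simp
next
  case False
  obtain A b where mk: "m + k = n" and A: "unimodular n A" and img: "aff_map n A b ` P = Q"
    using iso by (auto simp: lattice_iso_def)
  obtain B where B: "\<And>i j. i < n \<Longrightarrow> j < n \<Longrightarrow> (\<Sum>l<n. A i l * B l j) = (if i = j then 1 else 0)"
    using A unfolding unimodular_def by blast
  define row :: "nat \<Rightarrow> pt" where "row i = (\<lambda>l. if l < n then of_int (A (m + i) l) else 0)" for i
  \<comment> \<open>A column of the inverse matrix, used to see that the linear part of the last
    barycentric form is nonzero: it pairs to -1 with it.\<close>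
  define col :: pt where "col = (\<lambda>l. if l < n then of_int (B l m) else 0)"
  have rowZ: "row i \<in> Zn n" for i by (auto simp: row_def Zn_def Rn_def)
  have row_col: "ip n (row i) col = (if i = 0 then 1 else 0)" if "i < k" for i
  proof -
    have "ip n (row i) col = of_int (\<Sum>l<n. A (m + i) l * B l m)" by (simp add: ip_def row_def col_def)
    then show ?thesis using B[of "m + i" m] that mk False by simp
  qed
  have row0: "row i \<noteq> 0" if "i < k" for i
  proof
    assume "row i = 0"
    have "real_of_int (\<Sum>l<n. A (m + i) l * B l (m + i)) = (\<Sum>l<n. row i l * of_int (B l (m + i)))"
      by (simp add: row_def)
    also have "\<dots> = 0" using \<open>row i = 0\<close> by simp
    finally show False using B[of "m + i" "m + i"] that mk by simp
  qed
  have form: "aff_map n A b x (m + i) = ip n (row i) x + of_int (b (m + i))" if "i < k" for i x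
    using that mk by (simp add: aff_map_def row_def ip_def)
  have cyl: "aff_map n A b x \<in> simplex_cylinder m k s" if "x \<in> P" for x using img Q that by blast
  have ge1: "ip n u z + real c * of_int \<beta> \<ge> 1"
    if "u \<in> Zn n" "u \<noteq> 0" "\<And>x. x \<in> P \<Longrightarrow> ip n u x + of_int \<beta> \<ge> 0" for u \<beta>
  proof -
    have "ip n u z + real c * of_int \<beta> > 0"
      by (rule interior_strict[OF _ that(2,3) z(2)]) (use that(1) c Zn_subset_Rn in auto)
    moreover have "ip n u z + real c * of_int \<beta> \<in> \<int>" using ip_Ints[OF that(1) z(1)] by simp
    moreover have "1 \<le> t" if "t > 0" "t \<in> \<int>" for t :: real using that by (auto elim!: Ints_cases)
    ultimately show ?thesis by blast
  qed
  have rows: "ip n (row i) z + real c * of_int (b (m + i)) \<ge> 1" if "i < k" for i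
  proof (rule ge1[OF rowZ row0[OF that]])
    fix x assume "x \<in> P"
    then have "0 \<le> aff_map n A b x (m + i)" using cyl that by (simp add: simplex_cylinder_def)
    then show "0 \<le> ip n (row i) x + of_int (b (m + i))" using form[OF that] by simp
  qed
  define u where "u = - (\<Sum>i<k. row i)"
  have ipu: "ip n u x = - (\<Sum>i<k. ip n (row i) x)" for x by (simp only: u_def ip_minus ip_sum)
  have uZ: "u \<in> Zn n" unfolding u_def by (intro Zn_closed rowZ)
  have "ip n u col = - 1" unfolding ipu using False by (simp add: row_col)
  then have u0: "u \<noteq> 0" by auto
  have last: "ip n u z + real c * of_int (int s - (\<Sum>i<k. b (m + i))) \<ge> 1"
  proof (rule ge1[OF uZ u0])
    fix x assume "x \<in> P"
    then have "(\<Sum>i<k. aff_map n A b x (m + i)) \<le> real s" using cyl by (simp add: simplex_cylinder_def)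
    then show "0 \<le> ip n u x + of_int (int s - (\<Sum>i<k. b (m + i)))"
      by (simp add: form ipu sum.distrib)
  qed
  have "(\<Sum>i<k. ip n (row i) z + real c * of_int (b (m + i))) \<ge> (\<Sum>i<k. 1)"
    using rows by (intro sum_mono) auto
  then have "real k + 1 \<le> real c * real s"
    using last by (simp add: ipu sum.distrib sum_distrib_left algebra_simps)
  then have "real (k + 1) \<le> real (c * s)" by simp
  then show ?thesis by (simp only: of_nat_le_iff)
qed

lemma (in smooth_polytope) codeg_bound:
  assumes "lattice_iso n P (m + k) Q" "Q \<subseteq> simplex_cylinder m k s" "s > 0"
  shows "k + 1 \<le> codeg n P * s"
proof -
  obtain z where "z \<in> Zn n" "z \<in> interior_n n ((\<lambda>x. real (codeg n P) *\<^sub>R x) ` P)"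
    using codeg_facts(2) by blast
  then show ?thesis using interior_lattice_bound[OF assms] codeg_facts(1) by blast
qed

text \<open>The generator \<open>t\<close> with the largest coordinate is the right end of the
  interval, and 0 is the left one. The minimum of \<open>- unitv 0\<close> records the length, so a
  congruence of minimal values becomes one of lengths.\<close>

lemma lattice_interval:
  assumes F: "lattice_polytope 1 F" "full_dim 1 F" "0 \<in> F" and nn: "\<And>x. x \<in> F \<Longrightarrow> x 0 \<ge> 0"
  obtains a :: nat where "a \<ge> 1" "F = dil_simplex 1 a" "minval 1 F (- unitv 0) = - real a"
proof -
  obtain V where V: "finite V" "V \<noteq> {}" "V \<subseteq> Zn 1" "F = convex hull V"
    using F(1) by (auto simp: lattice_polytope_def)
  have VF: "V \<subseteq> F" unfolding V(4) by (rule hull_subset)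
  have ex: "x = x 0 *\<^sub>R unitv 0" if "x \<in> Rn 1" for x
    using pt_expand[OF that] by simp
  have VR: "V \<subseteq> Rn 1" using V(3) Zn_subset_Rn by blast
  obtain t where t: "t \<in> V" "\<And>v. v \<in> V \<Longrightarrow> v 0 \<le> t 0"
    using arg_min_if_finite(1)[OF V(1,2), of "\<lambda>v. - v 0"] arg_min_least[OF V(1,2), of _ "\<lambda>v. - v 0"]
    by force
  have "t 0 \<in> \<int>" "t 0 \<ge> 0" using t V(3) VF nn by (auto simp: Zn_def)
  then obtain a :: nat where a: "t 0 = real a" by (metis Ints_cases nonneg_int_cases of_int_0_le_iff of_int_of_nat_eq)
  have ta: "t = real a *\<^sub>R unitv 0" using ex[of t] t(1) VR unfolding a by blast
  have a1: "a \<ge> 1"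
  proof (rule ccontr)
    assume "\<not> a \<ge> 1"
    have "v = 0" if "v \<in> V" for v
    proof -
      have "v 0 = 0" using t(2)[OF that] nn[of v] VF that a \<open>\<not> a \<ge> 1\<close> by force
      then show ?thesis using ex[of v] VR that by (metis scaleR_zero_left subsetD)
    qed
    then have "V = {0}" using V(2) by auto
    then have "affine hull F = {0}" using V(4) by simp
    moreover have "unitv 0 \<in> Rn 1" using unitv_Zn[of 0 1] Zn_subset_Rn by auto
    moreover have "unitv 0 \<noteq> 0" by (auto simp: unitv_def fun_eq_iff)
    ultimately show False using F(2) by (auto simp: full_dim_def)
  qed
  have D: "dil_simplex 1 a = convex hull {0, t}"
    by (simp add: dil_simplex_def ta)
  have "F = dil_simplex 1 a"
  proof
    show "F \<subseteq> dil_simplex 1 a" unfolding V(4) D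
    proof (intro hull_minimal)
      show "V \<subseteq> convex hull {0, t}"
      proof
        fix v assume v: "v \<in> V"
        then have v0: "0 \<le> v 0" "v 0 \<le> real a" using nn VF t(2) a by auto
        have "v = (1 - v 0 / real a) *\<^sub>R 0 + (v 0 / real a) *\<^sub>R t"
        proof -
          have "(v 0 / real a) *\<^sub>R t = v 0 *\<^sub>R unitv 0" using a1 by (simp add: ta)
          also have "\<dots> = v" using ex[of v] v VR by (metis subsetD)
          finally show ?thesis by simp
        qed
        then show "v \<in> convex hull {0, t}" unfolding convex_hull_2
          using v0 a1 by (intro CollectI exI[of _ "1 - v 0 / real a"] exI[of _ "v 0 / real a"]) auto
      qed
    qed simp
    show "dil_simplex 1 a \<subseteq> F"
      unfolding D using F(3) t(1) VF V(4) by (intro hull_minimal) auto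
  qed
  moreover have "minval 1 F (- unitv 0) = - real a"
  proof -
    have ipu: "ip 1 (- unitv 0) x = - x 0" for x by (simp only: ip_minus ip_unitv zero_less_one)
    have "minval 1 F (- unitv 0) = ip 1 (- unitv 0) t"
    proof (rule minval_eq)
      fix x assume "x \<in> F"
      then show "ip 1 (- unitv 0) t \<le> ip 1 (- unitv 0) x"
        unfolding V(4) by (rule hull_ip_ge) (use t(2) in \<open>simp only: ipu neg_le_iff_le\<close>)
    qed (use t VF in auto)
    then show ?thesis by (simp only: ipu a)
  qed
  ultimately show ?thesis using that a1 by blast
qed

lemma gen_cayley_points:
  assumes "\<And>i. i \<le> k \<Longrightarrow> Ps i = {0}"
  shows "gen_cayley 0 k s Ps = dil_simplex k s"
proof -
  define f :: "nat \<Rightarrow> pt" where "f i = (if i = 0 then 0 else real s *\<^sub>R unitv (0 + i - 1))" for i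
  have "{..k} = insert 0 (Suc ` {..<k})"
    by (simp add: lessThan_Suc_eq_insert_0 flip: lessThan_Suc_atMost)
  then have "f ` {..k} = insert (f 0) ((\<lambda>i. f (Suc i)) ` {..<k})" by (simp add: image_image)
  also have "\<dots> = insert 0 {real s *\<^sub>R unitv i | i. i < k}" by (auto simp: f_def)
  finally have img: "f ` {..k} = insert 0 {real s *\<^sub>R unitv i | i. i < k}" .
  have "(\<lambda>x. x + f i) ` Ps i = {f i}" if "i \<in> {..k}" for i using assms that by simp
  then have "(\<Union>i\<le>k. (\<lambda>x. x + f i) ` Ps i) = f ` {..k}" by auto
  then show ?thesis unfolding gen_cayley_def dil_simplex_def f_def[symmetric] img by simp
qed

text \<open>For \<open>s = 2\<close> the bound gives \<open>k = n\<close>, or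
  \<open>k \<ge> n - 1\<close> when \<open>n\<close> is odd. For \<open>s \<ge> 3\<close> it gives
  \<open>3 * (n div 2) \<le> k \<le> n\<close>, so \<open>n \<le> 3\<close>; then either
  \<open>n = 1\<close>, or \<open>s \<le> k \<le> n\<close> leaves \<open>n = s = 3\<close>.\<close>

lemma classification_arithmetic:
  fixes n k s :: nat
  assumes "(n div 2) * s < k + 1" "k \<le> n" "k > 0" "s > 0"
  shows "s = 1 \<or> (k = n \<and> (n = 1 \<or> s = 2 \<or> n = 3 \<and> s = 3)) \<or> (s = 2 \<and> k + 1 = n \<and> odd n)"
proof -
  consider "s = 1" | "s = 2" | "s \<ge> 3" using assms(4) by linarith
  then show ?thesis
  proof cases
    case 2
    then show ?thesis using assms by (auto elim!: oddE evenE)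
  next
    case 3
    have "(n div 2) * 3 \<le> (n div 2) * s" using 3 by simp
    then have "(n div 2) * 3 \<le> k" using assms(1) by linarith
    then have "n div 2 \<le> 1" using assms(2) by linarith
    then consider "n div 2 = 0" | "n div 2 = 1" by linarith
    then show ?thesis
    proof cases
      case 1
      then show ?thesis using assms by auto
    next
      case 2
      then have "s \<le> k" using assms(1) by simp
      then show ?thesis using 2 3 assms(2) by auto
    qed
  qed auto
qed

section \<open>The two implications\<close>

definition classified :: "nat \<Rightarrow> pt set \<Rightarrow> bool" where
  "classified n P \<longleftrightarrow>
    ((\<exists>s::nat. s \<ge> 1 \<and> lattice_iso n P 1 (dil_simplex 1 s))
     \<or> lattice_iso n P 3 (dil_simplex 3 3)
     \<or> lattice_iso n P n (dil_simplex n 2)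
     \<or> (\<exists>m k Ps. 2 * real k \<ge> real n - 1 \<and>
          (\<forall>i\<le>k. lattice_polytope m (Ps i) \<and> full_dim m (Ps i)) \<and>
          (\<forall>i\<le>k. normal_fan m (Ps i) = normal_fan m (Ps 0)) \<and>
          lattice_iso n P (m + k) (gen_cayley m k 1 Ps))
     \<or> (odd n \<and> (\<exists>a::nat \<Rightarrow> nat. (\<forall>i<n. a i \<ge> 1) \<and>
          (\<forall>i<n. \<forall>j<n. a i mod 2 = a j mod 2) \<and>
          lattice_iso n P (1 + (n - 1)) (gen_cayley 1 (n - 1) 2 (\<lambda>i. dil_simplex 1 (a i))))))"

context smooth_polytope
begin

lemma codeg_if_classified:
  assumes "classified n P"
  shows "n + 1 \<le> 2 * codeg n P"
  using assms unfolding classified_def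
proof (elim disjE exE conjE)
  fix s assume "lattice_iso n P 1 (dil_simplex 1 s)"
  then show ?thesis using codeg_facts(1) by (auto simp: lattice_iso_def)
next
  assume iso: "lattice_iso n P 3 (dil_simplex 3 3)"
  \<comment> \<open>By integrality this gives codegree at least 2, as required for
    \<open>n = 3\<close>.\<close>
  have "3 + 1 \<le> codeg n P * 3"
    by (rule codeg_bound[of 0 3]) (use iso dil_simplex_cylinder[of 3 3] in auto)
  then show ?thesis using iso by (simp add: lattice_iso_def)
next
  assume iso: "lattice_iso n P n (dil_simplex n 2)"
  have "n + 1 \<le> codeg n P * 2"
    by (rule codeg_bound[of 0 n]) (use iso dil_simplex_cylinder[of n 2] in auto)
  then show ?thesis by simp
next
  fix m k and Ps :: "nat \<Rightarrow> pt set"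
  assume k: "real n - 1 \<le> 2 * real k" and Ps: "\<forall>i\<le>k. lattice_polytope m (Ps i) \<and> full_dim m (Ps i)"
    and iso: "lattice_iso n P (m + k) (gen_cayley m k 1 Ps)"
  have "Ps i \<subseteq> Rn m" if "i \<le> k" for i
  proof -
    have "affine hull (Ps i) = Rn m" using Ps that by (simp add: full_dim_def)
    then show ?thesis using hull_subset by metis
  qed
  then have "k + 1 \<le> codeg n P * 1" by (intro codeg_bound[OF iso] gen_cayley_cylinder) auto
  moreover have "n \<le> 2 * k + 1" using k by linarith
  ultimately show ?thesis by simp
next
  fix a :: "nat \<Rightarrow> nat"
  assume odd: "odd n" and iso: "lattice_iso n P (1 + (n - 1)) (gen_cayley 1 (n - 1) 2 (\<lambda>i. dil_simplex 1 (a i)))"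
  have "dil_simplex 1 b \<subseteq> Rn 1" for b
    unfolding dil_simplex_def
    by (rule convex_hull_subset_Rn) (auto simp: Rn_def scaleR_pt_apply unitv_def)
  then have "(n - 1) + 1 \<le> codeg n P * 2" by (intro codeg_bound[OF iso] gen_cayley_cylinder) auto
  \<comment> \<open>The cylinder only yields \<open>n \<le> 2 * c\<close>; the missing 1 comes from
    the parity of \<open>n\<close>.\<close>
  moreover have "n + 1 \<le> 2 * c" if "n - 1 + 1 \<le> c * 2" for c using that odd by presburger
  ultimately show ?thesis by blast
qed

end

context Q_normal_polytope
begin

lemma classified_if_codeg:
  assumes codeg: "n + 1 \<le> 2 * codeg n P"
  shows "classified n P"
proof -
  obtain C where CN: "C \<subseteq> N" and C0: "C \<noteq> {}" and Csum: "(\<Sum>u\<in>C. u) = 0"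
    and Cdeg: "(\<Sum>u\<in>C. mv u + \<sigma>) = 0" and Cprim: "\<And>u. u \<in> C \<Longrightarrow> \<exists>v\<in>E. C - {u} \<subseteq> I v"
    using primitive_collection_exists by metis
  have finC: "finite C" using CN finite_N finite_subset by blast
  then obtain k where k: "card C = Suc k" using C0 by (metis card_eq_0_iff not0_implies_Suc)
  have deg: "- (\<Sum>u\<in>C. mv u) = (real k + 1) * \<sigma>"
    using Cdeg k by (simp add: sum.distrib algebra_simps)
  have "(\<Sum>u\<in>C. mv u) \<in> \<int>" using minval_Ints CN N_Zn by (intro Ints_sum) blast
  moreover have pos: "- (\<Sum>u\<in>C. mv u) > 0" unfolding deg using sigma_pos by simp
  ultimately obtain z where z: "(\<Sum>u\<in>C. mv u) = of_int z" by (auto elim: Ints_cases)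
  define s where "s = nat (- z)"
  have s: "(\<Sum>u\<in>C. mv u) = - real s" "s > 0" using z pos by (auto simp: s_def)
  have s_sigma: "real s = (real k + 1) * \<sigma>" using deg s(1) by simp
  interpret primitive_collection n P C s k
    by unfold_locales (use CN Csum k s Cprim in auto)
  have "n div 2 \<le> codeg n P - 1" using codeg by linarith
  then have "real (n div 2) * \<sigma> \<le> real (codeg n P - 1) * \<sigma>" using sigma_pos by simp
  then have small: "real (n div 2) * \<sigma> < 1" using codeg_sigma by simp
  have "real (n div 2) * real s = (real (n div 2) * \<sigma>) * (real k + 1)" by (simp add: s_sigma)
  also have "\<dots> < 1 * (real k + 1)" using small by (intro mult_strict_right_mono) auto
  finally have "real ((n div 2) * s) < real (k + 1)" by simp
  then have bound: "(n div 2) * s < k + 1" by (simp only: of_nat_less_iff)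
  have height_int: "\<exists>z::int. ip n u v - mv u = of_int z" if "v \<in> E" "u \<in> C" for u v
  proof -
    have "u \<in> Zn n" using that CN N_Zn by blast
    moreover have "v \<in> Zn n" using that E_Zn by blast
    ultimately have "ip n u v - mv u \<in> \<int>" by (intro Ints_diff ip_Ints minval_Ints)
    then show ?thesis by (auto elim: Ints_cases)
  qed
  \<comment> \<open>The point \<open>shift v \<sigma>\<close> lies on all the shifted facets of \<open>C\<close>, so every height is an integral multiple of \<open>\<sigma>\<close>.\<close>
  have height_sigma: "\<exists>y::int. ip n u v - mv u = of_int y * \<sigma>" if v: "v \<in> E" and u: "u \<in> C" for u v
  proof -
    have nn: "0 \<le> ip n w (shift v \<sigma>) - (mv w + \<sigma>)" if "w \<in> C" for w
      using shift_sigma[OF v, of w] that CN by auto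
    have "(\<Sum>w\<in>C. ip n w (shift v \<sigma>) - (mv w + \<sigma>)) = 0"
      using Cdeg ip_C[of "shift v \<sigma>"] by (simp add: sum_subtractf)
    then have "\<forall>w\<in>C. ip n w (shift v \<sigma>) - (mv w + \<sigma>) = 0"
      using finC nn by (subst (asm) sum_nonneg_eq_0_iff) auto
    then have eq: "ip n u v + \<sigma> * (\<Sum>b\<in>I v. ip n u (dual v b)) = mv u + \<sigma>"
      using u by (simp add: ip_shift)
    have "(\<Sum>b\<in>I v. ip n u (dual v b)) \<in> \<int>"
      using u CN N_Zn dual_Zn[OF v] by (intro Ints_sum ip_Ints) auto
    then obtain y :: int where "(\<Sum>b\<in>I v. ip n u (dual v b)) = of_int y" by (auto elim: Ints_cases)
    then have "ip n u v - mv u = of_int (1 - y) * \<sigma>" using eq by (simp add: algebra_simps)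
    then show ?thesis by blast
  qed
  consider (line) "s = 1" | (simplex) "k = n" "n = 1 \<or> s = 2 \<or> n = 3 \<and> s = 3"
    | (conic) "s = 2" "k + 1 = n" "odd n"
    using classification_arithmetic[OF bound k_le k_pos s(2)] by blast
  then show ?thesis
  proof cases
    case line
    \<comment> \<open>For \<open>s = 1\<close> the divisibility of the heights is their
      integrality.\<close>
    interpret cayley_polytope n P C s k
    proof
      fix v assume v: "v \<in> E"
      show "\<exists>u\<in>C. C - {u} \<subseteq> I v"
        by (rule vertex_if_heights_divisible[OF v]) (use height_int[OF v] line in simp)
    qed
    obtain m fib where "m + k = n" "lattice_iso n P n (gen_cayley m k s fib)"
      and fib: "\<And>i. i \<le> k \<Longrightarrow> lattice_polytope m (fib i) \<and> full_dim m (fib i) \<and> 0 \<in> fib i"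
        "\<And>i. i \<le> k \<Longrightarrow> normal_fan m (fib i) = normal_fan m (fib 0)"
      by (rule cayley_isomorphism) blast
    then have iso: "lattice_iso n P (m + k) (gen_cayley m k 1 fib)" using line by simp
    have "n \<le> 2 * k + 1" using bound line by simp
    then have "real n - 1 \<le> 2 * real k" by linarith
    then show ?thesis using iso fib unfolding classified_def by blast
  next
    case simplex
    interpret cayley_polytope n P C s k
      by unfold_locales (rule vertex_if_simplex[OF simplex(1)])
    obtain m fib where mk: "m + k = n" and iso: "lattice_iso n P n (gen_cayley m k s fib)"
      and fib: "\<And>i. i \<le> k \<Longrightarrow> lattice_polytope m (fib i) \<and> full_dim m (fib i) \<and> 0 \<in> fib i"
      by (rule cayley_isomorphism) blast
    have m0: "m = 0" using mk simplex(1) by simp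
    have "fib i = {0}" if "i \<le> k" for i
    proof -
      have "fib i \<subseteq> Rn 0" using fib[OF that] m0 hull_subset by (metis full_dim_def)
      moreover have "Rn 0 = {0}" by (auto simp: Rn_def fun_eq_iff)
      ultimately show ?thesis using fib[OF that] by blast
    qed
    then have "gen_cayley 0 k s fib = dil_simplex k s" by (rule gen_cayley_points)
    then have "lattice_iso n P n (dil_simplex n s)" using iso m0 simplex(1) by simp
    then show ?thesis using simplex(2) s(2) unfolding classified_def by auto
  next
    case conic
    interpret cayley_polytope n P C s k
    proof
      fix v assume v: "v \<in> E"
      have "\<exists>z::int. ip n u v - mv u = real s * of_int z" if u: "u \<in> C" for u
      proof -
        obtain z y :: int where z: "ip n u v - mv u = of_int z" and y: "ip n u v - mv u = of_int y * \<sigma>"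
          using height_int[OF v u] height_sigma[OF v u] by blast
        \<comment> \<open>Here \<sigma> = 2 / n, so comparing the two expressions for the height
          gives \<open>z * n = 2 * y\<close>, and \<open>z\<close> is even because \<open>n\<close>
          is odd.\<close>
        have "real k + 1 = real n" using conic(2) by linarith
        then have "\<sigma> * real n = 2" using s_sigma conic(1) by (simp add: mult.commute)
        then have "real_of_int z * real n = real_of_int y * 2"
          using z y by (metis mult.assoc)
        then have "real_of_int (z * int n) = real_of_int (y * 2)" by simp
        then have "z * int n = y * 2" by (simp only: of_int_eq_iff)
        then have "even (z * int n)" by simp
        then have "even z" using conic(3) by simp
        then obtain x where "z = 2 * x" by (elim evenE)
        then show ?thesis using z conic(1) by (intro exI[of _ x]) simp
      qed
      then show "\<exists>u\<in>C. C - {u} \<subseteq> I v" by (rule vertex_if_heights_divisible[OF v])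
    qed
    obtain m fib where mk: "m + k = n" and iso: "lattice_iso n P n (gen_cayley m k s fib)"
      and fib: "\<And>i. i \<le> k \<Longrightarrow> lattice_polytope m (fib i) \<and> full_dim m (fib i) \<and> 0 \<in> fib i"
        "\<And>i x j. i \<le> k \<Longrightarrow> x \<in> fib i \<Longrightarrow> x j \<ge> 0"
        "\<And>i w. i \<le> k \<Longrightarrow> w \<in> Zn m \<Longrightarrow> \<exists>z::int. minval m (fib i) w - minval m (fib 0) w = real s * of_int z"
      by (rule cayley_isomorphism) blast
    have m1: "m = 1" using mk conic(2) by simp
    have "\<exists>a::nat. a \<ge> 1 \<and> fib i = dil_simplex 1 a \<and> minval 1 (fib i) (- unitv 0) = - real a" if "i \<le> k" for i
      using lattice_interval[of "fib i"] fib(1,2)[OF that] m1 by metis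
    then obtain a :: "nat \<Rightarrow> nat" where a: "\<And>i. i \<le> k \<Longrightarrow> a i \<ge> 1" "\<And>i. i \<le> k \<Longrightarrow> fib i = dil_simplex 1 (a i)"
      "\<And>i. i \<le> k \<Longrightarrow> minval 1 (fib i) (- unitv 0) = - real (a i)" by metis
    have cong: "a i mod 2 = a 0 mod 2" if i: "i \<le> k" for i
    proof -
      have "- unitv 0 \<in> Zn 1" by (rule Zn_closed(4)) (simp add: unitv_Zn)
      then obtain z :: int where "- real (a i) - - real (a 0) = 2 * of_int z"
        using fib(3)[OF i, of "- unitv 0"] m1 a(3)[OF i] a(3)[of 0] conic(1) by auto
      then have "real_of_int (int (a 0)) = real_of_int (int (a i) + 2 * z)" by simp
      then have "int (a 0) = int (a i) + 2 * z" by (simp only: of_int_eq_iff)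
      then have "even (int (a 0)) \<longleftrightarrow> even (int (a i))" by simp
      then show ?thesis by (simp add: mod2_eq_if)
    qed
    have "gen_cayley 1 k 2 fib = gen_cayley 1 k 2 (\<lambda>i. dil_simplex 1 (a i))"
      unfolding gen_cayley_def using a(2) by (intro arg_cong[where f = "\<lambda>S. convex hull S"] SUP_cong) auto
    moreover have "k = n - 1" using conic(2) by simp
    ultimately have "gen_cayley m k s fib = gen_cayley 1 (n - 1) 2 (\<lambda>i. dil_simplex 1 (a i))"
      using m1 conic(1) by (simp only:)
    then have iso': "lattice_iso n P (1 + (n - 1)) (gen_cayley 1 (n - 1) 2 (\<lambda>i. dil_simplex 1 (a i)))"
      using iso n_pos by simp
    have lt: "i \<le> k" if "i < n" for i using that conic(2) by simp
    have "\<forall>i<n. a i \<ge> 1" using a(1) lt by blast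
    moreover have "a i mod 2 = a j mod 2" if "i < n" "j < n" for i j
      using cong[OF lt[OF that(1)]] cong[OF lt[OF that(2)]] by (rule trans[OF _ sym])
    ultimately show ?thesis using iso' conic(3) unfolding classified_def by blast
  qed
qed

end

theorem theorem1p3:
  fixes n :: nat and P :: "pt set"
  assumes "lattice_polytope n P" and "full_dim n P"
    and "smooth n P" and "Q_normal n P"
  shows "real (codeg n P) \<ge> (real n + 1) / 2 \<longleftrightarrow>
    ((\<exists>s::nat. s \<ge> 1 \<and> lattice_iso n P 1 (dil_simplex 1 s))
     \<or> lattice_iso n P 3 (dil_simplex 3 3)
     \<or> lattice_iso n P n (dil_simplex n 2)
     \<or> (\<exists>m k Ps. 2 * real k \<ge> real n - 1 \<and>
          (\<forall>i\<le>k. lattice_polytope m (Ps i) \<and> full_dim m (Ps i)) \<and>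
          (\<forall>i\<le>k. normal_fan m (Ps i) = normal_fan m (Ps 0)) \<and>
          lattice_iso n P (m + k) (gen_cayley m k 1 Ps))
     \<or> (odd n \<and> (\<exists>a::nat \<Rightarrow> nat. (\<forall>i<n. a i \<ge> 1) \<and>
          (\<forall>i<n. \<forall>j<n. a i mod 2 = a j mod 2) \<and>
          lattice_iso n P (1 + (n - 1)) (gen_cayley 1 (n - 1) 2 (\<lambda>i. dil_simplex 1 (a i))))))"
proof -
  interpret smooth_polytope n P by unfold_locales (use assms in auto)
  have codeg: "real (codeg n P) \<ge> (real n + 1) / 2 \<longleftrightarrow> n + 1 \<le> 2 * codeg n P"
  proof -
    have "real (codeg n P) \<ge> (real n + 1) / 2 \<longleftrightarrow> real (n + 1) \<le> real (2 * codeg n P)" by auto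
    then show ?thesis by (simp only: of_nat_le_iff)
  qed
  have "classified n P" if "n + 1 \<le> 2 * codeg n P"
  \<comment> \<open>In dimension 0 there are no facet normals and the shifts are unbounded, so
    \<sigma> carries no information. The single point is covered by the family
    \<open>dil_simplex n 2\<close>.\<close>
  proof (cases "n = 0")
    case True
    have R0: "Rn 0 = {0}" by (auto simp: Rn_def fun_eq_iff)
    then have "P = {0}" using P_Rn E_P E_nonempty True by auto
    moreover have "dil_simplex 0 2 = {0}" by (simp add: dil_simplex_def)
    moreover have "aff_map 0 A b ` {0} = {0}" for A b by (auto simp: aff_map_def fun_eq_iff)
    ultimately have "lattice_iso n P n (dil_simplex n 2)"
      using True by (simp add: lattice_iso_def unimodular_def)
    then show ?thesis by (simp add: classified_def)
  next
    case False
    interpret Q_normal_polytope n P by unfold_locales (use assms False in auto)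
    show ?thesis by (rule classified_if_codeg[OF that])
  qed
  then show ?thesis unfolding codeg classified_def[symmetric] using codeg_if_classified by blast
qed

end
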